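(* Fix $\tau>0$ and $\mathbf{u}^0\in H_0^1(\Omega,\mathbb{R}^N)$, and assume that the damping coefficients $(\eta^k)_{k\ge 1}$ satisfy $$\frac{\omega}{k}\le \eta^k\le \omega_0\qquad\text{for all }k\ge 1,\ \text{ for some constants }\omega,\omega_0>0.$$ Let $\{\mathbf{u}^k\}_k$ be the sequence generated by the first-order convex-splitting scheme (defined in the context) with time step $\tau$, started from $\mathbf{u}^0$ and $\mathbf{v}^0\equiv\mathbf{0}$. Then there exists a subsequence of $\{\mathbf{u}^k\}_k$ that converges strongly in $H^1(\Omega,\mathbb{R}^N)$ to a stationary point of $E$.
   Context: $\Omega\subset\mathbb{R}^d$ ($d\in\{1,2,3\}$) is a bounded domain with $C^2$ boundary, $N\ge 1$, and $\alpha,\beta,\gamma>0$ are constants. $(\cdot,\cdot)$ is the $L^2(\Omega,\mathbb{R}^N)$ inner product and $a(\mathbf{u},\mathbf{v})=\int_\Omega\nabla\mathbf{u}:\nabla\mathbf{v}\,\mathrm{d}\mathbf{x}$. The energy is $$E(\mathbf{u})=\int_\Omega\Big(\tfrac12|\nabla\mathbf{u}|^2+\tfrac{\alpha}{4}|\mathbf{u}|^4-\tfrac{\beta}{2}|\mathbf{u}|^2+\gamma\Big)\mathrm{d}\mathbf{x},\qquad \mathbf{u}\in H_0^1(\Omega,\mathbb{R}^N).$$ A stationary point of $E$ is a function $\mathbf{u}\in H_0^1(\Omega,\mathbb{R}^N)$ with $a(\mathbf{u},\mathbf{z})+(\alpha|\mathbf{u}|^2\mathbf{u}-\beta\mathbf{u},\mathbf{z})=0$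 for all $\mathbf{z}\in H_0^1(\Omega,\mathbb{R}^N)$. First-order convex-splitting scheme: given $\tau>0$, positive numbers $\eta^k$ ($k\ge1$), $\mathbf{u}^0\in H_0^1(\Omega,\mathbb{R}^N)$ and $\mathbf{v}^0\equiv\mathbf{0}$ (equivalently $\mathbf{u}^{-1}=\mathbf{u}^0$), for each $k\ge0$ the pair $(\mathbf{u}^{k+1},\mathbf{v}^{k+1})$ with $\mathbf{u}^{k+1}\in H_0^1(\Omega,\mathbb{R}^N)$ is determined by $$\mathbf{v}^{k+1}-\mathbf{v}^k=-\tau\mu^{k+1}-\tau\eta^{k+1}\mathbf{v}^{k+1},\quad \mu^{k+1}=-\Delta\mathbf{u}^{k+1}+\alpha|\mathbf{u}^{k+1}|^2\mathbf{u}^{k+1}-\beta\mathbf{u}^k,\quad \mathbf{u}^{k+1}-\mathbf{u}^k=\tau\mathbf{v}^{k+1},$$ understood weakly, i.e. for all $\xi\in H_0^1(\Omega,\mathbb{R}^N)$ $$\Big(\tfrac{\mathbf{u}^{k+1}-2\mathbf{u}^k+\mathbf{u}^{k-1}}{\tau^2}+\eta^{k+1}\tfrac{\mathbf{u}^{k+1}-\mathbf{u}^k}{\tau},\xi\Big)=-a(\mathbf{u}^{k+1},\xi)-(\alpha|\mathbf{u}^{k+1}|^2\mathbf{u}^{k+1}-\beta\mathbf{u}^k,\xi).$$ For every $\mathbf{u}^k,\mathbf{u}^{k-1}\in H_0^1(\Omega,\mathbb{R}^N)$ this equation has a unique solution $\mathbf{u}^{k+1}$, so the sequence is well defined. *)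

theory Defs
  imports "HOL-Analysis.Analysis"
begin

section \<open>Differentiability classes and domains\<close>

text \<open>Intended for open \<open>S\<close>. All iterated partial derivatives up to order \<open>k\<close> exist and are
  continuous.\<close>

fun Ck_on :: "nat \<Rightarrow> 'a::euclidean_space set \<Rightarrow> ('a \<Rightarrow> 'b::real_normed_vector) \<Rightarrow> bool" where
  "Ck_on 0 S f \<longleftrightarrow> continuous_on S f"
| "Ck_on (Suc k) S f \<longleftrightarrow> (\<forall>x\<in>S. f differentiable (at x)) \<and>
     (\<forall>b\<in>Basis. Ck_on k S (\<lambda>x. frechet_derivative f (at x) b))"

definition test_function :: "'a::euclidean_space set \<Rightarrow> ('a \<Rightarrow> 'b::real_normed_vector) \<Rightarrow> bool" where
  "test_function \<Omega> \<phi> \<longleftrightarrow> (\<forall>k. Ck_on k UNIV \<phi>) \<and>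
     (\<exists>K. compact K \<and> K \<subseteq> \<Omega> \<and> (\<forall>x. x \<notin> K \<longrightarrow> \<phi> x = 0))"

text \<open>Near each boundary point, \<open>\<Omega>\<close> is the part of a ball lying strictly above the graph of a
  \<open>C\<^sup>k\<close> function over the hyperplane orthogonal to some unit vector \<open>e\<close>. A function on that
  hyperplane is represented by \<open>g\<close> composed with the orthogonal projection, so that no type for
  the space of dimension \<open>d - 1\<close> is needed.\<close>

definition Ck_boundary :: "nat \<Rightarrow> 'a::euclidean_space set \<Rightarrow> bool" where
  "Ck_boundary k \<Omega> \<longleftrightarrow> (\<forall>x0\<in>frontier \<Omega>. \<exists>r>0. \<exists>e g. norm e = 1 \<and> Ck_on k UNIV (g :: 'a \<Rightarrow> real) \<and>
     \<Omega> \<inter> ball x0 r = {x \<in> ball x0 r. x \<bullet> e > g (x - (x \<bullet> e) *\<^sub>R e)})"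

definition bounded_C2_domain :: "'a::euclidean_space set \<Rightarrow> bool" where
  "bounded_C2_domain \<Omega> \<longleftrightarrow>
     open \<Omega> \<and> connected \<Omega> \<and> \<Omega> \<noteq> {} \<and> bounded \<Omega> \<and> Ck_boundary 2 \<Omega>"

section \<open>Sobolev spaces\<close>

text \<open>Elements of \<open>L\<^sup>2\<close> and \<open>H\<^sup>1\<close> are represented by functions on the whole space; only their
  restriction to \<open>\<Omega>\<close> matters, and only up to null sets.\<close>

definition L2_fun :: "'a::euclidean_space set \<Rightarrow> ('a \<Rightarrow> 'b::euclidean_space) \<Rightarrow> bool" where
  "L2_fun \<Omega> f \<longleftrightarrow> f \<in> borel_measurable (lebesgue_on \<Omega>) \<and>
     integrable (lebesgue_on \<Omega>) (\<lambda>x. (norm (f x))\<^sup>2)"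

definition L2_inner ::
    "'a::euclidean_space set \<Rightarrow> ('a \<Rightarrow> 'b::euclidean_space) \<Rightarrow> ('a \<Rightarrow> 'b) \<Rightarrow> real" where
  "L2_inner \<Omega> f g = (LINT x|lebesgue_on \<Omega>. f x \<bullet> g x)"

text \<open>\<open>G x $ j $ i\<close> is the weak \<open>i\<close>-th partial derivative of the \<open>j\<close>-th component of \<open>u\<close>. The
  inner product and norm of the type \<open>real ^ 'd ^ 'n\<close> are those of Frobenius.\<close>

definition has_L2_weak_gradient ::
    "(real ^ 'd) set \<Rightarrow> (real ^ 'd \<Rightarrow> real ^ 'n) \<Rightarrow> (real ^ 'd \<Rightarrow> real ^ 'd ^ 'n) \<Rightarrow> bool" where
  "has_L2_weak_gradient \<Omega> u G \<longleftrightarrow> L2_fun \<Omega> G \<and>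
     (\<forall>\<phi> :: real ^ 'd \<Rightarrow> real. test_function \<Omega> \<phi> \<longrightarrow> (\<forall>i j.
        (LINT x|lebesgue_on \<Omega>. u x $ j * frechet_derivative \<phi> (at x) (axis i 1)) =
        - (LINT x|lebesgue_on \<Omega>. G x $ j $ i * \<phi> x)))"

definition H1 :: "(real ^ 'd) set \<Rightarrow> (real ^ 'd \<Rightarrow> real ^ 'n) set" where
  "H1 \<Omega> = {u. L2_fun \<Omega> u \<and> (\<exists>G. has_L2_weak_gradient \<Omega> u G)}"

text \<open>On open \<open>\<Omega>\<close> the weak gradient of an \<open>H\<^sup>1\<close> function is unique up to null sets, and all uses
  below are integrals over \<open>\<Omega>\<close>.\<close>

definition weak_gradient ::
    "(real ^ 'd) set \<Rightarrow> (real ^ 'd \<Rightarrow> real ^ 'n) \<Rightarrow> real ^ 'd \<Rightarrow> real ^ 'd ^ 'n" where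
  "weak_gradient \<Omega> u = (SOME G. has_L2_weak_gradient \<Omega> u G)"

definition dirichlet_form ::
    "(real ^ 'd) set \<Rightarrow> (real ^ 'd \<Rightarrow> real ^ 'n) \<Rightarrow> (real ^ 'd \<Rightarrow> real ^ 'n) \<Rightarrow> real" where
  "dirichlet_form \<Omega> u v = L2_inner \<Omega> (weak_gradient \<Omega> u) (weak_gradient \<Omega> v)"

definition H1_norm :: "(real ^ 'd) set \<Rightarrow> (real ^ 'd \<Rightarrow> real ^ 'n) \<Rightarrow> real" where
  "H1_norm \<Omega> u = sqrt (L2_inner \<Omega> u u + dirichlet_form \<Omega> u u)"

definition H1_tendsto ::
    "(real ^ 'd) set \<Rightarrow> (nat \<Rightarrow> real ^ 'd \<Rightarrow> real ^ 'n) \<Rightarrow> (real ^ 'd \<Rightarrow> real ^ 'n) \<Rightarrow> bool" where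
  "H1_tendsto \<Omega> f u \<longleftrightarrow> (\<forall>n. f n \<in> H1 \<Omega>) \<and> u \<in> H1 \<Omega> \<and>
     (\<lambda>n. H1_norm \<Omega> (\<lambda>x. f n x - u x)) \<longlonglongrightarrow> 0"

definition H10 :: "(real ^ 'd) set \<Rightarrow> (real ^ 'd \<Rightarrow> real ^ 'n) set" where
  "H10 \<Omega> = {u. \<exists>\<phi>. (\<forall>n. test_function \<Omega> (\<phi> n)) \<and> H1_tendsto \<Omega> \<phi> u}"

section \<open>Energy, stationary points and the convex-splitting scheme\<close>

definition energy ::
    "(real ^ 'd) set \<Rightarrow> real \<Rightarrow> real \<Rightarrow> real \<Rightarrow> (real ^ 'd \<Rightarrow> real ^ 'n) \<Rightarrow> real" where
  "energy \<Omega> \<alpha> \<beta> \<gamma> u = (LINT x|lebesgue_on \<Omega>.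
     1/2 * (norm (weak_gradient \<Omega> u x))\<^sup>2 + \<alpha>/4 * (norm (u x))^4 - \<beta>/2 * (norm (u x))\<^sup>2 + \<gamma>)"

text \<open>Stationary points of \<open>energy \<Omega> \<alpha> \<beta> \<gamma>\<close> are by definition the weak solutions in
  \<open>H\<^sub>0\<^sup>1\<close> of its Euler--Lagrange equation, in which \<open>\<gamma>\<close> does not occur.\<close>

definition stationary_point ::
    "(real ^ 'd) set \<Rightarrow> real \<Rightarrow> real \<Rightarrow> (real ^ 'd \<Rightarrow> real ^ 'n) \<Rightarrow> bool" where
  "stationary_point \<Omega> \<alpha> \<beta> u \<longleftrightarrow> u \<in> H10 \<Omega> \<and>
     (\<forall>z\<in>H10 \<Omega>. dirichlet_form \<Omega> u z +
        L2_inner \<Omega> (\<lambda>x. (\<alpha> * (norm (u x))\<^sup>2) *\<^sub>R u x - \<beta> *\<^sub>R u x) z = 0)"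

text \<open>The arguments \<open>up\<close>, \<open>u\<close>, \<open>un\<close> are the iterates \<open>u\<^sup>k\<^sup>-\<^sup>1\<close>, \<open>u\<^sup>k\<close>, \<open>u\<^sup>k\<^sup>+\<^sup>1\<close>, and \<open>h\<close> is the damping
  coefficient \<open>\<eta>\<^sup>k\<^sup>+\<^sup>1\<close>.\<close>

definition cs_step :: "(real ^ 'd) set \<Rightarrow> real \<Rightarrow> real \<Rightarrow> real \<Rightarrow> real \<Rightarrow>
    (real ^ 'd \<Rightarrow> real ^ 'n) \<Rightarrow> (real ^ 'd \<Rightarrow> real ^ 'n) \<Rightarrow> (real ^ 'd \<Rightarrow> real ^ 'n) \<Rightarrow> bool" where
  "cs_step \<Omega> \<alpha> \<beta> \<tau> h up u un \<longleftrightarrow> un \<in> H10 \<Omega> \<and>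
     (\<forall>\<xi>\<in>H10 \<Omega>.
        L2_inner \<Omega> (\<lambda>x. (un x - 2 *\<^sub>R u x + up x) /\<^sub>R \<tau>\<^sup>2 + h *\<^sub>R ((un x - u x) /\<^sub>R \<tau>)) \<xi> =
        - dirichlet_form \<Omega> un \<xi>
        - L2_inner \<Omega> (\<lambda>x. (\<alpha> * (norm (un x))\<^sup>2) *\<^sub>R un x - \<beta> *\<^sub>R u x) \<xi>)"

text \<open>The velocity \<open>v\<^sup>k\<^sup>+\<^sup>1 = (u\<^sup>k\<^sup>+\<^sup>1 - u\<^sup>k) / \<tau>\<close> is eliminated; the initial velocity \<open>v0\<close> enters
  through the ghost iterate \<open>u\<^sup>-\<^sup>1 = u\<^sup>0 - \<tau> v\<^sup>0\<close>.\<close>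

definition cs_scheme :: "(real ^ 'd) set \<Rightarrow> real \<Rightarrow> real \<Rightarrow> real \<Rightarrow> (nat \<Rightarrow> real) \<Rightarrow>
    (real ^ 'd \<Rightarrow> real ^ 'n) \<Rightarrow> (real ^ 'd \<Rightarrow> real ^ 'n) \<Rightarrow> (nat \<Rightarrow> real ^ 'd \<Rightarrow> real ^ 'n) \<Rightarrow> bool" where
  "cs_scheme \<Omega> \<alpha> \<beta> \<tau> \<eta> u0 v0 u \<longleftrightarrow> u 0 = u0 \<and>
     (\<forall>k. cs_step \<Omega> \<alpha> \<beta> \<tau> (\<eta> (k + 1))
        (if k = 0 then (\<lambda>x. u0 x - \<tau> *\<^sub>R v0 x) else u (k - 1)) (u k) (u (k + 1)))"

end

theory Submission
  imports Defs "HOL-Complex_Analysis.Great_Picard"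
begin

text \<open>The mechanism is energy decay plus compactness. Testing a step of the scheme with
\<open>u\<^sup>k\<^sup>+\<^sup>1 - u\<^sup>k\<close>, the implicit terms are handled by convexity, while the concave term
\<open>- \<beta>/2 |u|\<^sup>2\<close>, being treated explicitly, contributes \<open>\<beta>/2 |u\<^sup>k\<^sup>+\<^sup>1 - u\<^sup>k|\<^sup>2\<close> with a favourable sign
(\<open>cs_step_energy_decay\<close>). The energy is bounded below, so the iterates stay bounded in \<open>H\<^sup>1\<close>
and the increments tend to \<open>0\<close> in \<open>L\<^sup>2\<close>. As the damping coefficients are bounded, \<open>u\<^sup>k\<^sup>+\<^sup>1\<close> then
satisfies the Euler--Lagrange equation up to a residual that tends to \<open>0\<close> in \<open>L\<^sup>2\<close>.

Bounded sequences with this property converge along a subsequence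
(\<open>almost_stationary_compact\<close>). Rellich's theorem (\<open>H10_rellich\<close>) gives a subsequence that is Cauchy
in \<open>L\<^sup>2\<close>. Subtracting the equations of two of its members and testing with their difference, the
cubic terms contribute a nonnegative quantity, so the gradients are Cauchy as well. The spaces
are complete (\<open>H1_complete\<close>, \<open>H10_closed\<close>), and the embedding of \<open>H\<^sub>0\<^sup>1\<close> into \<open>L\<^sup>4\<close> (\<open>H10_L4\<close>) makes the
cubic term meaningful and lets it pass to the limit.

The functional analysis rests on two facts about test functions. First, a weak gradient is
unique up to null sets (\<open>has_L2_weak_gradient_unique\<close>), so that the chosen representative depends
linearly on the function and agrees with the classical gradient of a test function. Second,
\<open>|\<phi> (x + s) - \<phi> x| \<le> |s| \<integral>\<^sub>0\<^sup>1 |\<nabla>\<phi> (x + t s)| dt\<close>. Averaging this over translations \<open>s\<close> that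
move the domain off itself yields the \<open>L\<^sup>4\<close> bound in dimension at most three, by Cauchy--Schwarz,
Fubini and scaling alone; averaging it over small \<open>s\<close> shows that a function is close to its
means over the cells of a fine grid, which is what compactness needs.\<close>

section \<open>Square-integrable functions\<close>

lemma L2_fun_measurable: "L2_fun \<Omega> f \<Longrightarrow> f \<in> borel_measurable (lebesgue_on \<Omega>)"
  by (simp add: L2_fun_def)

lemma L2_fun_of_bound:
  assumes "f \<in> borel_measurable (lebesgue_on \<Omega>)" "integrable (lebesgue_on \<Omega>) h"
    and "\<And>x. (norm (f x))\<^sup>2 \<le> h x"
  shows "L2_fun \<Omega> f"
  unfolding L2_fun_def
proof (intro conjI assms(1), rule Bochner_Integration.integrable_bound[OF assms(2)])
  show "(\<lambda>x. (norm (f x))\<^sup>2) \<in> borel_measurable (lebesgue_on \<Omega>)"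
    using assms(1) by measurable
  show "AE x in lebesgue_on \<Omega>. norm ((norm (f x))\<^sup>2) \<le> norm (h x)"
    using assms(3) by (intro AE_I2) (auto intro: order_trans[OF _ abs_ge_self])
qed

lemma norm_add_sq_le: "(norm (a + b))\<^sup>2 \<le> 2 * (norm a)\<^sup>2 + 2 * (norm (b::'a::real_inner))\<^sup>2"
proof -
  have "0 \<le> (norm (a - b))\<^sup>2" by simp
  then show ?thesis by (simp add: power2_norm_eq_inner inner_simps inner_commute)
qed

lemma L2_fun_add:
  assumes "L2_fun \<Omega> f" "L2_fun \<Omega> g" shows "L2_fun \<Omega> (\<lambda>x. f x + g x)"
  using assms
  by (intro L2_fun_of_bound[where h = "\<lambda>x. 2 * (norm (f x))\<^sup>2 + 2 * (norm (g x))\<^sup>2"] norm_add_sq_le)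
     (auto simp: L2_fun_def)

lemma L2_fun_scaleR: "L2_fun \<Omega> f \<Longrightarrow> L2_fun \<Omega> (\<lambda>x. c *\<^sub>R f x)"
  by (auto simp: L2_fun_def power_mult_distrib)

lemma L2_fun_diff:
  assumes "L2_fun \<Omega> f" "L2_fun \<Omega> g" shows "L2_fun \<Omega> (\<lambda>x. f x - g x)"
  using L2_fun_add[OF assms(1) L2_fun_scaleR[OF assms(2), of "-1"]] by simp

lemma L2_integrable_inner:
  assumes "L2_fun \<Omega> f" "L2_fun \<Omega> g"
  shows "integrable (lebesgue_on \<Omega>) (\<lambda>x. f x \<bullet> g x)"
proof (rule Bochner_Integration.integrable_bound)
  show "integrable (lebesgue_on \<Omega>) (\<lambda>x. (norm (f x))\<^sup>2 + (norm (g x))\<^sup>2)"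
    using assms by (auto simp: L2_fun_def)
  show "(\<lambda>x. f x \<bullet> g x) \<in> borel_measurable (lebesgue_on \<Omega>)"
    using assms by (auto simp: L2_fun_def)
  have "norm (a \<bullet> b) \<le> norm ((norm a)\<^sup>2 + (norm b)\<^sup>2)" for a b :: 'b
  proof -
    have "norm (a \<bullet> b) \<le> norm a * norm b" by (simp add: Cauchy_Schwarz_ineq2)
    moreover have "0 \<le> (norm a - norm b)\<^sup>2" "0 \<le> (norm a)\<^sup>2 + (norm b)\<^sup>2" by simp_all
    ultimately show ?thesis by (simp add: power2_diff)
  qed
  then show "AE x in lebesgue_on \<Omega>. norm (f x \<bullet> g x) \<le> norm ((norm (f x))\<^sup>2 + (norm (g x))\<^sup>2)"
    by simp
qed

text \<open>Estimates below are for squared distances, with \<open>(a + b)\<^sup>2 \<le> 2 a\<^sup>2 + 2 b\<^sup>2\<close> in the role of the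
triangle inequality.\<close>

abbreviation L2_dist_sq ::
    "'a::euclidean_space set \<Rightarrow> ('a \<Rightarrow> 'b::euclidean_space) \<Rightarrow> ('a \<Rightarrow> 'b) \<Rightarrow> real" where
  "L2_dist_sq \<Omega> f g \<equiv> L2_inner \<Omega> (\<lambda>x. f x - g x) (\<lambda>x. f x - g x)"

lemma L2_inner_sym: "L2_inner \<Omega> f g = L2_inner \<Omega> g f"
  by (simp add: L2_inner_def inner_commute)

lemma L2_inner_self: "L2_inner \<Omega> f f = (LINT x|lebesgue_on \<Omega>. (norm (f x))\<^sup>2)"
  by (simp add: L2_inner_def power2_norm_eq_inner)

lemma L2_inner_self_nonneg [simp]: "0 \<le> L2_inner \<Omega> f f"
  by (simp add: L2_inner_self)

lemma L2_inner_diff_left: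
  assumes "L2_fun \<Omega> f" "L2_fun \<Omega> g" "L2_fun \<Omega> h"
  shows "L2_inner \<Omega> (\<lambda>x. f x - g x) h = L2_inner \<Omega> f h - L2_inner \<Omega> g h"
  using assms by (simp add: L2_inner_def inner_diff_left L2_integrable_inner)

lemma L2_inner_scaleR_left: "L2_inner \<Omega> (\<lambda>x. c *\<^sub>R f x) h = c * L2_inner \<Omega> f h"
  by (simp add: L2_inner_def)

lemma L2_inner_cong_AE:
  assumes "AE x in lebesgue_on \<Omega>. f x = f' x" "AE x in lebesgue_on \<Omega>. g x = g' x"
    and "L2_fun \<Omega> f" "L2_fun \<Omega> f'" "L2_fun \<Omega> g" "L2_fun \<Omega> g'"
  shows "L2_inner \<Omega> f g = L2_inner \<Omega> f' g'"
  unfolding L2_inner_def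
proof (rule integral_cong_AE)
  show "AE x in lebesgue_on \<Omega>. f x \<bullet> g x = f' x \<bullet> g' x" using assms(1,2) by eventually_elim simp
qed (use assms in \<open>auto simp: L2_fun_def\<close>)

lemma L2_Cauchy_Schwarz:
  assumes f: "L2_fun \<Omega> f" and g: "L2_fun \<Omega> g"
  shows "(L2_inner \<Omega> f g)\<^sup>2 \<le> L2_inner \<Omega> f f * L2_inner \<Omega> g g"
proof (cases "L2_inner \<Omega> g g = 0")
  case True
  then have "AE x in lebesgue_on \<Omega>. g x = 0"
    using g integral_nonneg_eq_0_iff_AE[of "lebesgue_on \<Omega>" "\<lambda>x. (norm (g x))\<^sup>2"]
    by (auto simp: L2_inner_self L2_fun_def)
  then have "L2_inner \<Omega> f g = (LINT x|lebesgue_on \<Omega>. 0)"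
    unfolding L2_inner_def using f g
    by (intro integral_cong_AE) (auto simp: L2_fun_def)
  then show ?thesis using True by simp
next
  case False
  define A B C where "A = L2_inner \<Omega> f f" and "B = L2_inner \<Omega> g g" and "C = L2_inner \<Omega> f g"
  have B: "B > 0" using False L2_inner_self_nonneg[of \<Omega> g] by (simp add: B_def less_le)
  let ?h = "\<lambda>x. B *\<^sub>R f x - C *\<^sub>R g x"
  have h: "L2_fun \<Omega> ?h" "L2_fun \<Omega> (\<lambda>x. B *\<^sub>R f x)" "L2_fun \<Omega> (\<lambda>x. C *\<^sub>R g x)"
    by (intro L2_fun_diff L2_fun_scaleR f g)+
  \<comment> \<open>The combination \<open>B f - C g\<close> is \<open>B\<close> times the component of \<open>f\<close> orthogonal to \<open>g\<close>.\<close>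
  have "0 \<le> L2_inner \<Omega> ?h ?h" by simp
  also have "\<dots> = B * L2_inner \<Omega> f ?h - C * L2_inner \<Omega> g ?h"
    by (subst L2_inner_diff_left) (use h in \<open>auto simp: L2_inner_scaleR_left\<close>)
  also have "\<dots> = B * L2_inner \<Omega> ?h f - C * L2_inner \<Omega> ?h g"
    by (simp only: L2_inner_sym)
  also have "\<dots> = B * (B * A - C * C)"
    using h f g by (simp add: L2_inner_diff_left L2_inner_scaleR_left A_def B_def C_def
        L2_inner_sym[of \<Omega> g f] algebra_simps)
  finally have "0 \<le> B * A - C * C" using B by (simp add: zero_le_mult_iff)
  then show ?thesis by (simp add: A_def B_def C_def power2_eq_square mult.commute)
qed

lemma L2_inner_add_sq_le:
  assumes f: "L2_fun \<Omega> f" and g: "L2_fun \<Omega> g"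
  shows "L2_inner \<Omega> (\<lambda>x. f x + g x) (\<lambda>x. f x + g x) \<le> 2 * L2_inner \<Omega> f f + 2 * L2_inner \<Omega> g g"
proof -
  have "L2_inner \<Omega> (\<lambda>x. f x + g x) (\<lambda>x. f x + g x)
      \<le> (LINT x|lebesgue_on \<Omega>. 2 * (norm (f x))\<^sup>2 + 2 * (norm (g x))\<^sup>2)"
    unfolding L2_inner_self
    using L2_fun_add[OF f g] f g by (intro integral_mono norm_add_sq_le) (auto simp: L2_fun_def)
  also have "\<dots> = 2 * L2_inner \<Omega> f f + 2 * L2_inner \<Omega> g g"
    using f g by (simp add: L2_inner_self L2_fun_def)
  finally show ?thesis .
qed

lemma L2_dist_sq_commute:
  "L2_dist_sq \<Omega> f g = L2_dist_sq \<Omega> g f"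
  by (simp add: L2_inner_self norm_minus_commute)

lemma L2_inner_diff_sq_le:
  assumes f: "L2_fun \<Omega> f" and g: "L2_fun \<Omega> g"
  shows "L2_dist_sq \<Omega> f g \<le> 2 * L2_inner \<Omega> f f + 2 * L2_inner \<Omega> g g"
  using L2_inner_add_sq_le[OF f L2_fun_scaleR[OF g, of "-1"]]
  by (simp add: L2_inner_self)

lemma L2_inner_triangle_sq:
  assumes "L2_fun \<Omega> f" "L2_fun \<Omega> g" "L2_fun \<Omega> h"
  shows "L2_dist_sq \<Omega> f h \<le>
    2 * L2_dist_sq \<Omega> f g + 2 * L2_dist_sq \<Omega> g h"
  using L2_inner_add_sq_le[OF L2_fun_diff[OF assms(1,2)] L2_fun_diff[OF assms(2,3)]] by simp

lemma L2_inner_self_nn: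
  assumes "L2_fun \<Omega> f"
  shows "(\<integral>\<^sup>+x. ennreal ((norm (f x))\<^sup>2) \<partial>lebesgue_on \<Omega>) = ennreal (L2_inner \<Omega> f f)"
  unfolding L2_inner_self using assms by (intro nn_integral_eq_integral) (auto simp: L2_fun_def)

lemma L2_fun_of_nn:
  assumes "f \<in> borel_measurable (lebesgue_on \<Omega>)"
    and "(\<integral>\<^sup>+x. ennreal ((norm (f x))\<^sup>2) \<partial>lebesgue_on \<Omega>) < \<infinity>"
  shows "L2_fun \<Omega> f"
  unfolding L2_fun_def using assms
  by (intro conjI integrableI_nonneg) auto

lemma L2_inner_tendsto:
  assumes f: "\<And>n. L2_fun \<Omega> (f n)" "L2_fun \<Omega> f'" and g: "L2_fun \<Omega> g"
    and lim: "(\<lambda>n. L2_dist_sq \<Omega> (f n) f') \<longlonglongrightarrow> 0"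
  shows "(\<lambda>n. L2_inner \<Omega> (f n) g) \<longlonglongrightarrow> L2_inner \<Omega> f' g"
proof -
  have "(\<lambda>n. (L2_inner \<Omega> (\<lambda>x. f n x - f' x) g)\<^sup>2) \<longlonglongrightarrow> 0"
  proof (rule tendsto_sandwich[OF _ _ tendsto_const])
    show "(\<lambda>n. L2_dist_sq \<Omega> (f n) f' * L2_inner \<Omega> g g) \<longlonglongrightarrow> 0"
      using tendsto_mult_right[OF lim, of "L2_inner \<Omega> g g"] by simp
  qed (use L2_Cauchy_Schwarz[OF L2_fun_diff[OF f] g] in auto)
  then have "(\<lambda>n. L2_inner \<Omega> (\<lambda>x. f n x - f' x) g) \<longlonglongrightarrow> 0"
    by (simp add: power_tendsto_0_iff)
  then have "(\<lambda>n. L2_inner \<Omega> (f n) g - L2_inner \<Omega> f' g) \<longlonglongrightarrow> 0"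
    using f g by (simp add: L2_inner_diff_left)
  then show ?thesis by (simp add: LIM_zero_iff)
qed

text \<open>The Riesz--Fischer theorem. A subsequence with increments \<open>\<Delta>\<^sub>k\<close> of squared norm below \<open>4\<^sup>-\<^sup>k\<close> makes
  \<open>\<Sum>\<^sub>k 2\<^sup>k |\<Delta>\<^sub>k|\<^sup>2\<close> integrable, hence finite almost everywhere, so that \<open>|\<Delta>\<^sub>k|\<close> decays geometrically
  and the subsequence converges pointwise; Fatou's lemma turns this into convergence in \<open>L\<^sup>2\<close>.\<close>

lemma L2_complete:
  fixes f :: "nat \<Rightarrow> 'a::euclidean_space \<Rightarrow> 'b::euclidean_space"
  assumes f: "\<And>n. L2_fun \<Omega> (f n)"
    and cauchy: "\<And>e. e > 0 \<Longrightarrow>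
      \<exists>N. \<forall>m\<ge>N. \<forall>n\<ge>N. L2_dist_sq \<Omega> (f m) (f n) < e"
  shows "\<exists>g. L2_fun \<Omega> g \<and> (\<lambda>n. L2_dist_sq \<Omega> (f n) g) \<longlonglongrightarrow> 0"
proof -
  let ?M = "lebesgue_on \<Omega>"
  let ?d = "\<lambda>m n. L2_dist_sq \<Omega> (f m) (f n)"
  have "\<forall>k. \<exists>N. \<forall>m\<ge>N. \<forall>n\<ge>N. ?d m n < (1/4)^k" using cauchy by simp
  then obtain N where N: "\<And>k m n. m \<ge> N k \<Longrightarrow> n \<ge> N k \<Longrightarrow> ?d m n < (1/4)^k" by metis
  define r where "r k = (\<Sum>i\<le>k. N i) + k" for k
  have rN: "r k \<ge> N k" for k unfolding r_def by (simp add: member_le_sum trans_le_add1)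
  have rk: "r k \<ge> k" for k by (simp add: r_def)
  have rSuc: "r (Suc k) \<ge> N k" for k
    using rN[of k] unfolding r_def by simp
  have fm [measurable]: "f n \<in> borel_measurable ?M" for n using f by (simp add: L2_fun_def)
  define D where "D k x = f (r (Suc k)) x - f (r k) x" for k x
  have Dm [measurable]: "D k \<in> borel_measurable ?M" for k unfolding D_def by measurable
  have "(\<integral>\<^sup>+x. (\<Sum>k. ennreal (2^k * (norm (D k x))\<^sup>2)) \<partial>?M)
      = (\<Sum>k. (\<integral>\<^sup>+x. ennreal (2^k * (norm (D k x))\<^sup>2) \<partial>?M))"
    by (intro nn_integral_suminf) measurable
  also have "\<dots> \<le> (\<Sum>k. ennreal ((1/2)^k))"
  proof (rule suminf_le)
    fix k
    have "(\<integral>\<^sup>+x. ennreal (2^k * (norm (D k x))\<^sup>2) \<partial>?M)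
      = ennreal (2^k) * (\<integral>\<^sup>+x. ennreal ((norm (D k x))\<^sup>2) \<partial>?M)"
      by (simp add: ennreal_mult nn_integral_cmult)
    also have "\<dots> = ennreal (2^k) * ennreal (?d (r (Suc k)) (r k))"
      unfolding D_def by (subst L2_inner_self_nn) (auto intro: L2_fun_diff f)
    also have "\<dots> \<le> ennreal (2^k) * ennreal ((1/4)^k)"
      using N[OF rSuc rN, of k] by (intro mult_left_mono ennreal_leI) auto
    also have "\<dots> = ennreal ((1/2)^k)"
      by (simp add: ennreal_mult[symmetric] power_mult_distrib[symmetric])
    finally show "(\<integral>\<^sup>+x. ennreal (2^k * (norm (D k x))\<^sup>2) \<partial>?M) \<le> ennreal ((1/2)^k)" .
  qed auto
  also have "\<dots> = ennreal (\<Sum>k. (1/2)^k)"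
    by (intro suminf_ennreal_eq) (auto intro!: summable_sums summable_geometric)
  also have "\<dots> < \<infinity>" by simp
  finally have "AE x in ?M. (\<Sum>k. ennreal (2^k * (norm (D k x))\<^sup>2)) \<noteq> \<infinity>"
    by (intro nn_integral_PInf_AE) auto
  then have conv: "AE x in ?M. convergent (\<lambda>k. f (r k) x)"
  proof eventually_elim
    case (elim x)
    then have "summable (\<lambda>k. 2^k * (norm (D k x))\<^sup>2)"
      by (intro summable_suminf_not_top) auto
    then have "(\<lambda>k. 2^k * (norm (D k x))\<^sup>2) \<longlonglongrightarrow> 0" by (rule summable_LIMSEQ_zero)
    then have "Bseq (\<lambda>k. 2^k * (norm (D k x))\<^sup>2)" by (intro convergent_imp_Bseq) (auto simp: convergent_def)
    then obtain C where C: "C > 0" "\<And>k. norm (2^k * (norm (D k x))\<^sup>2) \<le> C" unfolding Bseq_def by auto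
    have "norm (D k x) \<le> sqrt C * (1 / sqrt 2) ^ k" for k
    proof -
      have "(norm (D k x))\<^sup>2 \<le> C / 2^k" using C(2)[of k] by (simp add: field_simps)
      then have "norm (D k x) \<le> sqrt (C / 2^k)" by (simp add: real_le_rsqrt)
      then show ?thesis by (simp add: real_sqrt_divide real_sqrt_power power_one_over)
    qed
    moreover have "summable (\<lambda>k. sqrt C * (1 / sqrt 2) ^ k)"
      by (intro summable_mult summable_geometric) auto
    ultimately have "summable (\<lambda>k. D k x)" by (metis summable_comparison_test')
    then have "convergent (\<lambda>n. f (r 0) x + (\<Sum>k<n. D k x))"
      by (intro convergent_add convergent_const) (simp add: summable_iff_convergent)
    also have "(\<lambda>n. f (r 0) x + (\<Sum>k<n. D k x)) = (\<lambda>n. f (r n) x)"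
      unfolding D_def by (simp add: sum_lessThan_telescope[of "\<lambda>k. f (r k) x"])
    finally show ?case .
  qed
  define g where "g x = lim (\<lambda>k. f (r k) x)" for x
  have gm [measurable]: "g \<in> borel_measurable ?M" unfolding g_def by measurable
  have lim: "AE x in ?M. (\<lambda>k. f (r k) x) \<longlonglongrightarrow> g x"
    using conv by eventually_elim (simp add: g_def convergent_LIMSEQ_iff)
  have est: "(\<integral>\<^sup>+x. ennreal ((norm (f n x - g x))\<^sup>2) \<partial>?M) \<le> ennreal ((1/4)^k)" if "n \<ge> N k" for n k
  proof -
    have "(\<integral>\<^sup>+x. ennreal ((norm (f n x - g x))\<^sup>2) \<partial>?M)
        = (\<integral>\<^sup>+x. liminf (\<lambda>j. ennreal ((norm (f n x - f (r j) x))\<^sup>2)) \<partial>?M)"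
    proof (rule nn_integral_cong_AE)
      show "AE x in ?M. ennreal ((norm (f n x - g x))\<^sup>2) = liminf (\<lambda>j. ennreal ((norm (f n x - f (r j) x))\<^sup>2))"
        using lim
      proof eventually_elim
        case (elim x)
        have "(\<lambda>j. ennreal ((norm (f n x - f (r j) x))\<^sup>2)) \<longlonglongrightarrow> ennreal ((norm (f n x - g x))\<^sup>2)"
          by (intro tendsto_intros elim)
        then show ?case by (rule lim_imp_Liminf[symmetric, rotated]) simp
      qed
    qed
    also have "\<dots> \<le> liminf (\<lambda>j. \<integral>\<^sup>+x. ennreal ((norm (f n x - f (r j) x))\<^sup>2) \<partial>?M)"
      by (intro nn_integral_liminf) measurable
    also have "\<dots> \<le> ennreal ((1/4)^k)"
    proof (rule Liminf_le)
      have "(\<integral>\<^sup>+x. ennreal ((norm (f n x - f (r j) x))\<^sup>2) \<partial>?M) \<le> ennreal ((1/4)^k)" if "j \<ge> N k" for j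
        using N[OF \<open>n \<ge> N k\<close>, of "r j"] rk[of j] that
        by (subst L2_inner_self_nn) (auto intro: L2_fun_diff f simp: less_imp_le ennreal_leI)
      then show "\<forall>\<^sub>F j in sequentially. (\<integral>\<^sup>+x. ennreal ((norm (f n x - f (r j) x))\<^sup>2) \<partial>?M) \<le> ennreal ((1/4)^k)"
        by (auto simp: eventually_sequentially)
    qed simp
    finally show ?thesis .
  qed
  have "L2_fun \<Omega> (\<lambda>x. f (N 0) x - g x)"
    using est[of 0 "N 0"] by (intro L2_fun_of_nn) (auto intro: le_less_trans)
  from L2_fun_diff[OF f[of "N 0"] this] have g: "L2_fun \<Omega> g" by simp
  have "(\<lambda>n. L2_dist_sq \<Omega> (f n) g) \<longlonglongrightarrow> 0"
  proof (rule LIMSEQ_I)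
    fix e :: real assume "e > 0"
    obtain k where k: "(1/4)^k < e" using real_arch_pow_inv[OF \<open>e > 0\<close>, of "1/4"] by auto
    have "L2_dist_sq \<Omega> (f n) g \<le> (1/4)^k" if "n \<ge> N k" for n
      using est[OF that] by (subst (asm) L2_inner_self_nn) (auto intro: L2_fun_diff f g)
    then show "\<exists>no. \<forall>n\<ge>no. norm (L2_dist_sq \<Omega> (f n) g - 0) < e"
      using k by (intro exI[of _ "N k"]) (auto intro: le_less_trans)
  qed
  with g show ?thesis by blast
qed

section \<open>Smooth functions\<close>

lemma Ck_on_Suc_imp: "Ck_on (Suc k) UNIV f \<Longrightarrow> Ck_on k UNIV f"
proof (induction k arbitrary: f)
  case 0
  then show ?case by (simp add: continuous_on_eq_continuous_at differentiable_imp_continuous_within)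
next
  case (Suc k)
  then show ?case by (metis Ck_on.simps(2))
qed

lemma Ck_on_has_derivative:
  "Ck_on (Suc k) UNIV f \<Longrightarrow> (f has_derivative frechet_derivative f (at x)) (at x)"
  by (simp add: frechet_derivative_works)

lemma Ck_on_SucI:
  assumes "\<And>x. (f has_derivative f' x) (at x)" "\<And>b. b \<in> Basis \<Longrightarrow> Ck_on k UNIV (\<lambda>x. f' x b)"
  shows "Ck_on (Suc k) UNIV f"
proof -
  have "frechet_derivative f (at x) = f' x" for x
    using frechet_derivative_at[OF assms(1)] by simp
  then show ?thesis using assms by (auto simp: differentiable_def)
qed

lemma Ck_on_const: "Ck_on k UNIV (\<lambda>x. c)"
proof (induction k arbitrary: c)
  case (Suc k)
  show ?case by (rule Ck_on_SucI[where f' = "\<lambda>x h. 0"]) (use Suc in auto)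
qed simp

lemma Ck_on_add: "Ck_on k UNIV f \<Longrightarrow> Ck_on k UNIV g \<Longrightarrow> Ck_on k UNIV (\<lambda>x. f x + g x)"
proof (induction k arbitrary: f g)
  case 0 then show ?case by (auto intro: continuous_intros)
next
  case (Suc k)
  show ?case
    by (rule Ck_on_SucI, rule has_derivative_add[OF Ck_on_has_derivative[OF Suc.prems(1)]
          Ck_on_has_derivative[OF Suc.prems(2)]]) (use Suc in auto)
qed

lemma Ck_on_diff: "Ck_on k UNIV f \<Longrightarrow> Ck_on k UNIV g \<Longrightarrow> Ck_on k UNIV (\<lambda>x. f x - g x)"
proof (induction k arbitrary: f g)
  case 0 then show ?case by (auto intro: continuous_intros)
next
  case (Suc k)
  show ?case
    by (rule Ck_on_SucI, rule has_derivative_diff[OF Ck_on_has_derivative[OF Suc.prems(1)]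
          Ck_on_has_derivative[OF Suc.prems(2)]]) (use Suc in auto)
qed

lemma Ck_on_mult:
  fixes f g :: "'a::euclidean_space \<Rightarrow> real"
  shows "Ck_on k UNIV f \<Longrightarrow> Ck_on k UNIV g \<Longrightarrow> Ck_on k UNIV (\<lambda>x. f x * g x)"
proof (induction k arbitrary: f g)
  case 0 then show ?case by (auto intro: continuous_intros)
next
  case (Suc k)
  show ?case
    by (rule Ck_on_SucI, rule has_derivative_mult[OF Ck_on_has_derivative[OF Suc.prems(1)]
          Ck_on_has_derivative[OF Suc.prems(2)]])
      (use Suc in \<open>auto intro!: Ck_on_add Suc.IH simp: Ck_on_Suc_imp\<close>)
qed

lemma Ck_on_prod:
  fixes f :: "'i \<Rightarrow> 'a::euclidean_space \<Rightarrow> real"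
  assumes "finite I" "\<And>i. i \<in> I \<Longrightarrow> Ck_on k UNIV (f i)"
  shows "Ck_on k UNIV (\<lambda>x. \<Prod>i\<in>I. f i x)"
  using assms by (induction I) (auto intro: Ck_on_mult Ck_on_const)

text \<open>Smoothness is a statement about iterated derivatives, so the induction on \<open>k\<close> moves along the
whole sequence \<open>D\<close> of derivatives of a function of one variable.\<close>

lemma Ck_on_compose_affine:
  fixes D :: "nat \<Rightarrow> real \<Rightarrow> real" and v :: "'a::euclidean_space"
  assumes D: "\<And>n t. (D n has_real_derivative D (Suc n) t) (at t)"
  shows "Ck_on k UNIV (\<lambda>x. D n (x \<bullet> v + c))"
proof (induction k arbitrary: n)
  case 0
  have "isCont (D n) t" for t using D by (rule DERIV_isCont)
  then have "continuous_on UNIV (D n)" by (simp add: continuous_on_eq_continuous_at)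
  then have "continuous_on UNIV (\<lambda>x. D n (x \<bullet> v + c))"
    by (rule continuous_on_compose2) (auto intro!: continuous_intros)
  then show ?case by simp
next
  case (Suc k)
  have "((\<lambda>x. D n (x \<bullet> v + c)) has_derivative (\<lambda>h. D (Suc n) (x \<bullet> v + c) * (h \<bullet> v))) (at x)" for x
  proof -
    have "((\<lambda>x. x \<bullet> v + c) has_derivative (\<lambda>h. h \<bullet> v)) (at x)" by (auto intro!: derivative_eq_intros)
    from DERIV_compose_FDERIV[OF D this] show ?thesis by (simp add: mult.commute)
  qed
  then show ?case
    by (rule Ck_on_SucI) (use Suc in \<open>auto intro!: Ck_on_mult Ck_on_const\<close>)
qed

section \<open>A smooth cut-off function\<close>

text \<open>The functions \<open>P (1/t) exp (- 1/t)\<close>, extended by zero to \<open>t \<le> 0\<close>, are closed under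
differentiation, so one computation yields all derivatives of \<open>exp (- 1/t)\<close>.\<close>

definition flat_exp :: "real poly \<Rightarrow> real \<Rightarrow> real" where
  "flat_exp P t = (if t > 0 then poly P (1/t) * exp (- 1/t) else 0)"

lemma flat_exp_tendsto_0: "(flat_exp P \<longlongrightarrow> 0) (at_right 0)"
proof -
  have pe: "((\<lambda>s. poly P s * exp (-s)) \<longlongrightarrow> 0) at_top"
  proof -
    have "((\<lambda>s. \<Sum>i\<le>degree P. coeff P i * (s ^ i / exp s)) \<longlongrightarrow> (\<Sum>i\<le>degree P. coeff P i * 0)) at_top"
      by (intro tendsto_sum tendsto_mult tendsto_const tendsto_power_div_exp_0)
    then show ?thesis by (simp add: poly_altdef sum_distrib_right exp_minus divide_inverse mult.assoc)
  qed
  have "((\<lambda>t. poly P (inverse t) * exp (- inverse t)) \<longlongrightarrow> 0) (at_right 0)"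
    by (rule filterlim_compose[OF pe filterlim_inverse_at_top_right])
  then show ?thesis
    by (rule Lim_transform_eventually)
       (auto simp: flat_exp_def eventually_at_right_less field_simps intro!: eventually_mono[OF eventually_at_right_less])
qed

lemma DERIV_flat_exp:
  "(flat_exp P has_real_derivative flat_exp ([:0, 0, 1:] * (P - pderiv P)) t) (at t)"
proof -
  consider "t > 0" | "t < 0" | "t = 0" by linarith
  then show ?thesis
  proof cases
    case 1
    have "((\<lambda>t. poly P (1/t) * exp (- 1/t)) has_real_derivative
        flat_exp ([:0, 0, 1:] * (P - pderiv P)) t) (at t)"
      using 1 by (auto intro!: derivative_eq_intros DERIV_chain'[OF _ poly_DERIV]
          simp: flat_exp_def field_simps power2_eq_square)
    then show ?thesis
      by (rule DERIV_cong_ev[THEN iffD1, rotated -1])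
         (use 1 in \<open>auto simp: flat_exp_def intro!: eventually_nhds_in_open[of "{0<..}", THEN eventually_mono]\<close>)
  next
    case 2
    have "((\<lambda>t. 0) has_real_derivative 0) (at t)" by simp
    then have "(flat_exp P has_real_derivative 0) (at t)"
      by (rule DERIV_cong_ev[THEN iffD1, rotated -1])
         (use 2 in \<open>auto simp: flat_exp_def intro!: eventually_nhds_in_open[of "{..<0}", THEN eventually_mono]\<close>)
    then show ?thesis using 2 by (simp add: flat_exp_def)
  next
    case 3
    have "((\<lambda>h. flat_exp P h / h) \<longlongrightarrow> 0) (at_right 0)"
      by (rule Lim_transform_eventually[OF flat_exp_tendsto_0[of "[:0, 1:] * P"]])
         (auto simp: flat_exp_def field_simps intro!: eventually_mono[OF eventually_at_right_less])
    moreover have "((\<lambda>h. flat_exp P h / h) \<longlongrightarrow> 0) (at_left 0)"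
      by (rule Lim_transform_eventually[OF tendsto_const])
         (auto simp: flat_exp_def eventually_at_left_field intro!: exI[of _ "-1"])
    ultimately have "((\<lambda>h. flat_exp P h / h) \<longlongrightarrow> 0) (at 0)"
      using filterlim_split_at by blast
    then show ?thesis using 3 by (simp add: DERIV_def flat_exp_def)
  qed
qed

lemma Ck_on_flat_exp:
  fixes v :: "'a::euclidean_space"
  shows "Ck_on k UNIV (\<lambda>x. flat_exp P (x \<bullet> v + c))"
proof -
  define Q where "Q n = ((\<lambda>P. [:0, 0, 1:] * (P - pderiv P)) ^^ n) P" for n
  show ?thesis
    using Ck_on_compose_affine[of "\<lambda>n. flat_exp (Q n)" k 0 v c] DERIV_flat_exp
    unfolding Q_def by simp
qed

text \<open>Inside the box each factor has the form \<open>exp (- 1/(n t))\<close> with \<open>t > 0\<close>, so that these functions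
tend to the indicator of the open box as \<open>n\<close> grows.\<close>

definition box_bump :: "real \<Rightarrow> real ^ 'd \<Rightarrow> real ^ 'd \<Rightarrow> real ^ 'd \<Rightarrow> real" where
  "box_bump n a b x =
     (\<Prod>k\<in>UNIV. flat_exp 1 (n * (x $ k - a $ k)) * flat_exp 1 (n * (b $ k - x $ k)))"

lemma flat_exp_1_bounds: "0 \<le> flat_exp 1 t" "flat_exp 1 t \<le> 1"
  by (auto simp: flat_exp_def)

lemma box_bump_bounds: "0 \<le> box_bump n a b x" "box_bump n a b x \<le> 1"
  unfolding box_bump_def
  by (auto intro!: prod_nonneg prod_le_1 mult_le_one simp: flat_exp_1_bounds)

lemma box_bump_eq_0:
  assumes "n \<ge> 0" "x \<notin> box a b" shows "box_bump n a b x = 0"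
proof -
  obtain k where "x $ k \<le> a $ k \<or> b $ k \<le> x $ k"
    using assms(2) by (auto simp: mem_box_cart not_less)
  then have "n * (x $ k - a $ k) \<le> 0 \<or> n * (b $ k - x $ k) \<le> 0"
    using assms(1) by (auto intro!: mult_nonneg_nonpos)
  then have "flat_exp 1 (n * (x $ k - a $ k)) * flat_exp 1 (n * (b $ k - x $ k)) = 0"
    by (auto simp: flat_exp_def)
  then show ?thesis unfolding box_bump_def by (intro prod_zero) (auto intro!: exI[of _ k])
qed

lemma test_function_box_bump:
  fixes a b :: "real ^ 'd"
  assumes "cbox a b \<subseteq> \<Omega>" "n \<ge> 0" shows "test_function \<Omega> (box_bump n a b)"
  unfolding test_function_def
proof (intro conjI allI exI[of _ "cbox a b"] impI)
  fix k
  have 1: "flat_exp 1 (n * (x $ i - a $ i)) = flat_exp 1 (x \<bullet> (n *\<^sub>R axis i 1) + (- n * a $ i))" for x :: "real ^ 'd" and i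
    by (simp add: inner_axis algebra_simps)
  have 2: "flat_exp 1 (n * (b $ i - x $ i)) = flat_exp 1 (x \<bullet> (- n *\<^sub>R axis i 1) + n * b $ i)" for x :: "real ^ 'd" and i
    by (simp add: inner_axis algebra_simps)
  show "Ck_on k UNIV (box_bump n a b)"
    unfolding box_bump_def 1 2 by (intro Ck_on_prod Ck_on_mult Ck_on_flat_exp) auto
next
  fix x assume "x \<notin> cbox a b"
  then show "box_bump n a b x = 0"
    using assms(2) box_subset_cbox[of a b] by (intro box_bump_eq_0) auto
qed (use assms in auto)

lemma box_bump_tendsto:
  fixes x :: "real ^ 'd"
  assumes "x \<in> box a b" shows "(\<lambda>n. box_bump (real n) a b x) \<longlonglongrightarrow> 1"
proof -
  have "(\<lambda>n. flat_exp 1 (real n * t)) \<longlonglongrightarrow> 1" if "t > 0" for t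
  proof (rule Lim_transform_eventually)
    have "(\<lambda>n. exp (- inverse (real n) / t)) \<longlonglongrightarrow> exp (- 0 / t)"
      using that by (intro tendsto_intros lim_inverse_n) auto
    then show "(\<lambda>n. exp (- inverse (real n) / t)) \<longlonglongrightarrow> 1" by simp
    show "\<forall>\<^sub>F n in sequentially. exp (- inverse (real n) / t) = flat_exp 1 (real n * t)"
      using that by (intro eventually_sequentiallyI[of 1]) (auto simp: flat_exp_def field_simps)
  qed
  then have "(\<lambda>n. box_bump (real n) a b x) \<longlonglongrightarrow> (\<Prod>k\<in>(UNIV::'d set). 1 * 1)"
    unfolding box_bump_def using assms by (intro tendsto_prod tendsto_mult) (auto simp: mem_box_cart)
  then show ?thesis by simp
qed

lemma test_function_add:
  assumes "test_function \<Omega> f" "test_function \<Omega> g" shows "test_function \<Omega> (\<lambda>x. f x + g x)"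
proof -
  obtain K L where "compact K" "K \<subseteq> \<Omega>" "\<forall>x. x \<notin> K \<longrightarrow> f x = 0" "compact L" "L \<subseteq> \<Omega>" "\<forall>x. x \<notin> L \<longrightarrow> g x = 0"
    using assms unfolding test_function_def by blast
  then have "compact (K \<union> L)" "K \<union> L \<subseteq> \<Omega>" "\<forall>x. x \<notin> K \<union> L \<longrightarrow> f x + g x = 0" by auto
  then show ?thesis using assms unfolding test_function_def by (blast intro: Ck_on_add)
qed

lemma test_function_diff:
  assumes "test_function \<Omega> f" "test_function \<Omega> g" shows "test_function \<Omega> (\<lambda>x. f x - g x)"
proof -
  obtain K L where "compact K" "K \<subseteq> \<Omega>" "\<forall>x. x \<notin> K \<longrightarrow> f x = 0" "compact L" "L \<subseteq> \<Omega>" "\<forall>x. x \<notin> L \<longrightarrow> g x = 0"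
    using assms unfolding test_function_def by blast
  then have "compact (K \<union> L)" "K \<union> L \<subseteq> \<Omega>" "\<forall>x. x \<notin> K \<union> L \<longrightarrow> f x - g x = 0" by auto
  then show ?thesis using assms unfolding test_function_def by (blast intro: Ck_on_diff)
qed

lemma test_function_mult:
  fixes f g :: "'a::euclidean_space \<Rightarrow> real"
  assumes "test_function \<Omega> f" "test_function \<Omega> g" shows "test_function \<Omega> (\<lambda>x. f x * g x)"
proof -
  obtain K where "compact K" "K \<subseteq> \<Omega>" "\<forall>x. x \<notin> K \<longrightarrow> f x * g x = 0"
    using assms(1) unfolding test_function_def by fastforce
  then show ?thesis using assms unfolding test_function_def by (blast intro: Ck_on_mult)
qed

lemma test_function_0: "test_function \<Omega> (\<lambda>x. 0)"
  unfolding test_function_def by (auto intro: Ck_on_const)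

section \<open>The fundamental lemma of the calculus of variations\<close>

text \<open>Covering \<open>U\<close> by countably many open boxes \<open>B\<^sub>i\<close> and taking bumps \<open>b\<^sub>i\<^sub>,\<^sub>n\<close> that tend to the indicator of
  \<open>B\<^sub>i\<close>, the functions \<open>1 - \<Prod>\<^sub>i\<^sub><\<^sub>n (1 - b\<^sub>i\<^sub>,\<^sub>n)\<close> are test functions tending to the indicator of \<open>U\<close>.\<close>

lemma indicator_open_limit_test_functions:
  fixes U :: "(real ^ 'd) set"
  assumes "open U" "U \<subseteq> \<Omega>"
  obtains c :: "nat \<Rightarrow> real ^ 'd \<Rightarrow> real" where "\<And>n. test_function \<Omega> (c n)"
    "\<And>n x. 0 \<le> c n x" "\<And>n x. c n x \<le> 1" "\<And>x. (\<lambda>n. c n x) \<longlonglongrightarrow> indicator U x"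
proof (cases "U = {}")
  case True
  then show ?thesis using that[of "\<lambda>n x. 0"] by (auto simp: test_function_0)
next
  case False
  define F where "F = {box a b |a b. cbox a b \<subseteq> U}"
  have "\<And>S. S \<in> F \<Longrightarrow> open S" by (auto simp: F_def open_box)
  then obtain F' where F': "F' \<subseteq> F" "countable F'" "\<Union>F' = \<Union>F" using Lindelof by metis
  have UF: "\<Union>F = U"
  proof
    show "\<Union>F \<subseteq> U" using box_subset_cbox by (fastforce simp: F_def)
    show "U \<subseteq> \<Union>F"
    proof
      fix x assume "x \<in> U"
      then obtain e where e: "e > 0" "cball x e \<subseteq> U" using assms(1) open_contains_cball by blast
      obtain a b where ab: "x \<in> box a b" "box a b \<subseteq> ball x e" using rational_boxes[OF e(1), of x] by metis
      then have "cbox a b \<subseteq> closure (ball x e)"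
        using closure_mono[OF ab(2)] closure_box[of a b] ab(1) by (metis empty_iff)
      then have "cbox a b \<subseteq> U" using e closure_ball[of e x] by auto
      then show "x \<in> \<Union>F" using ab by (auto simp: F_def)
    qed
  qed
  then have "F' \<noteq> {}" using F' False by auto
  have "\<forall>i. \<exists>p. from_nat_into F' i = box (fst p) (snd p) \<and> cbox (fst p) (snd p) \<subseteq> U"
    using from_nat_into[OF \<open>F' \<noteq> {}\<close>] F'(1) by (fastforce simp: F_def)
  from choice[OF this] obtain p where p: "\<forall>i. from_nat_into F' i = box (fst (p i)) (snd (p i)) \<and> cbox (fst (p i)) (snd (p i)) \<subseteq> U"
    by blast
  define a where "a i = fst (p i)" for i
  define b where "b i = snd (p i)" for i
  have ab: "\<And>i. from_nat_into F' i = box (a i) (b i)" "\<And>i. cbox (a i) (b i) \<subseteq> U"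
    using p by (auto simp: a_def b_def)
  have "U = (\<Union>i. from_nat_into F' i)"
    using UF F'(2,3) range_from_nat_into[OF \<open>F' \<noteq> {}\<close> F'(2)] by simp
  then have U: "U = (\<Union>i. box (a i) (b i))" by (simp add: ab(1))
  define B where "B i n = box_bump (real n) (a i) (b i)" for i n
  define c where "c n x = 1 - (\<Prod>i<n. 1 - B i n x)" for n x
  have B: "0 \<le> B i n x" "B i n x \<le> 1" for i n x by (simp_all add: B_def box_bump_bounds)
  have "test_function \<Omega> (\<lambda>x. 1 - (\<Prod>i<m. 1 - B i n x))" for n m
  proof (induction m)
    case (Suc m)
    have "test_function \<Omega> (B m n)"
      unfolding B_def using ab(2)[of m] assms(2) by (intro test_function_box_bump) auto
    then have "test_function \<Omega> (\<lambda>x. (1 - (\<Prod>i<m. 1 - B i n x)) + B m n x - (1 - (\<Prod>i<m. 1 - B i n x)) * B m n x)"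
      by (intro test_function_diff test_function_add test_function_mult Suc)
    also have "(\<lambda>x. (1 - (\<Prod>i<m. 1 - B i n x)) + B m n x - (1 - (\<Prod>i<m. 1 - B i n x)) * B m n x)
      = (\<lambda>x. 1 - (\<Prod>i<Suc m. 1 - B i n x))" by (simp add: algebra_simps)
    finally show ?case .
  qed (simp add: test_function_0)
  then have tf: "test_function \<Omega> (c n)" for n
    unfolding c_def .
  moreover have c01: "0 \<le> c n x" "c n x \<le> 1" for n x
    unfolding c_def using B by (auto intro!: prod_le_1 prod_nonneg)
  moreover have "(\<lambda>n. c n x) \<longlonglongrightarrow> indicator U x" for x
  proof (cases "x \<in> U")
    case True
    then obtain i where i: "x \<in> box (a i) (b i)" using U by auto
    have "B i n x \<le> c n x" if "n > i" for n
    proof -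
      have "(\<Prod>j<n. 1 - B j n x) = (1 - B i n x) * (\<Prod>j\<in>{..<n} - {i}. 1 - B j n x)"
        using that by (subst prod.remove[of _ i]) auto
      also have "\<dots> \<le> (1 - B i n x) * 1"
        using B by (intro mult_left_mono prod_le_1) auto
      finally show ?thesis by (simp add: c_def)
    qed
    then have "\<forall>\<^sub>F n in sequentially. B i n x \<le> c n x"
      by (intro eventually_sequentiallyI[of "Suc i"]) simp
    moreover have "\<forall>\<^sub>F n in sequentially. c n x \<le> 1" using c01(2) by simp
    moreover have "(\<lambda>n. B i n x) \<longlonglongrightarrow> 1"
      unfolding B_def by (rule box_bump_tendsto[OF i])
    ultimately have "(\<lambda>n. c n x) \<longlonglongrightarrow> 1"
      by (rule tendsto_sandwich[OF _ _ _ tendsto_const])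
    then show ?thesis using True by simp
  next
    case False
    then have "B i n x = 0" for i n unfolding B_def using U by (intro box_bump_eq_0) auto
    then show ?thesis using False by (simp add: c_def)
  qed
  ultimately show ?thesis by (intro that[of c])
qed

text \<open>The hypothesis passes from test functions to indicators of open sets, hence to indicators of
relatively closed ones; and \<open>{x. f x > 0}\<close> is exhausted up to small measure by closed sets \<open>T\<close>, on
which \<open>\<integral>\<^sub>T f = 0\<close> forces \<open>T\<close> to be null.\<close>

lemma fundamental_lemma_nonpos:
  fixes \<Omega> :: "(real ^ 'd) set"
  assumes "open \<Omega>" and f: "integrable (lebesgue_on \<Omega>) f"
    and zero: "\<And>\<phi>. test_function \<Omega> \<phi> \<Longrightarrow> (LINT x|lebesgue_on \<Omega>. f x * \<phi> x) = (0::real)"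
  shows "AE x in lebesgue_on \<Omega>. f x \<le> 0"
proof -
  let ?M = "lebesgue_on \<Omega>"
  have \<Omega>: "\<Omega> \<in> sets lebesgue" using assms(1) by simp
  have fm [measurable]: "f \<in> borel_measurable ?M" using f by simp
  have opn: "(LINT x|?M. f x * indicator U x) = 0" if U: "open U" "U \<subseteq> \<Omega>" for U
  proof -
    obtain c :: "nat \<Rightarrow> real ^ 'd \<Rightarrow> real" where c: "\<And>n. test_function \<Omega> (c n)"
      "\<And>n x. 0 \<le> c n x" "\<And>n x. c n x \<le> 1" "\<And>x. (\<lambda>n. c n x) \<longlonglongrightarrow> indicator U x"
      using indicator_open_limit_test_functions[OF U] by blast
    have [measurable]: "c n \<in> borel_measurable ?M" for n
    proof -
      have "Ck_on 0 UNIV (c n)" using c(1) unfolding test_function_def by blast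
      then have "continuous_on \<Omega> (c n)" by (auto intro: continuous_on_subset)
      then show ?thesis using \<Omega> by (rule continuous_imp_measurable_on_sets_lebesgue)
    qed
    have "U \<in> sets lebesgue" using U by simp
    then have [measurable]: "U \<in> sets ?M" using U \<Omega> by (simp add: sets_restrict_space_iff)
    have "(\<lambda>n. LINT x|?M. f x * c n x) \<longlonglongrightarrow> (LINT x|?M. f x * indicator U x)"
    proof (rule integral_dominated_convergence[where w = "\<lambda>x. \<bar>f x\<bar>"])
      show "AE x in ?M. (\<lambda>n. f x * c n x) \<longlonglongrightarrow> f x * indicator U x"
        by (intro AE_I2 tendsto_mult tendsto_const c)
      show "AE x in ?M. norm (f x * c n x) \<le> \<bar>f x\<bar>" for n
        using c by (intro AE_I2) (auto simp: abs_mult mult_left_le)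
      show "integrable ?M (\<lambda>x. \<bar>f x\<bar>)" using f by simp
    qed measurable
    then show ?thesis using zero[OF c(1)] by (simp add: LIMSEQ_const_iff)
  qed
  define S where "S = {x \<in> \<Omega>. f x > 0}"
  have "S = {x \<in> space ?M. f x > 0}" by (simp add: S_def)
  also have "\<dots> \<in> sets ?M" by measurable
  finally have SM: "S \<in> sets ?M" .
  then have S: "S \<in> sets lebesgue" using \<Omega> by (simp add: sets_restrict_space_iff)
  have "emeasure lebesgue S \<le> ennreal e" if e: "e > 0" for e
  proof -
    obtain T where T: "closed T" "T \<subseteq> S" "S - T \<in> lmeasurable" "emeasure lebesgue (S - T) < ennreal e"
      using sets_lebesgue_inner_closed[OF S e] by metis
    have TM: "T \<in> sets lebesgue" "T \<subseteq> \<Omega>" using T by (auto simp: S_def)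
    then have [measurable]: "T \<in> sets ?M" using \<Omega> by (simp add: sets_restrict_space_iff)
    have [measurable]: "\<Omega> \<in> sets ?M" using \<Omega> by (simp add: sets_restrict_space_iff)
    have int: "integrable ?M (\<lambda>x. f x * indicator T x)"
      using f by (intro integrable_real_mult_indicator) auto
    have "(LINT x|?M. f x * indicator T x) = (LINT x|?M. f x * indicator \<Omega> x - f x * indicator (\<Omega> - T) x)"
      using TM by (intro Bochner_Integration.integral_cong) (auto simp: indicator_def)
    also have "\<dots> = (LINT x|?M. f x * indicator \<Omega> x) - (LINT x|?M. f x * indicator (\<Omega> - T) x)"
      using f by (intro Bochner_Integration.integral_diff integrable_real_mult_indicator) auto
    also have "\<dots> = 0"
      using assms(1) T(1) by (simp add: opn open_Diff)
    finally have "AE x in ?M. f x * indicator T x = 0"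
      using T int integral_nonneg_eq_0_iff_AE[OF int]
      by (auto simp: S_def indicator_def subset_iff less_imp_le)
    then have "AE x in ?M. x \<notin> T"
      by eventually_elim (use T in \<open>auto simp: S_def indicator_def\<close>)
    then have "emeasure ?M {x \<in> space ?M. x \<in> T} = 0" by (rule emeasure_eq_0_AE)
    also have "{x \<in> space ?M. x \<in> T} = T" using TM by auto
    finally have "emeasure ?M T = 0" .
    then have "emeasure lebesgue T = 0" using TM \<Omega> by (simp add: emeasure_restrict_space)
    then have "emeasure lebesgue S \<le> emeasure lebesgue (S - T)"
      using T(2) S TM emeasure_subadditive[of "S - T" lebesgue T] by (simp add: Un_absorb2 sets.Diff)
    then show ?thesis using T by simp
  qed
  then have "emeasure lebesgue S \<le> 0 + ennreal e" if "e > 0" for e using that by simp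
  then have "emeasure lebesgue S \<le> 0" using ennreal_le_epsilon by blast
  then have "S \<in> null_sets ?M"
    using S \<Omega> SM by (intro null_setsI) (auto simp: emeasure_restrict_space S_def)
  then show ?thesis by (rule AE_I') (auto simp: S_def not_le)
qed

lemma fundamental_lemma:
  fixes \<Omega> :: "(real ^ 'd) set"
  assumes "open \<Omega>" and f: "integrable (lebesgue_on \<Omega>) f"
    and zero: "\<And>\<phi>. test_function \<Omega> \<phi> \<Longrightarrow> (LINT x|lebesgue_on \<Omega>. f x * \<phi> x) = (0::real)"
  shows "AE x in lebesgue_on \<Omega>. f x = 0"
proof -
  have "AE x in lebesgue_on \<Omega>. f x \<le> 0" by (rule fundamental_lemma_nonpos[OF assms])
  moreover have "AE x in lebesgue_on \<Omega>. - f x \<le> 0"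
    by (rule fundamental_lemma_nonpos) (use assms in auto)
  ultimately show ?thesis by eventually_elim simp
qed

section \<open>Weak gradients\<close>

lemma integrable_compact_support:
  fixes f :: "'a::euclidean_space \<Rightarrow> 'b::{banach, second_countable_topology}"
  assumes "continuous_on UNIV f" "compact K" "\<And>x. x \<notin> K \<Longrightarrow> f x = 0"
  shows "integrable lborel f"
proof -
  have "integrable lborel (\<lambda>x. indicator K x *\<^sub>R f x)"
    using assms by (intro borel_integrable_compact) (auto intro: continuous_on_subset)
  also have "(\<lambda>x. indicator K x *\<^sub>R f x) = f" using assms(3) by (auto simp: indicator_def)
  finally show ?thesis .
qed

lemma bounded_compact_support:
  fixes f :: "'a::euclidean_space \<Rightarrow> 'b::real_normed_vector"
  assumes "continuous_on UNIV f" "compact K" "\<And>x. x \<notin> K \<Longrightarrow> f x = 0"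
  obtains M where "\<And>x. norm (f x) \<le> M" "M \<ge> 0"
proof -
  have "bounded (f ` K)"
    using assms by (intro compact_imp_bounded compact_continuous_image) (auto intro: continuous_on_subset)
  then obtain M where M: "\<And>x. x \<in> K \<Longrightarrow> norm (f x) \<le> M" by (auto simp: bounded_iff)
  have "norm (f x) \<le> max M 0" for x
    using M[of x] assms(3)[of x] by (cases "x \<in> K") auto
  then show ?thesis by (rule that) simp
qed

lemma borel_measurable_lebesgue_on:
  assumes "f \<in> borel_measurable borel"
  shows "f \<in> borel_measurable (lebesgue_on \<Omega>)"
  using assms by (intro measurable_restrict_space1 measurable_completion) simp

lemma integral_lebesgue_on_support:
  fixes f :: "'a::euclidean_space \<Rightarrow> 'b::{banach, second_countable_topology}"
  assumes "\<Omega> \<in> sets lebesgue" "f \<in> borel_measurable borel" "\<And>x. x \<notin> \<Omega> \<Longrightarrow> f x = 0"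
  shows "integral\<^sup>L (lebesgue_on \<Omega>) f = integral\<^sup>L lborel f"
proof -
  have "integral\<^sup>L (lebesgue_on \<Omega>) f = integral\<^sup>L lebesgue (\<lambda>x. indicator \<Omega> x *\<^sub>R f x)"
    using assms(1) by (intro integral_restrict_space) simp
  also have "(\<lambda>x. indicator \<Omega> x *\<^sub>R f x) = f" using assms(3) by (auto simp: indicator_def)
  also have "integral\<^sup>L lebesgue f = integral\<^sup>L lborel f"
    using assms(2) by (intro integral_completion) simp
  finally show ?thesis .
qed

lemma nn_integral_lebesgue_on_support:
  assumes "\<Omega> \<in> sets lebesgue" "\<And>x. x \<notin> \<Omega> \<Longrightarrow> f x = 0"
  shows "integral\<^sup>N (lebesgue_on \<Omega>) f = integral\<^sup>N lborel f"
proof -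
  have "integral\<^sup>N (lebesgue_on \<Omega>) f = integral\<^sup>N lebesgue (\<lambda>x. f x * indicator \<Omega> x)"
    using assms(1) by (intro nn_integral_restrict_space) simp
  also have "(\<lambda>x. f x * indicator \<Omega> x) = f" using assms(2) by (auto simp: indicator_def)
  finally show ?thesis by (simp add: nn_integral_completion)
qed

lemma L2_fun_compact_support:
  fixes f :: "'a::euclidean_space \<Rightarrow> 'b::euclidean_space"
  assumes "\<Omega> \<in> sets lebesgue" and f: "continuous_on UNIV f" "compact K" "\<And>x. x \<notin> K \<Longrightarrow> f x = 0"
  shows "L2_fun \<Omega> f"
  unfolding L2_fun_def
proof
  have "f \<in> borel_measurable borel" using f(1) by (simp add: borel_measurable_continuous_onI)
  then show "f \<in> borel_measurable (lebesgue_on \<Omega>)" by (rule borel_measurable_lebesgue_on)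
  have cont: "continuous_on UNIV (\<lambda>x. (norm (f x))\<^sup>2)" using f(1) by (intro continuous_intros)
  then have "integrable lborel (\<lambda>x. (norm (f x))\<^sup>2)"
    by (rule integrable_compact_support[OF _ f(2)]) (simp add: f)
  then have "integrable lebesgue (\<lambda>x. (norm (f x))\<^sup>2)"
    using cont by (subst integrable_completion) (auto intro: borel_measurable_continuous_onI)
  then show "integrable (lebesgue_on \<Omega>) (\<lambda>x. (norm (f x))\<^sup>2)"
    using assms(1) by (intro integrable_restrict_space[THEN iffD2] integrable_mult_indicator) auto
qed

lemma frechet_derivative_eq_0_off_support:
  fixes f :: "'a::euclidean_space \<Rightarrow> 'b::real_normed_vector"
  assumes "compact K" "\<And>x. x \<notin> K \<Longrightarrow> f x = 0" "x \<notin> K"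
  shows "frechet_derivative f (at x) e = 0"
proof -
  have "open (- K)" using assms(1) by (simp add: compact_imp_closed open_Compl)
  have "(f has_derivative (\<lambda>h. 0)) (at x)"
    by (rule has_derivative_transform_within_open[where f = "\<lambda>x. 0", OF has_derivative_const \<open>open (- K)\<close>])
       (use assms in auto)
  from fun_cong[OF frechet_derivative_at[OF this], of e] show ?thesis by simp
qed

text \<open>The integral of \<open>f (x + e) - f x\<close> vanishes by translation invariance, and difference quotients
  converge boundedly to the derivative.\<close>

lemma integral_frechet_derivative_eq_0:
  fixes f :: "'a::euclidean_space \<Rightarrow> real"
  assumes diff: "\<And>x. f differentiable (at x)"
    and cont: "continuous_on UNIV (\<lambda>x. frechet_derivative f (at x) e)"
    and K: "compact K" "\<And>x. x \<notin> K \<Longrightarrow> f x = 0"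
  shows "(LINT x|lborel. frechet_derivative f (at x) e) = 0"
proof -
  let ?D = "\<lambda>x. frechet_derivative f (at x) e"
  have deriv: "(f has_derivative frechet_derivative f (at x)) (at x)" for x
    using diff frechet_derivative_works by blast
  have fc: "continuous_on UNIV f"
    using diff by (simp add: continuous_on_eq_continuous_at differentiable_imp_continuous_within)
  have line: "((\<lambda>t. f (x + t *\<^sub>R e)) has_real_derivative ?D (x + t *\<^sub>R e)) (at t)" for x t
  proof -
    have "((\<lambda>t. f (x + t *\<^sub>R e)) has_derivative (\<lambda>h. frechet_derivative f (at (x + t *\<^sub>R e)) (h *\<^sub>R e))) (at t)"
      by (rule has_derivative_compose[OF _ deriv]) (auto intro!: derivative_eq_intros)
    moreover have "frechet_derivative f (at (x + t *\<^sub>R e)) (h *\<^sub>R e) = ?D (x + t *\<^sub>R e) * h" for h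
      using linear_frechet_derivative[OF diff, of "x + t *\<^sub>R e"] by (simp add: linear_scale)
    ultimately show ?thesis by (simp add: has_field_derivative_def mult_commute_abs)
  qed
  have Dz: "?D x = 0" if "x \<notin> K" for x
    using frechet_derivative_eq_0_off_support[OF K that] .
  obtain M where M: "\<And>x. norm (?D x) \<le> M" "M \<ge> 0" using bounded_compact_support[OF cont K(1) Dz] by blast
  obtain R where R: "\<And>x. x \<in> K \<Longrightarrow> norm x \<le> R" using compact_imp_bounded[OF K(1)] by (auto simp: bounded_iff)
  define q where "q n x = (f (x + (1 / real (Suc n)) *\<^sub>R e) - f x) * real (Suc n)" for n x
  have fint: "integrable lborel f" by (rule integrable_compact_support[OF fc K])
  have shift_int: "integrable lborel (\<lambda>x. f (x + c))" for c
    by (rule integrable_compact_support[where K = "(\<lambda>x. x - c) ` K"])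
       (use K fc in \<open>auto intro!: continuous_on_compose2[OF fc] continuous_intros compact_continuous_image simp: image_iff algebra_simps\<close>)
  have shift: "(LINT x|lborel. f (x + c)) = (LINT x|lborel. f x)" for c
  proof -
    have "(LINT x|lborel. f x) = (LINT x|distr lborel borel ((+) c). f x)" by (simp add: lborel_distr_plus)
    also have "\<dots> = (LINT x|lborel. f (c + x))"
      using fc by (subst integral_distr) (auto intro: borel_measurable_continuous_onI)
    finally show ?thesis by (simp add: add.commute)
  qed
  have q0: "(LINT x|lborel. q n x) = 0" for n
    unfolding q_def using fint shift_int by (simp add: shift)
  have "(\<lambda>n. LINT x|lborel. q n x) \<longlonglongrightarrow> (LINT x|lborel. ?D x)"
  proof (rule integral_dominated_convergence[where w = "\<lambda>x. indicator (cball 0 (R + norm e)) x * M"])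
    show "?D \<in> borel_measurable lborel" using cont by (simp add: borel_measurable_continuous_onI)
    show "q n \<in> borel_measurable lborel" for n
      unfolding q_def using fint shift_int by (intro borel_measurable_times borel_measurable_diff) auto
    show "integrable lborel (\<lambda>x. indicator (cball 0 (R + norm e)) x * M)"
      by (intro integrable_mult_left integrable_real_indicator) (use emeasure_bounded_finite[OF bounded_cball, of 0 "R + norm e"] in simp_all)
    show "AE x in lborel. (\<lambda>n. q n x) \<longlonglongrightarrow> ?D x"
    proof (rule AE_I2)
      fix x
      have "(\<lambda>h. (f (x + h *\<^sub>R e) - f x) / h) \<midarrow>0\<rightarrow> ?D x"
        using line[of x 0] by (simp add: DERIV_def)
      moreover have "filterlim (\<lambda>n. 1 / real (Suc n)) (at 0) sequentially"
        unfolding filterlim_at using LIMSEQ_inverse_real_of_nat by (auto simp: divide_inverse)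
      ultimately have "(\<lambda>n. (f (x + (1 / real (Suc n)) *\<^sub>R e) - f x) / (1 / real (Suc n))) \<longlonglongrightarrow> ?D x"
        by (rule filterlim_compose)
      then show "(\<lambda>n. q n x) \<longlonglongrightarrow> ?D x" by (simp add: q_def)
    qed
    show "AE x in lborel. norm (q n x) \<le> indicator (cball 0 (R + norm e)) x * M" for n
    proof (rule AE_I2)
      fix x
      let ?h = "1 / real (Suc n)"
      show "norm (q n x) \<le> indicator (cball 0 (R + norm e)) x * M"
      proof (cases "x \<in> cball 0 (R + norm e)")
        case True
        have "?h > 0" by simp
        obtain t where "f (x + ?h *\<^sub>R e) - f (x + 0 *\<^sub>R e) = (?h - 0) * ?D (x + t *\<^sub>R e)"
          using MVT2[OF \<open>?h > 0\<close>, of "\<lambda>t. f (x + t *\<^sub>R e)" "\<lambda>t. ?D (x + t *\<^sub>R e)"] line by metis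
        then have "q n x = ?D (x + t *\<^sub>R e)" by (simp add: q_def)
        then show ?thesis using M(1) True by simp
      next
        case False
        have "norm (?h *\<^sub>R e) \<le> norm e" by (simp add: divide_le_eq mult_left_le mult_le_cancel_left1)
        have nx: "norm x > R + norm e" using False by simp
        then have "x \<notin> K" using R[of x] norm_ge_zero[of e] by linarith
        moreover have "x + ?h *\<^sub>R e \<notin> K"
        proof
          assume "x + ?h *\<^sub>R e \<in> K"
          then have "norm (x + ?h *\<^sub>R e) \<le> R" by (rule R)
          then show False using norm_diff_ineq[of x "?h *\<^sub>R e"] \<open>norm (?h *\<^sub>R e) \<le> norm e\<close> nx by linarith
        qed
        ultimately have "q n x = 0" by (simp add: q_def K(2))
        then show ?thesis using M(2) by simp
      qed
    qed
  qed
  then show ?thesis unfolding q0 by (simp add: LIMSEQ_const_iff)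
qed

lemma test_function_C1:
  assumes "test_function \<Omega> \<phi>"
  shows "\<phi> differentiable (at x)"
    and "continuous_on UNIV \<phi>"
    and "b \<in> Basis \<Longrightarrow> continuous_on UNIV (\<lambda>x. frechet_derivative \<phi> (at x) b)"
proof -
  have 1: "Ck_on (Suc 0) UNIV \<phi>" and 0: "Ck_on 0 UNIV \<phi>"
    using assms unfolding test_function_def by blast+
  show "\<phi> differentiable (at x)" "continuous_on UNIV \<phi>" using 0 1 by auto
  show "continuous_on UNIV (\<lambda>x. frechet_derivative \<phi> (at x) b)" if "b \<in> Basis"
    using 1 that by auto
qed

lemma test_function_support:
  assumes "test_function \<Omega> \<phi>"
  obtains K where "compact K" "K \<subseteq> \<Omega>" "\<And>x. x \<notin> K \<Longrightarrow> \<phi> x = 0"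
    "\<And>x e. x \<notin> K \<Longrightarrow> frechet_derivative \<phi> (at x) e = 0"
proof -
  obtain K where K: "compact K" "K \<subseteq> \<Omega>" "\<forall>x. x \<notin> K \<longrightarrow> \<phi> x = 0"
    using assms unfolding test_function_def by blast
  then have "frechet_derivative \<phi> (at x) e = 0" if "x \<notin> K" for x e
    using frechet_derivative_eq_0_off_support[OF K(1)] that by blast
  then show ?thesis using K by (intro that[of K]) auto
qed

definition classical_gradient ::
    "(real ^ 'd \<Rightarrow> real ^ 'n) \<Rightarrow> real ^ 'd \<Rightarrow> real ^ 'd ^ 'n" where
  "classical_gradient \<phi> x = (\<chi> j i. frechet_derivative \<phi> (at x) (axis i 1) $ j)"

lemma continuous_classical_gradient:
  fixes \<phi> :: "real ^ 'd \<Rightarrow> real ^ 'n"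
  assumes "test_function \<Omega> \<phi>" shows "continuous_on UNIV (classical_gradient \<phi>)"
proof -
  have "continuous_on UNIV (\<lambda>x. frechet_derivative \<phi> (at x) (axis i 1))" for i
    by (rule test_function_C1(3)[OF assms]) (auto simp: Basis_vec_def)
  then show ?thesis
    unfolding classical_gradient_def by (intro continuous_on_vec_lambda continuous_on_component)
qed

lemma classical_gradient_eq_0:
  assumes "\<And>e. frechet_derivative \<phi> (at x) e = 0" shows "classical_gradient \<phi> x = 0"
  by (simp add: classical_gradient_def assms vec_eq_iff)

lemma test_function_L2:
  fixes \<phi> :: "'a::euclidean_space \<Rightarrow> 'b::euclidean_space"
  assumes "open \<Omega>" "test_function \<Omega> \<phi>"
  shows "L2_fun \<Omega> \<phi>" "b \<in> Basis \<Longrightarrow> L2_fun \<Omega> (\<lambda>x. frechet_derivative \<phi> (at x) b)"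
proof -
  obtain K where K: "compact K" "\<And>x. x \<notin> K \<Longrightarrow> \<phi> x = 0"
    "\<And>x e. x \<notin> K \<Longrightarrow> frechet_derivative \<phi> (at x) e = 0" using test_function_support[OF assms(2)] by metis
  have \<Omega>: "\<Omega> \<in> sets lebesgue" using assms(1) by simp
  show "L2_fun \<Omega> \<phi>"
    by (rule L2_fun_compact_support[OF \<Omega> test_function_C1(2)[OF assms(2)] K(1,2)])
  show "L2_fun \<Omega> (\<lambda>x. frechet_derivative \<phi> (at x) b)" if "b \<in> Basis"
    by (rule L2_fun_compact_support[OF \<Omega> test_function_C1(3)[OF assms(2) that] K(1)]) (simp add: K(3))
qed

lemma L2_fun_component:
  fixes f :: "'a::euclidean_space \<Rightarrow> 'b::euclidean_space ^ 'n"
  assumes "L2_fun \<Omega> f" shows "L2_fun \<Omega> (\<lambda>x. f x $ j)"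
proof (rule L2_fun_of_bound)
  show "(\<lambda>x. f x $ j) \<in> borel_measurable (lebesgue_on \<Omega>)"
  proof (rule measurable_compose[OF L2_fun_measurable[OF assms]])
    show "(\<lambda>v::'b^'n. v $ j) \<in> borel_measurable borel"
      by (intro borel_measurable_continuous_onI continuous_on_component continuous_on_id)
  qed
  show "integrable (lebesgue_on \<Omega>) (\<lambda>x. (norm (f x))\<^sup>2)" using assms by (simp add: L2_fun_def)
  show "(norm (f x $ j))\<^sup>2 \<le> (norm (f x))\<^sup>2" for x by (simp add: Finite_Cartesian_Product.norm_nth_le power_mono)
qed

text \<open>Integration by parts, in the form that the derivative of \<open>\<psi>\<^sub>j \<phi>\<close> integrates to zero; the support
of \<open>\<psi>\<close> serves for the product.\<close>

lemma has_L2_weak_gradient_classical: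
  fixes \<psi> :: "real ^ 'd \<Rightarrow> real ^ 'n"
  assumes "open \<Omega>" and \<psi>: "test_function \<Omega> \<psi>"
  shows "has_L2_weak_gradient \<Omega> \<psi> (classical_gradient \<psi>)"
  unfolding has_L2_weak_gradient_def
proof (intro conjI allI impI)
  have \<Omega>: "\<Omega> \<in> sets lebesgue" using assms(1) by simp
  obtain K where K: "compact K" "K \<subseteq> \<Omega>" "\<And>x. x \<notin> K \<Longrightarrow> \<psi> x = 0"
    "\<And>x e. x \<notin> K \<Longrightarrow> frechet_derivative \<psi> (at x) e = 0" using test_function_support[OF \<psi>] by metis
  show "L2_fun \<Omega> (classical_gradient \<psi>)"
    by (rule L2_fun_compact_support[OF \<Omega> continuous_classical_gradient[OF \<psi>] K(1)])
       (simp add: classical_gradient_eq_0 K)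
  have K\<Omega>: "\<psi> x = 0" "frechet_derivative \<psi> (at x) e = 0" if "x \<notin> \<Omega>" for x e
    using K that by blast+
  fix \<phi> :: "real ^ 'd \<Rightarrow> real" and i j
  assume \<phi>: "test_function \<Omega> \<phi>"
  let ?e = "axis i 1 :: real ^ 'd"
  have e: "?e \<in> Basis" by (auto simp: Basis_vec_def)
  let ?P = "\<lambda>x. \<psi> x $ j * \<phi> x"
  have "(\<psi> has_derivative frechet_derivative \<psi> (at x)) (at x)" for x
    using test_function_C1(1)[OF \<psi>] frechet_derivative_works by blast
  then have d1: "((\<lambda>x. \<psi> x $ j) has_derivative (\<lambda>h. frechet_derivative \<psi> (at x) h $ j)) (at x)" for x
    by (rule bounded_linear.has_derivative[OF bounded_linear_vec_nth])
  have d2: "(\<phi> has_derivative frechet_derivative \<phi> (at x)) (at x)" for x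
    using test_function_C1(1)[OF \<phi>] frechet_derivative_works by blast
  have dP: "(?P has_derivative (\<lambda>h. \<psi> x $ j * frechet_derivative \<phi> (at x) h + frechet_derivative \<psi> (at x) h $ j * \<phi> x)) (at x)" for x
    by (rule has_derivative_mult[OF d1 d2])
  have fP: "frechet_derivative ?P (at x) ?e = \<psi> x $ j * frechet_derivative \<phi> (at x) ?e + frechet_derivative \<psi> (at x) ?e $ j * \<phi> x" for x
    using frechet_derivative_at[OF dP[of x]] by (metis (no_types, lifting))
  have c: "continuous_on UNIV (\<lambda>x. \<psi> x $ j * frechet_derivative \<phi> (at x) ?e)"
     "continuous_on UNIV (\<lambda>x. frechet_derivative \<psi> (at x) ?e $ j * \<phi> x)"
    by (intro continuous_intros test_function_C1[OF \<psi>] test_function_C1[OF \<phi>] e)+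
  have "(LINT x|lborel. frechet_derivative ?P (at x) ?e) = 0"
  proof (rule integral_frechet_derivative_eq_0[OF _ _ K(1)])
    show "?P differentiable at x" for x using dP by (auto simp: differentiable_def)
    show "continuous_on UNIV (\<lambda>x. frechet_derivative ?P (at x) ?e)"
      unfolding fP by (intro continuous_on_add c)
  qed (simp add: K)
  also have "(LINT x|lborel. frechet_derivative ?P (at x) ?e) =
      (LINT x|lborel. \<psi> x $ j * frechet_derivative \<phi> (at x) ?e) + (LINT x|lborel. frechet_derivative \<psi> (at x) ?e $ j * \<phi> x)"
    unfolding fP
    by (intro Bochner_Integration.integral_add integrable_compact_support[OF c(1) K(1)] integrable_compact_support[OF c(2) K(1)])
       (simp_all add: K)
  also have "(LINT x|lborel. \<psi> x $ j * frechet_derivative \<phi> (at x) ?e) = (LINT x|lebesgue_on \<Omega>. \<psi> x $ j * frechet_derivative \<phi> (at x) ?e)"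
    by (intro integral_lebesgue_on_support[symmetric] \<Omega> borel_measurable_continuous_onI c) (simp add: K\<Omega>)
  also have "(LINT x|lborel. frechet_derivative \<psi> (at x) ?e $ j * \<phi> x) = (LINT x|lebesgue_on \<Omega>. frechet_derivative \<psi> (at x) ?e $ j * \<phi> x)"
    by (intro integral_lebesgue_on_support[symmetric] \<Omega> borel_measurable_continuous_onI c) (simp add: K\<Omega>)
  finally show "(LINT x|lebesgue_on \<Omega>. \<psi> x $ j * frechet_derivative \<phi> (at x) ?e) =
      - (LINT x|lebesgue_on \<Omega>. classical_gradient \<psi> x $ j $ i * \<phi> x)"
    by (simp add: classical_gradient_def)
qed

lemma has_L2_weak_gradient_integrable:
  fixes \<phi> :: "real ^ 'd \<Rightarrow> real"
  assumes "open \<Omega>" "test_function \<Omega> \<phi>"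
  shows "L2_fun \<Omega> u \<Longrightarrow> integrable (lebesgue_on \<Omega>) (\<lambda>x. u x $ j * frechet_derivative \<phi> (at x) (axis i 1))"
    and "L2_fun \<Omega> G \<Longrightarrow> integrable (lebesgue_on \<Omega>) (\<lambda>x. G x $ j $ i * \<phi> x)"
proof -
  have e: "axis i (1::real) \<in> Basis" by (auto simp: Basis_vec_def)
  show "integrable (lebesgue_on \<Omega>) (\<lambda>x. u x $ j * frechet_derivative \<phi> (at x) (axis i 1))" if "L2_fun \<Omega> u"
    using L2_integrable_inner[OF L2_fun_component[OF that] test_function_L2(2)[OF assms e]] by simp
  show "integrable (lebesgue_on \<Omega>) (\<lambda>x. G x $ j $ i * \<phi> x)" if "L2_fun \<Omega> G"
    using L2_integrable_inner[OF L2_fun_component[OF L2_fun_component[OF that]] test_function_L2(1)[OF assms]] by simp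
qed

text \<open>The constant \<open>weak_gradient\<close> is an arbitrary choice among the functions with the defining
property. Every computation with it replaces that choice by an explicit gradient by means of
this uniqueness.\<close>

lemma has_L2_weak_gradient_unique:
  assumes "open \<Omega>" "bounded \<Omega>" and G: "has_L2_weak_gradient \<Omega> u G" and H: "has_L2_weak_gradient \<Omega> u H"
  shows "AE x in lebesgue_on \<Omega>. G x = H x"
proof -
  have fin: "integrable (lebesgue_on \<Omega>) (\<lambda>x. 1::real)"
    using lmeasurable_open[OF assms(2,1)] by (intro finite_measure.integrable_const finite_measure_lebesgue_on)
  have GL: "L2_fun \<Omega> G" "L2_fun \<Omega> H" using G H by (auto simp: has_L2_weak_gradient_def)
  have "AE x in lebesgue_on \<Omega>. G x $ j $ i - H x $ j $ i = 0" for i j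
  proof (rule fundamental_lemma[OF assms(1)])
    let ?f = "\<lambda>x. G x $ j $ i - H x $ j $ i"
    have L: "L2_fun \<Omega> ?f" by (intro L2_fun_diff L2_fun_component GL)
    have "L2_fun \<Omega> (\<lambda>x. 1::real)" using fin by (simp add: L2_fun_def)
    from L2_integrable_inner[OF L this] show "integrable (lebesgue_on \<Omega>) ?f" by simp
    fix \<phi> :: "real ^ 'a \<Rightarrow> real" assume \<phi>: "test_function \<Omega> \<phi>"
    have "(LINT x|lebesgue_on \<Omega>. ?f x * \<phi> x) =
        (LINT x|lebesgue_on \<Omega>. G x $ j $ i * \<phi> x) - (LINT x|lebesgue_on \<Omega>. H x $ j $ i * \<phi> x)"
      unfolding left_diff_distrib
      by (intro Bochner_Integration.integral_diff has_L2_weak_gradient_integrable(2)[OF assms(1) \<phi>] GL)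
    also have "\<dots> = 0"
      using G H \<phi> unfolding has_L2_weak_gradient_def by (metis (no_types, lifting) diff_self neg_equal_iff_equal)
    finally show "(LINT x|lebesgue_on \<Omega>. ?f x * \<phi> x) = 0" .
  qed
  then have "AE x in lebesgue_on \<Omega>. \<forall>j\<in>UNIV. \<forall>i\<in>UNIV. G x $ j $ i - H x $ j $ i = 0"
    by (intro AE_finite_allI finite)
  then show ?thesis by eventually_elim (simp add: vec_eq_iff)
qed

lemma has_L2_weak_gradient_diff:
  assumes "open \<Omega>" "L2_fun \<Omega> u" "L2_fun \<Omega> v"
    and G: "has_L2_weak_gradient \<Omega> u G" and H: "has_L2_weak_gradient \<Omega> v H"
  shows "has_L2_weak_gradient \<Omega> (\<lambda>x. u x - v x) (\<lambda>x. G x - H x)"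
  unfolding has_L2_weak_gradient_def
proof (intro conjI allI impI)
  have GL: "L2_fun \<Omega> G" "L2_fun \<Omega> H" using G H by (auto simp: has_L2_weak_gradient_def)
  then show "L2_fun \<Omega> (\<lambda>x. G x - H x)" by (rule L2_fun_diff)
  fix \<phi> :: "real ^ 'a \<Rightarrow> real" and i j assume \<phi>: "test_function \<Omega> \<phi>"
  note int = has_L2_weak_gradient_integrable[OF assms(1) \<phi>]
  have "(LINT x|lebesgue_on \<Omega>. u x $ j * frechet_derivative \<phi> (at x) (axis i 1)) =
        - (LINT x|lebesgue_on \<Omega>. G x $ j $ i * \<phi> x)"
    "(LINT x|lebesgue_on \<Omega>. v x $ j * frechet_derivative \<phi> (at x) (axis i 1)) =
        - (LINT x|lebesgue_on \<Omega>. H x $ j $ i * \<phi> x)"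
    using G H \<phi> unfolding has_L2_weak_gradient_def by blast+
  then show "(LINT x|lebesgue_on \<Omega>. (u x - v x) $ j * frechet_derivative \<phi> (at x) (axis i 1)) =
        - (LINT x|lebesgue_on \<Omega>. (G x - H x) $ j $ i * \<phi> x)"
    by (simp add: left_diff_distrib int assms GL)
qed

section \<open>Translation estimates and the embedding into \<open>L\<^sup>4\<close>\<close>

lemma norm_matrix_vector_mult_le:
  fixes A :: "real ^ 'd ^ 'n" shows "norm (A *v s) \<le> norm A * norm s"
proof -
  have "norm (A *v s) = L2_set (\<lambda>j. norm (A $ j \<bullet> s)) UNIV"
    by (simp add: norm_vec_def matrix_vector_mul_component)
  also have "\<dots> \<le> L2_set (\<lambda>j. norm (A $ j) * norm s) UNIV"
    by (intro L2_set_mono) (auto simp: Cauchy_Schwarz_ineq2)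
  also have "\<dots> = norm A * norm s"
    by (simp add: norm_vec_def[of A] L2_set_left_distrib[symmetric])
  finally show ?thesis .
qed

lemma norm_frechet_derivative_le:
  fixes \<phi> :: "real ^ 'd \<Rightarrow> real ^ 'n"
  assumes "test_function \<Omega> \<phi>"
  shows "norm (frechet_derivative \<phi> (at x) s) \<le> norm (classical_gradient \<phi> x) * norm s"
proof -
  have lin: "linear (frechet_derivative \<phi> (at x))"
    using test_function_C1(1)[OF assms] by (rule linear_frechet_derivative)
  have "frechet_derivative \<phi> (at x) s = classical_gradient \<phi> x *v s"
    using matrix_works[of "frechet_derivative \<phi> (at x)" s] lin
    by (simp add: classical_gradient_def matrix_def linear_def scalar_mult_eq_scaleR[abs_def])
  then show ?thesis by (simp add: norm_matrix_vector_mult_le)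
qed

lemma nn_integral_lborel_affine:
  fixes h :: "'a::euclidean_space \<Rightarrow> ennreal"
  assumes [measurable]: "h \<in> borel_measurable borel" and "t > 0"
  shows "ennreal (t ^ DIM('a)) * (\<integral>\<^sup>+s. h (x + t *\<^sub>R s) \<partial>lborel) = (\<integral>\<^sup>+s. h s \<partial>lborel)"
proof -
  have "(\<integral>\<^sup>+s. h s \<partial>lborel) = (\<integral>\<^sup>+s. h s \<partial>density (distr lborel borel (\<lambda>s. x + t *\<^sub>R s)) (\<lambda>_. \<bar>t\<bar>^DIM('a)))"
    using lborel_affine[of t x] assms(2) by simp
  also have "\<dots> = ennreal (t ^ DIM('a)) * (\<integral>\<^sup>+s. h (x + t *\<^sub>R s) \<partial>lborel)"
    using assms(2) by (simp add: nn_integral_density nn_integral_distr nn_integral_cmult)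
  finally show ?thesis ..
qed

lemma nn_integral_lborel_shift:
  fixes h :: "'a::euclidean_space \<Rightarrow> ennreal"
  assumes "h \<in> borel_measurable borel"
  shows "(\<integral>\<^sup>+x. h (x + c) \<partial>lborel) = (\<integral>\<^sup>+x. h x \<partial>lborel)"
  using nn_integral_lborel_affine[OF assms, of 1 c] by (simp add: add.commute)

abbreviation L2_sq_nn :: "('a::euclidean_space \<Rightarrow> 'b::real_normed_vector) \<Rightarrow> ennreal" where
  "L2_sq_nn f \<equiv> (\<integral>\<^sup>+x. ennreal ((norm (f x))\<^sup>2) \<partial>lborel)"

lemma nn_integral_square_le_emeasure:
  assumes [measurable]: "f \<in> borel_measurable M" "S \<in> sets M"
  shows "(\<integral>\<^sup>+x. f x * indicator S x \<partial>M)\<^sup>2 \<le> emeasure M S * (\<integral>\<^sup>+x. (f x)\<^sup>2 * indicator S x \<partial>M)"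
proof -
  have "(\<integral>\<^sup>+x. f x * indicator S x \<partial>M)\<^sup>2 = (\<integral>\<^sup>+x. indicator S x * (f x * indicator S x) \<partial>M)\<^sup>2"
    by (intro arg_cong2[where f = "(^)"] nn_integral_cong) (auto simp: indicator_def)
  also have "\<dots> \<le> (\<integral>\<^sup>+x. (indicator S x)\<^sup>2 \<partial>M) * (\<integral>\<^sup>+x. (f x * indicator S x)\<^sup>2 \<partial>M)"
    by (intro Cauchy_Schwarz_nn_integral) auto
  also have "(\<integral>\<^sup>+x. (indicator S x :: ennreal)\<^sup>2 \<partial>M) = (\<integral>\<^sup>+x. indicator S x \<partial>M)"
    by (intro nn_integral_cong) (auto simp: indicator_def)
  also have "\<dots> = emeasure M S" by simp
  also have "(\<integral>\<^sup>+x. (f x * indicator S x)\<^sup>2 \<partial>M) = (\<integral>\<^sup>+x. (f x)\<^sup>2 * indicator S x \<partial>M)"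
    by (intro nn_integral_cong) (auto simp: indicator_def)
  finally show ?thesis .
qed

text \<open>The fundamental theorem of calculus on the segment from \<open>x\<close> to \<open>x + s\<close>. The parameter interval
excludes \<open>0\<close>, where the scaling \<open>s \<mapsto> t s\<close> and the negative powers of \<open>t\<close> used later degenerate.\<close>

lemma norm_increment_le_nn_integral:
  fixes \<phi> :: "real ^ 'd \<Rightarrow> real ^ 'n"
  assumes \<phi>: "test_function \<Omega> \<phi>"
  shows "ennreal (norm (\<phi> (x + s) - \<phi> x)) \<le>
    ennreal (norm s) * (\<integral>\<^sup>+t. ennreal (norm (classical_gradient \<phi> (x + t *\<^sub>R s))) * indicator {0<..1} t \<partial>lborel)"
proof -
  let ?g = "\<lambda>t. norm (classical_gradient \<phi> (x + t *\<^sub>R s))"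
  let ?D = "\<lambda>t. frechet_derivative \<phi> (at (x + t *\<^sub>R s)) s"
  have cg: "continuous_on A ?g" for A
    by (intro continuous_on_norm continuous_on_compose2[OF continuous_classical_gradient[OF \<phi>]] continuous_intros) auto
  have "((\<lambda>t. \<phi> (x + t *\<^sub>R s)) has_vector_derivative ?D t) (at t within {0..1})" for t
  proof -
    have d: "(\<phi> has_derivative frechet_derivative \<phi> (at y)) (at y)" for y
      using test_function_C1(1)[OF \<phi>] frechet_derivative_works by blast
    have "((\<lambda>t. \<phi> (x + t *\<^sub>R s)) has_derivative (\<lambda>h. frechet_derivative \<phi> (at (x + t *\<^sub>R s)) (h *\<^sub>R s))) (at t within {0..1})"
      by (rule has_derivative_compose[OF _ d]) (auto intro!: derivative_eq_intros)
    moreover have "frechet_derivative \<phi> (at (x + t *\<^sub>R s)) (h *\<^sub>R s) = h *\<^sub>R ?D t" for h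
      using linear_frechet_derivative[OF test_function_C1(1)[OF \<phi>]] by (rule linear_scale)
    ultimately show ?thesis by (simp add: has_vector_derivative_def)
  qed
  then have "(?D has_integral (\<phi> (x + 1 *\<^sub>R s) - \<phi> (x + 0 *\<^sub>R s))) {0..1}"
    by (intro fundamental_theorem_of_calculus) auto
  then have D: "(?D has_integral (\<phi> (x + s) - \<phi> x)) {0..1}" by simp
  have gi: "?g integrable_on {0..1}" by (intro integrable_continuous_interval cg)
  have "norm (\<phi> (x + s) - \<phi> x) \<le> integral {0..1} (\<lambda>t. ?g t * norm s)"
    using integral_norm_bound_integral[OF has_integral_integrable[OF D] integrable_on_mult_left[OF gi]]
      norm_frechet_derivative_le[OF \<phi>] integral_unique[OF D] by simp
  also have "\<dots> = norm s * integral {0..1} ?g" by simp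
  finally have "ennreal (norm (\<phi> (x + s) - \<phi> x)) \<le> ennreal (norm s) * ennreal (integral {0..1} ?g)"
    by (simp add: ennreal_leI ennreal_mult[symmetric] Henstock_Kurzweil_Integration.integral_nonneg gi)
  also have "ennreal (integral {0..1} ?g) = (\<integral>\<^sup>+t. ennreal (?g t) * indicator {0..1} t \<partial>lborel)"
    by (rule nn_integral_has_integral_lebesgue'[symmetric, OF _ integrable_integral[OF gi]]) simp
  also have "\<dots> = (\<integral>\<^sup>+t. ennreal (?g t) * indicator {0<..1} t \<partial>lborel)"
    using AE_lborel_singleton[of "0::real"]
    by (intro nn_integral_cong_AE, eventually_elim) (auto simp: indicator_def)
  finally show ?thesis .
qed

lemma gradient_measurable:
  assumes "test_function \<Omega> \<phi>"
  shows "(\<lambda>x. norm (classical_gradient \<phi> x)) \<in> borel_measurable borel"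
  by (intro borel_measurable_continuous_onI continuous_on_norm continuous_classical_gradient[OF assms])

text \<open>By Fubini, since every translate of the gradient has the same norm.\<close>

lemma translation_estimate:
  fixes \<phi> :: "real ^ 'd \<Rightarrow> real ^ 'n"
  assumes \<phi>: "test_function \<Omega> \<phi>"
  shows "L2_sq_nn (\<lambda>x. \<phi> (x + s) - \<phi> x) \<le>
    ennreal ((norm s)\<^sup>2) * L2_sq_nn (classical_gradient \<phi>)"
proof -
  let ?g = "\<lambda>x. norm (classical_gradient \<phi> x)"
  note [measurable] = gradient_measurable[OF \<phi>]
  have "ennreal ((norm (\<phi> (x + s) - \<phi> x))\<^sup>2) \<le>
      ennreal ((norm s)\<^sup>2) * (\<integral>\<^sup>+t. ennreal ((?g (x + t *\<^sub>R s))\<^sup>2) * indicator {0<..1} t \<partial>lborel)" for x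
  proof -
    have "ennreal ((norm (\<phi> (x + s) - \<phi> x))\<^sup>2) = (ennreal (norm (\<phi> (x + s) - \<phi> x)))\<^sup>2"
      by (simp add: ennreal_power)
    also have "\<dots> \<le> (ennreal (norm s) * (\<integral>\<^sup>+t. ennreal (?g (x + t *\<^sub>R s)) * indicator {0<..1} t \<partial>lborel))\<^sup>2"
      by (intro power_mono norm_increment_le_nn_integral[OF \<phi>]) simp
    also have "\<dots> = (ennreal (norm s))\<^sup>2 * (\<integral>\<^sup>+t. ennreal (?g (x + t *\<^sub>R s)) * indicator {0<..1} t \<partial>lborel)\<^sup>2"
      by (simp add: power_mult_distrib)
    also have "\<dots> \<le> (ennreal (norm s))\<^sup>2 * (emeasure lborel {0<..(1::real)} *
        (\<integral>\<^sup>+t. (ennreal (?g (x + t *\<^sub>R s)))\<^sup>2 * indicator {0<..1} t \<partial>lborel))"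
      by (intro mult_left_mono nn_integral_square_le_emeasure) auto
    finally show ?thesis by (simp add: ennreal_power)
  qed
  then have "L2_sq_nn (\<lambda>x. \<phi> (x + s) - \<phi> x) \<le>
      (\<integral>\<^sup>+x. ennreal ((norm s)\<^sup>2) * (\<integral>\<^sup>+t. ennreal ((?g (x + t *\<^sub>R s))\<^sup>2) * indicator {0<..1} t \<partial>lborel) \<partial>lborel)"
    by (intro nn_integral_mono)
  also have "\<dots> = ennreal ((norm s)\<^sup>2) *
      (\<integral>\<^sup>+x. (\<integral>\<^sup>+t. ennreal ((?g (x + t *\<^sub>R s))\<^sup>2) * indicator {0<..1} t \<partial>lborel) \<partial>lborel)"
    by (intro nn_integral_cmult) measurable
  also have "(\<integral>\<^sup>+x. (\<integral>\<^sup>+t. ennreal ((?g (x + t *\<^sub>R s))\<^sup>2) * indicator {0<..1} t \<partial>lborel) \<partial>lborel)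
      = (\<integral>\<^sup>+t. (\<integral>\<^sup>+x. ennreal ((?g (x + t *\<^sub>R s))\<^sup>2) * indicator {0<..1} t \<partial>lborel) \<partial>lborel)"
    by (rule lborel_pair.Fubini') measurable
  also have "\<dots> = (\<integral>\<^sup>+t. (\<integral>\<^sup>+x. ennreal ((?g x)\<^sup>2) \<partial>lborel) * indicator {0<..(1::real)} t \<partial>lborel)"
  proof (intro nn_integral_cong)
    fix t :: real
    have "(\<integral>\<^sup>+x. ennreal ((?g (x + t *\<^sub>R s))\<^sup>2) * indicator {0<..1} t \<partial>lborel)
      = (\<integral>\<^sup>+x. ennreal ((?g (x + t *\<^sub>R s))\<^sup>2) \<partial>lborel) * indicator {0<..1} t"
      by (intro nn_integral_multc) measurable
    also have "(\<integral>\<^sup>+x. ennreal ((?g (x + t *\<^sub>R s))\<^sup>2) \<partial>lborel) = (\<integral>\<^sup>+x. ennreal ((?g x)\<^sup>2) \<partial>lborel)"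
      by (rule nn_integral_lborel_shift[of "\<lambda>x. ennreal ((?g x)\<^sup>2)"]) measurable
    finally show "(\<integral>\<^sup>+x. ennreal ((?g (x + t *\<^sub>R s))\<^sup>2) * indicator {0<..1} t \<partial>lborel)
      = (\<integral>\<^sup>+x. ennreal ((?g x)\<^sup>2) \<partial>lborel) * indicator {0<..1} t" .
  qed
  also have "\<dots> = (\<integral>\<^sup>+x. ennreal ((?g x)\<^sup>2) \<partial>lborel)"
    by (simp add: nn_integral_cmult_indicator)
  finally show ?thesis .
qed

lemma nn_integral_powr_minus_three_quarters:
  "(\<integral>\<^sup>+t. ennreal (t powr (-3/4)) * indicator {0<..1} t \<partial>lborel) = 4"
proof -
  have "((\<lambda>t::real. t powr (-3/4)) has_integral (1 powr (-3/4 + 1) / (-3/4 + 1))) {0..1}"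
    by (rule has_integral_powr_from_0) auto
  then have hi: "((\<lambda>t::real. t powr (-3/4)) has_integral 4) {0..1}" by simp
  have "(\<integral>\<^sup>+t. ennreal (t powr (-3/4)) * indicator {0<..1} t \<partial>lborel)
      = (\<integral>\<^sup>+t. ennreal (t powr (-3/4)) * indicator {0..1} t \<partial>lborel)"
    using AE_lborel_singleton[of "0::real"]
    by (intro nn_integral_cong_AE, eventually_elim) (auto simp: indicator_def)
  also have "\<dots> = ennreal 4"
    by (rule nn_integral_has_integral_lebesgue'[OF _ hi]) simp
  finally show ?thesis by simp
qed

lemma ennreal_powr_square: "(ennreal (t powr a))\<^sup>2 = ennreal (t powr (2 * a))"
  by (simp add: power2_eq_square flip: ennreal_mult powr_add)

lemma indicator_square: "(indicator S x :: ennreal)\<^sup>2 = indicator S x"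
  by (simp add: indicator_def)

text \<open>The weight \<open>t\<^sup>-\<^sup>3\<^sup>/\<^sup>4\<close> is integrable at \<open>0\<close>. Two applications bound the fourth power of \<open>\<integral>\<^sub>0\<^sup>1 B dt\<close> by
a multiple of \<open>\<integral>\<^sub>0\<^sup>1 t\<^sup>9\<^sup>/\<^sup>4 B\<^sup>4 dt\<close>, and \<open>t\<^sup>9\<^sup>/\<^sup>4\<close> absorbs a singularity \<open>t\<^sup>-\<^sup>3\<close> of \<open>B\<^sup>4\<close> with an
integrable \<open>t\<^sup>-\<^sup>3\<^sup>/\<^sup>4\<close> left over.\<close>

lemma weighted_Cauchy_Schwarz:
  fixes f :: "real \<Rightarrow> ennreal"
  assumes [measurable]: "f \<in> borel_measurable borel"
  shows "(\<integral>\<^sup>+t. f t * indicator {0<..1} t \<partial>lborel)\<^sup>2 \<le>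
    4 * (\<integral>\<^sup>+t. ennreal (t powr (3/4)) * (f t)\<^sup>2 * indicator {0<..1} t \<partial>lborel)"
proof -
  define p q where "p t = ennreal (t powr (-3/8)) * indicator {0<..1} t"
    and "q t = ennreal (t powr (3/8)) * f t * indicator {0<..1} t" for t
  have [measurable]: "p \<in> borel_measurable lborel" "q \<in> borel_measurable lborel"
    unfolding p_def q_def by measurable
  have "f t * indicator {0<..1} t = p t * q t" for t
  proof (cases "t \<in> {0<..1}")
    case True
    have "ennreal (t powr (-3/8)) * ennreal (t powr (3/8)) = 1"
      using True by (simp add: ennreal_mult[symmetric] powr_add[symmetric])
    then have "ennreal (t powr (-3/8)) * (ennreal (t powr (3/8)) * f t) = f t"
      by (simp only: mult.assoc[symmetric] mult_1_left)
    then show ?thesis using True by (simp add: p_def q_def)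
  qed (simp add: p_def)
  then have "(\<integral>\<^sup>+t. f t * indicator {0<..1} t \<partial>lborel)\<^sup>2 = (\<integral>\<^sup>+t. p t * q t \<partial>lborel)\<^sup>2"
    by simp
  also have "\<dots> \<le> (\<integral>\<^sup>+t. (p t)\<^sup>2 \<partial>lborel) * (\<integral>\<^sup>+t. (q t)\<^sup>2 \<partial>lborel)"
    by (rule Cauchy_Schwarz_nn_integral) measurable
  also have "(\<lambda>t. (p t)\<^sup>2) = (\<lambda>t. ennreal (t powr (-3/4)) * indicator {0<..1} t)"
    by (simp add: p_def power_mult_distrib ennreal_powr_square indicator_square)
  also have "(\<integral>\<^sup>+t. ennreal (t powr (-3/4)) * indicator {0<..1} t \<partial>lborel) = 4"
    by (rule nn_integral_powr_minus_three_quarters)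
  also have "(\<lambda>t. (q t)\<^sup>2) = (\<lambda>t. ennreal (t powr (3/4)) * (f t)\<^sup>2 * indicator {0<..1} t)"
    by (simp add: q_def power_mult_distrib ennreal_powr_square indicator_square)
  finally show ?thesis .
qed

text \<open>For \<open>x\<close> in the domain and \<open>s \<in> Q\<close> the value \<open>\<phi> (x + s)\<close> vanishes, so \<open>|\<phi> x|\<close> is at most
\<open>L \<integral>\<^sub>0\<^sup>1 |\<nabla>\<phi> (x + t s)| dt\<close>. Averaging over \<open>Q\<close> gives \<open>|\<phi> x| \<le> L \<integral>\<^sub>0\<^sup>1 B t x dt\<close>, where \<open>B t x\<close> is the mean
of \<open>|\<nabla>\<phi>|\<close> over \<open>x + t Q\<close>. By Jensen's inequality its square is at most the mean \<open>C t x\<close> of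
\<open>|\<nabla>\<phi>|\<^sup>2\<close>. Scaling bounds \<open>C t x\<close> by \<open>t\<^sup>-\<^sup>d G\<close> with \<open>G = \<integral> |\<nabla>\<phi>|\<^sup>2\<close>, and \<open>C t\<close> has integral \<open>G\<close>, so the
integral of \<open>B\<^sup>4\<close> is at most \<open>t\<^sup>-\<^sup>d G\<^sup>2\<close>, which for \<open>d \<le> 3\<close> is a singularity that
\<open>weighted_Cauchy_Schwarz\<close> can absorb.\<close>

lemma L4_embedding_nn:
  fixes \<phi> :: "real ^ 'd \<Rightarrow> real ^ 'n"
  assumes \<phi>: "test_function \<Omega> \<phi>" and d: "CARD('d) \<le> 3"
    and Q: "Q \<in> sets borel" "emeasure lborel Q = 1" "\<And>s. s \<in> Q \<Longrightarrow> norm s \<le> L"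
      "\<And>x s. x \<in> \<Omega> \<Longrightarrow> s \<in> Q \<Longrightarrow> x + s \<notin> \<Omega>" and L: "L \<ge> 0"
  shows "(\<integral>\<^sup>+x. ennreal ((norm (\<phi> x)) ^ 4) \<partial>lborel) \<le>
    256 * ennreal (L ^ 4) * (L2_sq_nn (classical_gradient \<phi>))\<^sup>2"
proof -
  let ?g = "\<lambda>x. norm (classical_gradient \<phi> x)"
  note [measurable] = gradient_measurable[OF \<phi>] Q(1)
  let ?I = "indicator {0<..(1::real)} :: real \<Rightarrow> ennreal"
  let ?J = "indicator Q :: real ^ 'd \<Rightarrow> ennreal"
  define G where "G = (\<integral>\<^sup>+x. ennreal ((?g x)\<^sup>2) \<partial>lborel)"
  define B where "B t x = (\<integral>\<^sup>+s. ennreal (?g (x + t *\<^sub>R s)) * ?J s \<partial>lborel)" for t x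
  define C where "C t x = (\<integral>\<^sup>+s. ennreal ((?g (x + t *\<^sub>R s))\<^sup>2) * ?J s \<partial>lborel)" for t x
  have [measurable]: "(\<lambda>t. B t x) \<in> borel_measurable borel" for x unfolding B_def by measurable
  have [measurable]: "(\<lambda>x. C t x) \<in> borel_measurable borel" for t unfolding C_def by measurable
  have Bm [measurable]: "(\<lambda>(x, t). B t x) \<in> borel_measurable (lborel \<Otimes>\<^sub>M lborel)"
    unfolding B_def by measurable
  have Cm [measurable]: "(\<lambda>(x, t). C t x) \<in> borel_measurable (lborel \<Otimes>\<^sub>M lborel)"
    unfolding C_def by measurable
  have BC: "(B t x)\<^sup>2 \<le> C t x" for t x
  proof -
    have "(B t x)\<^sup>2 \<le> emeasure lborel Q * (\<integral>\<^sup>+s. (ennreal (?g (x + t *\<^sub>R s)))\<^sup>2 * ?J s \<partial>lborel)"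
      unfolding B_def by (intro nn_integral_square_le_emeasure) auto
    then show ?thesis by (simp add: C_def Q(2) ennreal_power)
  qed
  have CG: "ennreal (t ^ 3) * C t x \<le> G" if "0 < t" "t \<le> 1" for t x
  proof -
    have "t ^ 3 \<le> t ^ CARD('d)" using that d by (intro power_decreasing) auto
    then have "ennreal (t ^ 3) * C t x \<le> ennreal (t ^ DIM(real ^ 'd)) * (\<integral>\<^sup>+s. ennreal ((?g (x + t *\<^sub>R s))\<^sup>2) \<partial>lborel)"
      unfolding C_def by (intro mult_mono ennreal_leI nn_integral_mono) (auto simp: indicator_def)
    also have "\<dots> = G"
      unfolding G_def using that by (intro nn_integral_lborel_affine[of "\<lambda>x. ennreal ((?g x)\<^sup>2)"]) measurable
    finally show ?thesis .
  qed
  have intC: "(\<integral>\<^sup>+x. C t x \<partial>lborel) = G" for t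
  proof -
    have "(\<integral>\<^sup>+x. C t x \<partial>lborel) = (\<integral>\<^sup>+s. (\<integral>\<^sup>+x. ennreal ((?g (x + t *\<^sub>R s))\<^sup>2) * ?J s \<partial>lborel) \<partial>lborel)"
      unfolding C_def by (rule lborel_pair.Fubini') measurable
    also have "\<dots> = (\<integral>\<^sup>+s. G * ?J s \<partial>lborel)"
    proof (intro nn_integral_cong)
      fix s
      have "(\<integral>\<^sup>+x. ennreal ((?g (x + t *\<^sub>R s))\<^sup>2) * ?J s \<partial>lborel) = (\<integral>\<^sup>+x. ennreal ((?g (x + t *\<^sub>R s))\<^sup>2) \<partial>lborel) * ?J s"
        by (intro nn_integral_multc) measurable
      also have "(\<integral>\<^sup>+x. ennreal ((?g (x + t *\<^sub>R s))\<^sup>2) \<partial>lborel) = G"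
        unfolding G_def by (rule nn_integral_lborel_shift[of "\<lambda>x. ennreal ((?g x)\<^sup>2)"]) measurable
      finally show "(\<integral>\<^sup>+x. ennreal ((?g (x + t *\<^sub>R s))\<^sup>2) * ?J s \<partial>lborel) = G * ?J s" .
    qed
    also have "\<dots> = G" using Q by (simp add: nn_integral_cmult_indicator)
    finally show ?thesis .
  qed
  have point: "ennreal (norm (\<phi> x)) \<le> ennreal L * (\<integral>\<^sup>+t. B t x * ?I t \<partial>lborel)" for x
  proof (cases "x \<in> \<Omega>")
    case False
    then have "\<phi> x = 0" using \<phi> unfolding test_function_def by blast
    then show ?thesis by simp
  next
    case True
    have "ennreal (norm (\<phi> x)) = (\<integral>\<^sup>+s. ennreal (norm (\<phi> x)) * ?J s \<partial>lborel)"
      using Q by (simp add: nn_integral_cmult_indicator)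
    also have "\<dots> \<le> (\<integral>\<^sup>+s. ennreal L * (\<integral>\<^sup>+t. ennreal (?g (x + t *\<^sub>R s)) * ?J s * ?I t \<partial>lborel) \<partial>lborel)"
    proof (intro nn_integral_mono)
      fix s
      show "ennreal (norm (\<phi> x)) * ?J s \<le> ennreal L * (\<integral>\<^sup>+t. ennreal (?g (x + t *\<^sub>R s)) * ?J s * ?I t \<partial>lborel)"
      proof (cases "s \<in> Q")
        case s: True
        have "\<phi> (x + s) = 0" using \<phi> Q(4)[OF True s] unfolding test_function_def by blast
        then have "ennreal (norm (\<phi> x)) \<le> ennreal (norm s) * (\<integral>\<^sup>+t. ennreal (?g (x + t *\<^sub>R s)) * ?I t \<partial>lborel)"
          using norm_increment_le_nn_integral[OF \<phi>, of x s] by simp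
        also have "\<dots> \<le> ennreal L * (\<integral>\<^sup>+t. ennreal (?g (x + t *\<^sub>R s)) * ?I t \<partial>lborel)"
          using Q(3)[OF s] by (intro mult_right_mono ennreal_leI) auto
        finally show ?thesis using s by simp
      qed simp
    qed
    also have "\<dots> = ennreal L * (\<integral>\<^sup>+s. (\<integral>\<^sup>+t. ennreal (?g (x + t *\<^sub>R s)) * ?J s * ?I t \<partial>lborel) \<partial>lborel)"
      by (intro nn_integral_cmult) measurable
    also have "(\<integral>\<^sup>+s. (\<integral>\<^sup>+t. ennreal (?g (x + t *\<^sub>R s)) * ?J s * ?I t \<partial>lborel) \<partial>lborel)
        = (\<integral>\<^sup>+t. (\<integral>\<^sup>+s. ennreal (?g (x + t *\<^sub>R s)) * ?J s * ?I t \<partial>lborel) \<partial>lborel)"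
      by (rule lborel_pair.Fubini') measurable
    also have "\<dots> = (\<integral>\<^sup>+t. B t x * ?I t \<partial>lborel)"
      unfolding B_def by (intro nn_integral_cong nn_integral_multc) measurable
    finally show ?thesis .
  qed
  have fourth: "(\<integral>\<^sup>+t. B t x * ?I t \<partial>lborel) ^ 4 \<le>
      64 * (\<integral>\<^sup>+t. ennreal (t powr (-3/4)) * G * C t x * ?I t \<partial>lborel)" for x
  proof -
    have "(\<integral>\<^sup>+t. B t x * ?I t \<partial>lborel) ^ 4 = ((\<integral>\<^sup>+t. B t x * ?I t \<partial>lborel)\<^sup>2)\<^sup>2"
      by (simp flip: power_mult)
    also have "\<dots> \<le> (4 * (\<integral>\<^sup>+t. ennreal (t powr (3/4)) * (B t x)\<^sup>2 * ?I t \<partial>lborel))\<^sup>2"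
      by (intro power_mono weighted_Cauchy_Schwarz) auto
    also have "\<dots> = 16 * (\<integral>\<^sup>+t. ennreal (t powr (3/4)) * (B t x)\<^sup>2 * ?I t \<partial>lborel)\<^sup>2"
      by (simp add: power_mult_distrib)
    also have "\<dots> \<le> 16 * (4 * (\<integral>\<^sup>+t. ennreal (t powr (3/4)) * (ennreal (t powr (3/4)) * (B t x)\<^sup>2)\<^sup>2 * ?I t \<partial>lborel))"
      by (intro mult_left_mono weighted_Cauchy_Schwarz) auto
    also have "\<dots> = 64 * (\<integral>\<^sup>+t. ennreal (t powr (3/4)) * (ennreal (t powr (3/4)) * (B t x)\<^sup>2)\<^sup>2 * ?I t \<partial>lborel)"
      by (simp flip: mult.assoc)
    also have "\<dots> \<le> 64 * (\<integral>\<^sup>+t. ennreal (t powr (-3/4)) * G * C t x * ?I t \<partial>lborel)"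
    proof (intro mult_left_mono nn_integral_mono)
      fix t :: real
      show "ennreal (t powr (3/4)) * (ennreal (t powr (3/4)) * (B t x)\<^sup>2)\<^sup>2 * ?I t \<le> ennreal (t powr (-3/4)) * G * C t x * ?I t"
      proof (cases "t \<in> {0<..1}")
        case True
        have e: "ennreal (t powr (3/4)) * (ennreal (t powr (3/4)))\<^sup>2 = ennreal (t powr (-3/4)) * ennreal (t ^ 3)"
        proof -
          have t3: "t ^ 3 = t powr 3" using True by simp
          have "t powr (3/4) * t powr (2 * (3/4)) = t powr (-3/4) * t powr 3"
            by (simp flip: powr_add)
          then show ?thesis unfolding ennreal_powr_square t3 by (simp only: ennreal_mult[symmetric] powr_ge_zero)
        qed
        have "ennreal (t powr (3/4)) * (ennreal (t powr (3/4)) * (B t x)\<^sup>2)\<^sup>2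
            \<le> ennreal (t powr (3/4)) * (ennreal (t powr (3/4)) * C t x)\<^sup>2"
          by (intro mult_left_mono power_mono BC) auto
        also have "\<dots> = (ennreal (t powr (3/4)) * (ennreal (t powr (3/4)))\<^sup>2) * (C t x)\<^sup>2"
          by (simp add: power_mult_distrib mult.assoc)
        also have "\<dots> = ennreal (t powr (-3/4)) * (ennreal (t ^ 3) * C t x) * C t x"
          unfolding e by (simp add: power2_eq_square mult.assoc)
        also have "\<dots> \<le> ennreal (t powr (-3/4)) * G * C t x"
          using True by (intro mult_right_mono mult_left_mono CG) auto
        finally show ?thesis using True by simp
      qed simp
    qed simp
    finally show ?thesis .
  qed
  have "(\<integral>\<^sup>+x. ennreal ((norm (\<phi> x)) ^ 4) \<partial>lborel) \<le>
      (\<integral>\<^sup>+x. ennreal (L ^ 4) * (64 * (\<integral>\<^sup>+t. ennreal (t powr (-3/4)) * G * C t x * ?I t \<partial>lborel)) \<partial>lborel)"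
  proof (intro nn_integral_mono)
    fix x
    have "ennreal ((norm (\<phi> x)) ^ 4) = (ennreal (norm (\<phi> x))) ^ 4" by (simp add: ennreal_power)
    also have "\<dots> \<le> (ennreal L * (\<integral>\<^sup>+t. B t x * ?I t \<partial>lborel)) ^ 4"
      by (intro power_mono point) simp
    also have "\<dots> = ennreal (L ^ 4) * (\<integral>\<^sup>+t. B t x * ?I t \<partial>lborel) ^ 4"
      using L by (simp add: power_mult_distrib ennreal_power)
    also have "\<dots> \<le> ennreal (L ^ 4) * (64 * (\<integral>\<^sup>+t. ennreal (t powr (-3/4)) * G * C t x * ?I t \<partial>lborel))"
      by (intro mult_left_mono fourth) simp
    finally show "ennreal ((norm (\<phi> x)) ^ 4) \<le> ennreal (L ^ 4) * (64 * (\<integral>\<^sup>+t. ennreal (t powr (-3/4)) * G * C t x * ?I t \<partial>lborel))" .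
  qed
  also have "\<dots> = ennreal (L ^ 4) * (64 * (\<integral>\<^sup>+x. (\<integral>\<^sup>+t. ennreal (t powr (-3/4)) * G * C t x * ?I t \<partial>lborel) \<partial>lborel))"
  proof -
    have [measurable]: "(\<lambda>x. \<integral>\<^sup>+t. ennreal (t powr (-3/4)) * G * C t x * ?I t \<partial>lborel) \<in> borel_measurable lborel"
      by measurable
    show ?thesis by (simp add: nn_integral_cmult)
  qed
  also have "(\<integral>\<^sup>+x. (\<integral>\<^sup>+t. ennreal (t powr (-3/4)) * G * C t x * ?I t \<partial>lborel) \<partial>lborel)
      = (\<integral>\<^sup>+t. (\<integral>\<^sup>+x. ennreal (t powr (-3/4)) * G * C t x * ?I t \<partial>lborel) \<partial>lborel)"
    by (rule lborel_pair.Fubini') measurable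
  also have "\<dots> = (\<integral>\<^sup>+t. (ennreal (t powr (-3/4)) * ?I t) * G\<^sup>2 \<partial>lborel)"
  proof (intro nn_integral_cong)
    fix t
    have "(\<integral>\<^sup>+x. ennreal (t powr (-3/4)) * G * C t x * ?I t \<partial>lborel) = (\<integral>\<^sup>+x. (ennreal (t powr (-3/4)) * G * ?I t) * C t x \<partial>lborel)"
      by (simp add: ac_simps)
    also have "\<dots> = (ennreal (t powr (-3/4)) * G * ?I t) * G"
      by (subst nn_integral_cmult) (auto simp: intC)
    finally show "(\<integral>\<^sup>+x. ennreal (t powr (-3/4)) * G * C t x * ?I t \<partial>lborel) = (ennreal (t powr (-3/4)) * ?I t) * G\<^sup>2"
      by (simp add: power2_eq_square ac_simps)
  qed
  also have "\<dots> = 4 * G\<^sup>2"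
    by (subst nn_integral_multc, measurable) (simp only: nn_integral_powr_minus_three_quarters)
  also have "64 * (4 * G\<^sup>2) = 256 * G\<^sup>2"
    by (simp flip: mult.assoc)
  also have "ennreal (L ^ 4) * (256 * G\<^sup>2) = 256 * ennreal (L ^ 4) * G\<^sup>2"
    by (simp only: ac_simps)
  finally show ?thesis unfolding G_def .
qed

lemma L4_embedding_test_function:
  fixes \<Omega> :: "(real ^ 'd) set"
  assumes "bounded \<Omega>" and d: "CARD('d) \<le> 3"
  obtains K where "K \<ge> 0" "\<And>\<phi> :: real ^ 'd \<Rightarrow> real ^ 'n. test_function \<Omega> \<phi> \<Longrightarrow>
    (\<integral>\<^sup>+x. ennreal ((norm (\<phi> x)) ^ 4) \<partial>lborel) \<le>
      ennreal K * (L2_sq_nn (classical_gradient \<phi>))\<^sup>2"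
proof -
  obtain R where R: "R > 0" "\<And>x. x \<in> \<Omega> \<Longrightarrow> norm x \<le> R"
    using bounded_pos assms(1) by metis
  \<comment> \<open>A unit cube of translations that move the cube of side \<open>2 R\<close> off itself in every coordinate.\<close>
  let ?a = "(\<chi> i. 2 * R + 1) :: real ^ 'd"
  let ?Q = "cbox ?a (\<chi> i. 2 * R + 2)"
  obtain L0 where L0: "\<And>s. s \<in> ?Q \<Longrightarrow> norm s \<le> L0" using bounded_cbox[of ?a] unfolding bounded_iff by blast
  have "emeasure lborel ?Q = (\<Prod>b\<in>Basis. ((\<chi> i. 2 * R + 2) - ?a) \<bullet> b)"
    by (intro emeasure_lborel_cbox) (auto simp: Basis_vec_def inner_axis)
  also have "(\<Prod>b\<in>(Basis::(real^'d) set). ((\<chi> i. 2 * R + 2) - ?a) \<bullet> b) = 1"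
    by (intro prod.neutral) (auto simp: Basis_vec_def inner_axis)
  finally have Q1: "emeasure lborel ?Q = 1" by simp
  have away: "x + s \<notin> \<Omega>" if "x \<in> \<Omega>" "s \<in> ?Q" for x s
  proof
    assume "x + s \<in> \<Omega>"
    fix i :: 'd
    have "\<bar>(x + s) $ i\<bar> \<le> R" "\<bar>x $ i\<bar> \<le> R"
      using R(2)[OF \<open>x + s \<in> \<Omega>\<close>] R(2)[OF that(1)] component_le_norm_cart order_trans by blast+
    moreover have "s $ i \<ge> 2 * R + 1" using that(2) by (simp add: mem_box_cart)
    ultimately show False by simp
  qed
  show ?thesis
  proof (rule that)
    show "0 \<le> 256 * (max L0 0) ^ 4" by simp
    fix \<phi> :: "real ^ 'd \<Rightarrow> real ^ 'n" assume \<phi>: "test_function \<Omega> \<phi>"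
    have "(\<integral>\<^sup>+x. ennreal ((norm (\<phi> x)) ^ 4) \<partial>lborel) \<le>
       256 * ennreal ((max L0 0) ^ 4) * (L2_sq_nn (classical_gradient \<phi>))\<^sup>2"
      by (rule L4_embedding_nn[OF \<phi> d, of ?Q]) (use Q1 L0 away in \<open>auto simp: le_max_iff_disj\<close>)
    then show "(\<integral>\<^sup>+x. ennreal ((norm (\<phi> x)) ^ 4) \<partial>lborel) \<le>
       ennreal (256 * (max L0 0) ^ 4) * (L2_sq_nn (classical_gradient \<phi>))\<^sup>2"
      by (simp add: ennreal_mult)
  qed
qed

section \<open>Rellich's compactness theorem\<close>

definition cell :: "real \<Rightarrow> real ^ 'd \<Rightarrow> int ^ 'd" where
  "cell h x = (\<chi> i. \<lfloor>x $ i / h\<rfloor>)"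

lemma cell_eq_iff:
  assumes "h > 0"
  shows "cell h x = z \<longleftrightarrow> (\<forall>i. of_int (z $ i) * h \<le> x $ i \<and> x $ i < (of_int (z $ i) + 1) * h)"
  using assms by (auto simp: cell_def vec_eq_iff floor_eq_iff field_simps)

lemma measurable_cell: "cell h \<in> borel \<rightarrow>\<^sub>M count_space UNIV"
  unfolding measurable_count_space_eq2_countable
proof (intro conjI ballI)
  fix z :: "int ^ 'a"
  have "Measurable.pred borel (\<lambda>x::real^'a. \<forall>i. \<lfloor>x $ i / h\<rfloor> = z $ i)" by measurable
  then show "cell h -` {z} \<inter> space borel \<in> sets borel"
    by (simp add: pred_def cell_def vec_eq_iff vimage_def)
qed simp

lemma emeasure_cell:
  fixes z :: "int ^ 'd"
  assumes h: "h > 0" shows "emeasure lborel {y. cell h y = z} = ennreal (h ^ CARD('d))"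
proof -
  define a b :: "real ^ 'd" where "a = (\<chi> i. of_int (z $ i) * h)" and "b = (\<chi> i. (of_int (z $ i) + 1) * h)"
  have S: "{y. cell h y = z} \<in> sets lborel"
    using measurable_sets[OF measurable_cell, of "{z}" h] by (simp add: vimage_def)
  have ab: "(\<Prod>i\<in>Basis. (b - a) \<bullet> i) = h ^ CARD('d)"
  proof -
    have "(\<Prod>i\<in>Basis. (b - a) \<bullet> i) = (\<Prod>i\<in>(Basis :: (real^'d) set). h)"
      by (intro prod.cong) (auto simp: Basis_vec_def inner_axis a_def b_def algebra_simps)
    then show ?thesis by simp
  qed
  have le: "\<And>i. i \<in> Basis \<Longrightarrow> a \<bullet> i \<le> b \<bullet> i"
    using h by (auto simp: Basis_vec_def inner_axis a_def b_def)
  have "emeasure lborel {y. cell h y = z} \<le> emeasure lborel (cbox a b)"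
    using h by (intro emeasure_mono) (auto simp: cell_eq_iff mem_box_cart a_def b_def less_imp_le)
  moreover have "emeasure lborel (box a b) \<le> emeasure lborel {y. cell h y = z}"
    using h S by (intro emeasure_mono) (auto simp: cell_eq_iff mem_box_cart a_def b_def less_imp_le)
  ultimately show ?thesis
    using le ab by (simp add: emeasure_lborel_cbox emeasure_lborel_box antisym)
qed

text \<open>Cauchy--Schwarz against the indicator of the cell, whose measure is \<open>h\<^sup>d\<close>.\<close>

lemma cell_integral_square_le:
  fixes f :: "real ^ 'd \<Rightarrow> 'b::euclidean_space"
  assumes h: "h > 0" and f: "integrable lborel f"
  shows "ennreal ((norm (LINT y|lborel. indicator {y. cell h y = z} y *\<^sub>R f y))\<^sup>2) \<le>
    ennreal (h ^ CARD('d)) * (\<integral>\<^sup>+y. ennreal ((norm (f y))\<^sup>2) * indicator {y. cell h y = z} y \<partial>lborel)"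
proof -
  let ?S = "{y. cell h y = z}"
  have S [measurable]: "?S \<in> sets lborel"
    using measurable_sets[OF measurable_cell, of "{z}" h] by (simp add: vimage_def)
  have [measurable]: "f \<in> borel_measurable lborel" using f by simp
  have int: "integrable lborel (\<lambda>y. indicator ?S y *\<^sub>R f y)"
    by (intro integrable_mult_indicator f S)
  have "ennreal ((norm (LINT y|lborel. indicator ?S y *\<^sub>R f y))\<^sup>2)
      = (ennreal (norm (LINT y|lborel. indicator ?S y *\<^sub>R f y)))\<^sup>2"
    by (simp add: ennreal_power)
  also have "\<dots> \<le> (\<integral>\<^sup>+y. ennreal (norm (indicator ?S y *\<^sub>R f y)) \<partial>lborel)\<^sup>2"
    by (intro power_mono integral_norm_bound_ennreal int) simp
  also have "(\<integral>\<^sup>+y. ennreal (norm (indicator ?S y *\<^sub>R f y)) \<partial>lborel)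
      = (\<integral>\<^sup>+y. ennreal (norm (f y)) * indicator ?S y \<partial>lborel)"
    by (rule nn_integral_cong) (simp add: indicator_def)
  also have "\<dots>\<^sup>2 \<le> emeasure lborel ?S * (\<integral>\<^sup>+y. (ennreal (norm (f y)))\<^sup>2 * indicator ?S y \<partial>lborel)"
    by (rule nn_integral_square_le_emeasure) measurable
  finally show ?thesis by (simp add: emeasure_cell[OF h] ennreal_power)
qed

definition cell_mean :: "real \<Rightarrow> (real ^ 'd \<Rightarrow> 'b::euclidean_space) \<Rightarrow> real ^ 'd \<Rightarrow> 'b" where
  "cell_mean h f x = (LINT y|lborel. indicator {y. cell h y = cell h x} y *\<^sub>R f y) /\<^sub>R h ^ CARD('d)"

lemma borel_measurable_cell_mean: "cell_mean h f \<in> borel_measurable borel"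
proof -
  have "cell_mean h f = (\<lambda>z. (LINT y|lborel. indicator {y. cell h y = z} y *\<^sub>R f y) /\<^sub>R h ^ CARD('a)) \<circ> cell h"
    by (auto simp: cell_mean_def)
  also have "\<dots> \<in> borel_measurable borel"
    using measurable_cell by (rule measurable_comp) simp
  finally show ?thesis .
qed

lemma norm_cell_mean_square_le:
  fixes f :: "real ^ 'd \<Rightarrow> 'b::euclidean_space"
  assumes h: "h > 0" and f: "integrable lborel f"
  shows "ennreal (h ^ CARD('d)) * ennreal ((norm (cell_mean h f x))\<^sup>2) \<le>
    (\<integral>\<^sup>+y. ennreal ((norm (f y))\<^sup>2) * indicator {y. cell h y = cell h x} y \<partial>lborel)" (is "_ \<le> ?R")
proof -
  let ?V = "h ^ CARD('d)" and ?I = "LINT y|lborel. indicator {y. cell h y = cell h x} y *\<^sub>R f y"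
  have V: "?V > 0" using h by simp
  have "ennreal ?V * ennreal ((norm (cell_mean h f x))\<^sup>2) = ennreal (1 / ?V) * ennreal ((norm ?I)\<^sup>2)"
    unfolding cell_mean_def using V h
    by (simp add: ennreal_mult[symmetric] power_mult_distrib power_divide field_simps power2_eq_square)
  also have "\<dots> \<le> ennreal (1 / ?V) * (ennreal ?V * ?R)"
    by (intro mult_left_mono cell_integral_square_le h f) simp
  also have "\<dots> = ?R" using V h by (simp add: mult.assoc[symmetric] ennreal_mult[symmetric])
  finally show ?thesis .
qed

text \<open>Averaged over a cell of side \<open>h\<close>, a function differs from itself only by translations of
  length at most \<open>h \<surd>d\<close>, so the translation estimate bounds the distance to the cell means.\<close>

lemma cell_mean_estimate:
  fixes \<phi> :: "real ^ 'd \<Rightarrow> real ^ 'n"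
  assumes \<phi>: "test_function \<Omega> \<phi>" and h: "h > 0"
  shows "L2_sq_nn (\<lambda>x. \<phi> x - cell_mean h \<phi> x) \<le>
    ennreal (2 ^ CARD('d) * real CARD('d) * h\<^sup>2) *
      L2_sq_nn (classical_gradient \<phi>)"
proof -
  let ?V = "h ^ CARD('d)"
  let ?W = "cbox (\<chi> i. - h) (\<chi> i. h) :: (real ^ 'd) set"
  define G where "G = L2_sq_nn (classical_gradient \<phi>)"
  have V: "?V > 0" using h by simp
  obtain K where K: "compact K" "\<And>x. x \<notin> K \<Longrightarrow> \<phi> x = 0" using test_function_support[OF \<phi>] by metis
  have \<phi>i: "integrable lborel \<phi>" by (rule integrable_compact_support[OF test_function_C1(2)[OF \<phi>] K])
  have [measurable]: "\<phi> \<in> borel_measurable borel" using \<phi>i by simp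
  have Wm [measurable]: "?W \<in> sets borel" by simp
  have point: "ennreal ?V * ennreal ((norm (\<phi> x - cell_mean h \<phi> x))\<^sup>2) \<le>
      (\<integral>\<^sup>+s. ennreal ((norm (\<phi> (x + s) - \<phi> x))\<^sup>2) * indicator ?W s \<partial>lborel)" for x
  proof -
    let ?S = "{y. cell h y = cell h x}"
    have S [measurable]: "?S \<in> sets lborel"
      using measurable_sets[OF measurable_cell, of "{cell h x}" h] by (simp add: vimage_def)
    have Sfin: "emeasure lborel ?S < \<infinity>" by (simp add: emeasure_cell[OF h])
    have mS: "measure lborel ?S = ?V" using V by (simp add: measure_def emeasure_cell[OF h])
    have i1: "integrable lborel (\<lambda>y. indicator ?S y *\<^sub>R \<phi> y)" by (intro integrable_mult_indicator \<phi>i S)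
    have i2: "integrable lborel (\<lambda>y. indicator ?S y *\<^sub>R \<phi> x)"
      using Sfin S by (intro integrable_scaleR_left integrable_real_indicator)
    have i3: "(LINT y|lborel. indicator ?S y *\<^sub>R \<phi> x) = ?V *\<^sub>R \<phi> x"
      using Sfin S by (subst integral_scaleR_left) (simp_all add: mS)
    have "(LINT y|lborel. indicator ?S y *\<^sub>R (\<phi> y - \<phi> x)) =
        (LINT y|lborel. indicator ?S y *\<^sub>R \<phi> y) - ?V *\<^sub>R \<phi> x"
      using i1 i2 by (simp add: scaleR_diff_right i3)
    then have eq: "cell_mean h \<phi> x - \<phi> x = (LINT y|lborel. indicator ?S y *\<^sub>R (\<phi> y - \<phi> x)) /\<^sub>R ?V"
      unfolding cell_mean_def using h by (simp add: scaleR_diff_right)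
    have int: "integrable lborel (\<lambda>y. indicator ?S y *\<^sub>R (\<phi> y - \<phi> x))"
      unfolding scaleR_diff_right by (intro Bochner_Integration.integrable_diff i1 i2)
    \<comment> \<open>The difference is a cell mean of a function cut off to the cell, so the bound above applies.\<close>
    have "(\<lambda>y. indicator ?S y *\<^sub>R (indicator ?S y *\<^sub>R (\<phi> y - \<phi> x))) = (\<lambda>y. indicator ?S y *\<^sub>R (\<phi> y - \<phi> x))"
      by (auto simp: indicator_def)
    then have "cell_mean h (\<lambda>y. indicator ?S y *\<^sub>R (\<phi> y - \<phi> x)) x = cell_mean h \<phi> x - \<phi> x"
      unfolding eq by (simp add: cell_mean_def)
    then have "ennreal ?V * ennreal ((norm (\<phi> x - cell_mean h \<phi> x))\<^sup>2) \<le>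
        (\<integral>\<^sup>+y. ennreal ((norm (indicator ?S y *\<^sub>R (\<phi> y - \<phi> x)))\<^sup>2) * indicator ?S y \<partial>lborel)"
      using norm_cell_mean_square_le[OF h int, of x] by (simp add: norm_minus_commute)
    also have "\<dots> \<le> (\<integral>\<^sup>+y. ennreal ((norm (\<phi> y - \<phi> x))\<^sup>2) * indicator ?W (y - x) \<partial>lborel)"
    proof (intro nn_integral_mono)
      fix y
      have "y - x \<in> ?W" if "y \<in> ?S"
      proof -
        have "- h \<le> (y - x) $ i \<and> (y - x) $ i \<le> h" for i
        proof -
          define k where "k = of_int (cell h x $ i) * h"
          have "k \<le> x $ i" "x $ i < k + h" "k \<le> y $ i" "y $ i < k + h"
            using cell_eq_iff[OF h, of x "cell h x"] cell_eq_iff[OF h, of y "cell h x"] that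
            by (simp_all add: k_def distrib_right)
          then show ?thesis by simp
        qed
        then show ?thesis by (simp add: mem_box_cart)
      qed
      then show "ennreal ((norm (indicator ?S y *\<^sub>R (\<phi> y - \<phi> x)))\<^sup>2) * indicator ?S y
          \<le> ennreal ((norm (\<phi> y - \<phi> x))\<^sup>2) * indicator ?W (y - x)"
        by (auto simp: indicator_def)
    qed
    also have "\<dots> = (\<integral>\<^sup>+s. ennreal ((norm (\<phi> (s + x) - \<phi> x))\<^sup>2) * indicator ?W (s + x - x) \<partial>lborel)"
      by (rule nn_integral_lborel_shift[symmetric, of "\<lambda>y. ennreal ((norm (\<phi> y - \<phi> x))\<^sup>2) * indicator ?W (y - x)"]) measurable
    finally show ?thesis by (simp add: add.commute)
  qed
  note [measurable] = borel_measurable_cell_mean[of h \<phi>]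
  have "ennreal ?V * L2_sq_nn (\<lambda>x. \<phi> x - cell_mean h \<phi> x)
      = (\<integral>\<^sup>+x. ennreal ?V * ennreal ((norm (\<phi> x - cell_mean h \<phi> x))\<^sup>2) \<partial>lborel)"
    by (rule nn_integral_cmult[symmetric]) measurable
  also have "\<dots> \<le> (\<integral>\<^sup>+x. (\<integral>\<^sup>+s. ennreal ((norm (\<phi> (x + s) - \<phi> x))\<^sup>2) * indicator ?W s \<partial>lborel) \<partial>lborel)"
    by (intro nn_integral_mono point)
  also have "\<dots> = (\<integral>\<^sup>+s. (\<integral>\<^sup>+x. ennreal ((norm (\<phi> (x + s) - \<phi> x))\<^sup>2) * indicator ?W s \<partial>lborel) \<partial>lborel)"
    by (rule lborel_pair.Fubini') measurable
  also have "\<dots> \<le> (\<integral>\<^sup>+s. (ennreal (real CARD('d) * h\<^sup>2) * G) * indicator ?W s \<partial>lborel)"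
  proof (intro nn_integral_mono)
    fix s :: "real ^ 'd"
    have "(\<integral>\<^sup>+x. ennreal ((norm (\<phi> (x + s) - \<phi> x))\<^sup>2) * indicator ?W s \<partial>lborel)
        = L2_sq_nn (\<lambda>x. \<phi> (x + s) - \<phi> x) * indicator ?W s"
      by (rule nn_integral_multc) measurable
    also have "\<dots> \<le> (ennreal ((norm s)\<^sup>2) * G) * indicator ?W s"
      unfolding G_def by (intro mult_right_mono translation_estimate[OF \<phi>]) simp
    also have "\<dots> \<le> (ennreal (real CARD('d) * h\<^sup>2) * G) * indicator ?W s"
    proof (cases "s \<in> ?W")
      case True
      have "(norm s)\<^sup>2 = (\<Sum>i\<in>UNIV. (s $ i)\<^sup>2)"
        by (simp add: norm_vec_def L2_set_def sum_nonneg)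
      also have "\<dots> \<le> (\<Sum>i\<in>(UNIV::'d set). h\<^sup>2)"
      proof (intro sum_mono)
        fix i
        have "- h \<le> s $ i" "s $ i \<le> h" using True by (simp_all add: mem_box_cart)
        then have "\<bar>s $ i\<bar> \<le> \<bar>h\<bar>" by linarith
        then show "(s $ i)\<^sup>2 \<le> h\<^sup>2" by (simp add: abs_le_square_iff)
      qed
      finally show ?thesis by (intro mult_right_mono ennreal_leI) auto
    qed simp
    finally show "(\<integral>\<^sup>+x. ennreal ((norm (\<phi> (x + s) - \<phi> x))\<^sup>2) * indicator ?W s \<partial>lborel)
      \<le> (ennreal (real CARD('d) * h\<^sup>2) * G) * indicator ?W s" .
  qed
  also have "\<dots> = (ennreal (real CARD('d) * h\<^sup>2) * G) * ennreal (2 ^ CARD('d) * ?V)"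
  proof -
    have "emeasure lborel ?W = (\<Prod>i\<in>Basis. ((\<chi> i. h) - (\<chi> i. - h) :: real ^ 'd) \<bullet> i)"
      using h by (intro emeasure_lborel_cbox) (auto simp: Basis_vec_def inner_axis)
    also have "(\<Prod>i\<in>Basis. ((\<chi> i. h) - (\<chi> i. - h) :: real ^ 'd) \<bullet> i) = (\<Prod>i\<in>(Basis::(real^'d) set). 2 * h)"
      by (intro prod.cong) (auto simp: Basis_vec_def inner_axis)
    finally show ?thesis by (simp add: nn_integral_cmult_indicator power_mult_distrib)
  qed
  finally have le: "ennreal ?V * L2_sq_nn (\<lambda>x. \<phi> x - cell_mean h \<phi> x)
      \<le> (ennreal (real CARD('d) * h\<^sup>2) * G) * ennreal (2 ^ CARD('d) * ?V)" .
  have "L2_sq_nn (\<lambda>x. \<phi> x - cell_mean h \<phi> x)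
      = ennreal (1 / ?V) * (ennreal ?V * L2_sq_nn (\<lambda>x. \<phi> x - cell_mean h \<phi> x))"
    using V h by (simp add: mult.assoc[symmetric] ennreal_mult[symmetric])
  also have "\<dots> \<le> ennreal (1 / ?V) * ((ennreal (real CARD('d) * h\<^sup>2) * G) * ennreal (2 ^ CARD('d) * ?V))"
    by (intro mult_left_mono le) simp
  also have "\<dots> = (ennreal (1 / ?V) * ennreal (real CARD('d) * h\<^sup>2) * ennreal (2 ^ CARD('d) * ?V)) * G"
    by (simp only: ac_simps)
  also have "ennreal (1 / ?V) * ennreal (real CARD('d) * h\<^sup>2) * ennreal (2 ^ CARD('d) * ?V)
      = ennreal (1 / ?V * (real CARD('d) * h\<^sup>2) * (2 ^ CARD('d) * ?V))"
    using h by (simp only: ennreal_mult[symmetric] zero_le_mult_iff zero_le_power zero_le_divide_iff less_imp_le of_nat_0_le_iff zero_le_one zero_le_numeral simp_thms)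
  also have "1 / ?V * (real CARD('d) * h\<^sup>2) * (2 ^ CARD('d) * ?V) = 2 ^ CARD('d) * real CARD('d) * h\<^sup>2"
    using h by (simp add: field_simps)
  finally show ?thesis unfolding G_def .
qed

lemma norm_four_square_le:
  fixes a b c d e :: "'a::real_inner"
  shows "(norm (a - e))\<^sup>2 \<le> 4 * ((norm (a - b))\<^sup>2 + (norm (b - c))\<^sup>2 + (norm (d - c))\<^sup>2 + (norm (e - d))\<^sup>2)"
proof -
  have "a - e = ((a - b) + (b - c)) + ((c - d) + (d - e))" by simp
  then have "(norm (a - e))\<^sup>2 \<le> 2 * (norm ((a - b) + (b - c)))\<^sup>2 + 2 * (norm ((c - d) + (d - e)))\<^sup>2"
    using norm_add_sq_le[of "(a - b) + (b - c)" "(c - d) + (d - e)"] by metis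
  also have "\<dots> \<le> 2 * (2 * (norm (a - b))\<^sup>2 + 2 * (norm (b - c))\<^sup>2) + 2 * (2 * (norm (c - d))\<^sup>2 + 2 * (norm (d - e))\<^sup>2)"
    by (intro add_mono mult_left_mono norm_add_sq_le) auto
  finally show ?thesis by (simp add: norm_minus_commute[of c d] norm_minus_commute[of d e])
qed

text \<open>The cell means over the grids of side \<open>2\<^sup>-\<^sup>l\<close> are countably many bounded sequences of
  vectors, so along a subsequence they all converge; dominated convergence makes the projections onto
  each grid converge in \<open>L\<^sup>2\<close>, and the distance to them is uniformly small.\<close>

lemma rellich_test_functions:
  fixes \<phi> :: "nat \<Rightarrow> real ^ 'd \<Rightarrow> real ^ 'n"
  assumes \<Omega>: "open \<Omega>" "bounded \<Omega>" and \<phi>: "\<And>n. test_function \<Omega> (\<phi> n)" and "B \<ge> 0"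
    and B0: "\<And>n. L2_sq_nn (\<phi> n) \<le> ennreal B"
    and B1: "\<And>n. L2_sq_nn (classical_gradient (\<phi> n)) \<le> ennreal B"
  obtains r :: "nat \<Rightarrow> nat" where "strict_mono r" "\<And>e. e > 0 \<Longrightarrow>
    \<exists>N. \<forall>m\<ge>N. \<forall>n\<ge>N. L2_sq_nn (\<lambda>x. \<phi> (r m) x - \<phi> (r n) x) \<le> ennreal e"
proof -
  have \<phi>i: "integrable lborel (\<phi> n)" for n
  proof -
    obtain K where "compact K" "\<And>x. x \<notin> K \<Longrightarrow> \<phi> n x = 0" using test_function_support[OF \<phi>] by metis
    then show ?thesis using integrable_compact_support[OF test_function_C1(2)[OF \<phi>]] by blast
  qed
  have \<phi>m [measurable]: "\<phi> n \<in> borel_measurable borel" for n using \<phi>i[of n] by simp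
  have \<phi>0: "\<phi> n x = 0" if "x \<notin> \<Omega>" for n x using \<phi> that unfolding test_function_def by blast
  define H :: "nat \<Rightarrow> real" where "H l = 1 / 2 ^ l" for l
  have H: "H l > 0" "H l \<le> 1" for l by (simp_all add: H_def)
  define a where "a n p = (LINT y|lborel. indicator {y. cell (H (fst p)) y = snd p} y *\<^sub>R \<phi> n y)"
    for n and p :: "nat \<times> (int ^ 'd)"
  have "norm (a n p) \<le> sqrt B" for n p
  proof -
    have "ennreal ((norm (a n p))\<^sup>2) \<le> ennreal (H (fst p) ^ CARD('d)) *
        (\<integral>\<^sup>+y. ennreal ((norm (\<phi> n y))\<^sup>2) * indicator {y. cell (H (fst p)) y = snd p} y \<partial>lborel)"
      unfolding a_def by (rule cell_integral_square_le[OF H(1) \<phi>i])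
    also have "\<dots> \<le> ennreal 1 * (\<integral>\<^sup>+y. ennreal ((norm (\<phi> n y))\<^sup>2) \<partial>lborel)"
      using H[of "fst p"] by (intro mult_mono ennreal_leI nn_integral_mono) (auto simp: power_le_one indicator_def)
    also have "\<dots> \<le> ennreal B" using B0[of n] by simp
    finally have "(norm (a n p))\<^sup>2 \<le> B" using \<open>B \<ge> 0\<close> by simp
    then show ?thesis by (rule real_le_rsqrt)
  qed
  then obtain r where r: "strict_mono r" "\<And>p. \<exists>l. (\<lambda>n. a (r n) p) \<longlonglongrightarrow> l"
    using function_convergent_subsequence[of "UNIV :: (nat \<times> (int ^ 'd)) set" a "sqrt B"]
    by (metis UNIV_I countableI_type)
  define P where "P l n = cell_mean (H l) (\<phi> (r n))" for l n
  define Pbar where "Pbar l x = lim (\<lambda>n. P l n x)" for l x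
  have [measurable]: "P l n \<in> borel_measurable borel" for l n
    unfolding P_def by (rule borel_measurable_cell_mean)
  have [measurable]: "Pbar l \<in> borel_measurable borel" for l
    unfolding Pbar_def by measurable
  have [measurable]: "\<Omega> \<in> sets borel" using \<Omega> by simp
  have Plim: "(\<lambda>n. P l n x) \<longlonglongrightarrow> Pbar l x" for l x
  proof -
    obtain v where "(\<lambda>n. a (r n) (l, cell (H l) x)) \<longlonglongrightarrow> v" using r(2) by blast
    then have "(\<lambda>n. P l n x) \<longlonglongrightarrow> v /\<^sub>R H l ^ CARD('d)"
      unfolding P_def cell_mean_def a_def by (intro tendsto_scaleR tendsto_const) simp
    then show ?thesis unfolding Pbar_def by (simp add: limI)
  qed
  have Pbound: "(norm (P l n x))\<^sup>2 \<le> B / H l ^ CARD('d)" for l n x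
  proof -
    have "ennreal (H l ^ CARD('d)) * ennreal ((norm (P l n x))\<^sup>2) \<le>
        (\<integral>\<^sup>+y. ennreal ((norm (\<phi> (r n) y))\<^sup>2) * indicator {y. cell (H l) y = cell (H l) x} y \<partial>lborel)"
      unfolding P_def by (rule norm_cell_mean_square_le[OF H(1) \<phi>i])
    also have "\<dots> \<le> (\<integral>\<^sup>+y. ennreal ((norm (\<phi> (r n) y))\<^sup>2) \<partial>lborel)"
      by (intro nn_integral_mono) (auto simp: indicator_def)
    also have "\<dots> \<le> ennreal B" by (rule B0)
    finally have "ennreal (H l ^ CARD('d) * (norm (P l n x))\<^sup>2) \<le> ennreal B"
      using H(1)[of l] by (simp add: ennreal_mult)
    then have "H l ^ CARD('d) * (norm (P l n x))\<^sup>2 \<le> B" using \<open>B \<ge> 0\<close> by simp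
    then show ?thesis using H(1)[of l] by (simp add: field_simps)
  qed
  have Pconv: "(\<lambda>n. \<integral>\<^sup>+x. ennreal ((norm (P l n x - Pbar l x))\<^sup>2) * indicator \<Omega> x \<partial>lborel) \<longlonglongrightarrow> 0" for l
  proof -
    let ?c = "B / H l ^ CARD('d)"
    have lim_bound: "(norm (Pbar l x))\<^sup>2 \<le> ?c" for x
    proof (rule tendsto_upperbound)
      show "(\<lambda>n. (norm (P l n x))\<^sup>2) \<longlonglongrightarrow> (norm (Pbar l x))\<^sup>2" by (intro tendsto_intros Plim)
    qed (auto simp: Pbound)
    have bd: "(norm (P l n x - Pbar l x))\<^sup>2 \<le> 4 * ?c" for n x
      using norm_add_sq_le[of "P l n x" "- Pbar l x"] Pbound[of l n x] lim_bound[of x] by simp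
    have "(\<lambda>n. \<integral>\<^sup>+x. ennreal ((norm (P l n x - Pbar l x))\<^sup>2) * indicator \<Omega> x \<partial>lborel) \<longlonglongrightarrow> (\<integral>\<^sup>+x. (0::ennreal) \<partial>(lborel :: (real^'d) measure))"
    proof (rule nn_integral_dominated_convergence[where w = "\<lambda>x. ennreal (4 * ?c) * indicator \<Omega> x"])
      show "AE x in lborel. ennreal ((norm (P l n x - Pbar l x))\<^sup>2) * indicator \<Omega> x \<le> ennreal (4 * ?c) * indicator \<Omega> x" for n
        by (intro AE_I2 mult_right_mono ennreal_leI bd) simp
      show "(\<integral>\<^sup>+x. ennreal (4 * ?c) * indicator \<Omega> x \<partial>lborel) < \<infinity>"
        using emeasure_bounded_finite[OF \<Omega>(2)] by (simp add: nn_integral_cmult_indicator ennreal_mult_less_top)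
      show "AE x in lborel. (\<lambda>n. ennreal ((norm (P l n x - Pbar l x))\<^sup>2) * indicator \<Omega> x) \<longlonglongrightarrow> 0"
      proof (rule AE_I2)
        fix x
        have "(\<lambda>n. (norm (P l n x - Pbar l x))\<^sup>2) \<longlonglongrightarrow> (norm (Pbar l x - Pbar l x))\<^sup>2"
          by (intro tendsto_intros Plim)
        then have "(\<lambda>n. ennreal ((norm (P l n x - Pbar l x))\<^sup>2)) \<longlonglongrightarrow> ennreal 0"
          by (intro tendsto_ennrealI) simp
        then show "(\<lambda>n. ennreal ((norm (P l n x - Pbar l x))\<^sup>2) * indicator \<Omega> x) \<longlonglongrightarrow> 0"
          by (cases "x \<in> \<Omega>") auto
      qed
    qed measurable
    then show ?thesis by simp
  qed
  define C where "C = 2 ^ CARD('d) * real CARD('d) * B"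
  have C: "C \<ge> 0" using \<open>B \<ge> 0\<close> by (simp add: C_def)
  have near: "L2_sq_nn (\<lambda>x. \<phi> (r n) x - P l n x) \<le> ennreal (C * (H l)\<^sup>2)" for l n
  proof -
    have "L2_sq_nn (\<lambda>x. \<phi> (r n) x - P l n x) \<le>
        ennreal (2 ^ CARD('d) * real CARD('d) * (H l)\<^sup>2) * ennreal B"
      unfolding P_def
      by (rule order_trans[OF cell_mean_estimate[OF \<phi> H(1)]]) (intro mult_left_mono B1, simp)
    then show ?thesis using \<open>B \<ge> 0\<close> by (simp add: ennreal_mult[symmetric] C_def ac_simps)
  qed
  show ?thesis
  proof (rule that[OF r(1)])
    fix e :: real assume e: "e > 0"
    have "(\<lambda>l. C * (H l)\<^sup>2) \<longlonglongrightarrow> C * 0\<^sup>2"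
      unfolding H_def using LIMSEQ_divide_realpow_zero[of 2 1] by (intro tendsto_intros) simp
    then have "\<forall>\<^sub>F l in sequentially. C * (H l)\<^sup>2 < e / 16"
      using e by (intro order_tendstoD(2)) auto
    then obtain l where l: "C * (H l)\<^sup>2 < e / 16" by (auto simp: eventually_sequentially)
    define Q where "Q n = (\<integral>\<^sup>+x. ennreal ((norm (P l n x - Pbar l x))\<^sup>2) * indicator \<Omega> x \<partial>lborel)" for n
    have "\<forall>\<^sub>F n in sequentially. Q n < ennreal (e / 16)"
      unfolding Q_def using e by (intro order_tendstoD(2)[OF Pconv]) simp
    then obtain N where N: "\<And>n. n \<ge> N \<Longrightarrow> Q n < ennreal (e / 16)" by (auto simp: eventually_sequentially)
    have "L2_sq_nn (\<lambda>x. \<phi> (r m) x - \<phi> (r n) x) \<le> ennreal e" if "m \<ge> N" "n \<ge> N" for m n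
    proof -
      let ?D = "\<lambda>n x. ennreal ((norm (\<phi> (r n) x - P l n x))\<^sup>2)"
      let ?Q = "\<lambda>n x. ennreal ((norm (P l n x - Pbar l x))\<^sup>2) * indicator \<Omega> x"
      have "L2_sq_nn (\<lambda>x. \<phi> (r m) x - \<phi> (r n) x) \<le>
          (\<integral>\<^sup>+x. 4 * (?D m x + ?Q m x + ?Q n x + ?D n x) \<partial>lborel)"
      proof (rule nn_integral_mono)
        fix x
        show "ennreal ((norm (\<phi> (r m) x - \<phi> (r n) x))\<^sup>2) \<le> 4 * (?D m x + ?Q m x + ?Q n x + ?D n x)"
        proof (cases "x \<in> \<Omega>")
          case True
          have "ennreal ((norm (\<phi> (r m) x - \<phi> (r n) x))\<^sup>2) \<le> ennreal (4 * ((norm (\<phi> (r m) x - P l m x))\<^sup>2 +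
              (norm (P l m x - Pbar l x))\<^sup>2 + (norm (P l n x - Pbar l x))\<^sup>2 + (norm (\<phi> (r n) x - P l n x))\<^sup>2))"
            by (intro ennreal_leI norm_four_square_le)
          then show ?thesis using True by (simp add: ennreal_mult)
        qed (simp add: \<phi>0)
      qed
      also have "\<dots> = 4 * ((\<integral>\<^sup>+x. ?D m x \<partial>lborel) + Q m + Q n + (\<integral>\<^sup>+x. ?D n x \<partial>lborel))"
        unfolding Q_def by (simp add: nn_integral_cmult nn_integral_add)
      also have "\<dots> \<le> 4 * (ennreal (e / 16) + ennreal (e / 16) + ennreal (e / 16) + ennreal (e / 16))"
        using order_trans[OF near ennreal_leI[OF less_imp_le[OF l]]] N[OF that(1)] N[OF that(2)]
        by (intro mult_left_mono add_mono) (auto simp: less_imp_le)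
      also have "\<dots> = ennreal (4 * (e / 16 + e / 16 + e / 16 + e / 16))"
        using e by (simp only: ennreal_plus[symmetric] ennreal_mult ennreal_numeral add_nonneg_nonneg less_imp_le divide_pos_pos zero_less_numeral zero_le_numeral)
      also have "\<dots> = ennreal e" by simp
      finally show ?thesis .
    qed
    then show "\<exists>N. \<forall>m\<ge>N. \<forall>n\<ge>N. L2_sq_nn (\<lambda>x. \<phi> (r m) x - \<phi> (r n) x) \<le> ennreal e"
      by blast
  qed
qed

section \<open>The spaces \<open>H\<^sup>1\<close> and \<open>H\<^sub>0\<^sup>1\<close>\<close>

lemma L2_inner_diff_diff:
  assumes "L2_fun \<Omega> f" "L2_fun \<Omega> g"
  shows "L2_dist_sq \<Omega> f g = L2_inner \<Omega> f f - 2 * L2_inner \<Omega> f g + L2_inner \<Omega> g g"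
proof -
  have "(f x - g x) \<bullet> (f x - g x) = f x \<bullet> f x - 2 * (f x \<bullet> g x) + g x \<bullet> g x" for x
    by (simp add: inner_diff_left inner_diff_right inner_commute)
  then show ?thesis using assms by (simp add: L2_inner_def L2_integrable_inner)
qed

lemma L2_inner_self_tendsto:
  assumes f: "\<And>n. L2_fun \<Omega> (f n)" "L2_fun \<Omega> g"
    and lim: "(\<lambda>n. L2_dist_sq \<Omega> (f n) g) \<longlonglongrightarrow> 0"
  shows "(\<lambda>n. L2_inner \<Omega> (f n) (f n)) \<longlonglongrightarrow> L2_inner \<Omega> g g"
proof -
  have "L2_inner \<Omega> (f n) (f n) =
      L2_dist_sq \<Omega> (f n) g + 2 * L2_inner \<Omega> (f n) g - L2_inner \<Omega> g g" for n
    using L2_inner_diff_diff[OF f(1)[of n] f(2)] by simp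
  moreover have "(\<lambda>n. L2_dist_sq \<Omega> (f n) g + 2 * L2_inner \<Omega> (f n) g - L2_inner \<Omega> g g)
      \<longlonglongrightarrow> 0 + 2 * L2_inner \<Omega> g g - L2_inner \<Omega> g g"
    by (intro tendsto_intros lim L2_inner_tendsto[OF f f(2) lim])
  ultimately show ?thesis by simp
qed

lemma L2_fun_scaleR_const: "L2_fun \<Omega> g \<Longrightarrow> L2_fun \<Omega> (\<lambda>x. g x *\<^sub>R c)" for g :: "_ \<Rightarrow> real"
  by (auto simp: L2_fun_def power_mult_distrib)

lemma H1_L2: "u \<in> H1 \<Omega> \<Longrightarrow> L2_fun \<Omega> u"
  by (simp add: H1_def)

lemma H1_has_weak_gradient:
  assumes "u \<in> H1 \<Omega>" shows "has_L2_weak_gradient \<Omega> u (weak_gradient \<Omega> u)"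
proof -
  have "\<exists>G. has_L2_weak_gradient \<Omega> u G" using assms by (simp add: H1_def)
  then show ?thesis unfolding weak_gradient_def by (rule someI_ex)
qed

lemma H1_gradient_L2: "u \<in> H1 \<Omega> \<Longrightarrow> L2_fun \<Omega> (weak_gradient \<Omega> u)"
  using H1_has_weak_gradient by (auto simp: has_L2_weak_gradient_def)

lemma H1_I: "L2_fun \<Omega> u \<Longrightarrow> has_L2_weak_gradient \<Omega> u G \<Longrightarrow> u \<in> H1 \<Omega>"
  by (auto simp: H1_def)

lemma H10_H1: "u \<in> H10 \<Omega> \<Longrightarrow> u \<in> H1 \<Omega>"
  by (auto simp: H10_def H1_tendsto_def)

lemma H1_norm_power2: "(H1_norm \<Omega> u)\<^sup>2 = L2_inner \<Omega> u u + dirichlet_form \<Omega> u u"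
  by (simp add: H1_norm_def dirichlet_form_def)

abbreviation H1_dist_sq :: "(real ^ 'd) set \<Rightarrow> (real ^ 'd \<Rightarrow> real ^ 'n) \<Rightarrow> (real ^ 'd \<Rightarrow> real ^ 'n) \<Rightarrow> real" where
  "H1_dist_sq \<Omega> u v \<equiv> L2_dist_sq \<Omega> u v + L2_dist_sq \<Omega> (weak_gradient \<Omega> u) (weak_gradient \<Omega> v)"

context
  fixes \<Omega> :: "(real ^ 'd) set"
  assumes \<Omega>: "open \<Omega>" "bounded \<Omega>"
begin

lemma weak_gradient_AE:
  fixes u :: "real ^ 'd \<Rightarrow> real ^ 'n"
  assumes "u \<in> H1 \<Omega>" "has_L2_weak_gradient \<Omega> u G"
  shows "AE x in lebesgue_on \<Omega>. weak_gradient \<Omega> u x = G x"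
  using has_L2_weak_gradient_unique[OF \<Omega> H1_has_weak_gradient[OF assms(1)] assms(2)] .

lemma H1_diff:
  fixes u v :: "real ^ 'd \<Rightarrow> real ^ 'n"
  assumes "u \<in> H1 \<Omega>" "v \<in> H1 \<Omega>"
  shows "(\<lambda>x. u x - v x) \<in> H1 \<Omega>"
    and "AE x in lebesgue_on \<Omega>. weak_gradient \<Omega> (\<lambda>x. u x - v x) x = weak_gradient \<Omega> u x - weak_gradient \<Omega> v x"
proof -
  have *: "has_L2_weak_gradient \<Omega> (\<lambda>x. u x - v x) (\<lambda>x. weak_gradient \<Omega> u x - weak_gradient \<Omega> v x)"
    using assms by (intro has_L2_weak_gradient_diff \<Omega> H1_L2 H1_has_weak_gradient)
  show 1: "(\<lambda>x. u x - v x) \<in> H1 \<Omega>"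
    using assms by (intro H1_I[OF _ *] L2_fun_diff H1_L2)
  show "AE x in lebesgue_on \<Omega>. weak_gradient \<Omega> (\<lambda>x. u x - v x) x = weak_gradient \<Omega> u x - weak_gradient \<Omega> v x"
    by (rule weak_gradient_AE[OF 1 *])
qed

lemma dirichlet_form_diff_left:
  fixes u v z :: "real ^ 'd \<Rightarrow> real ^ 'n"
  assumes "u \<in> H1 \<Omega>" "v \<in> H1 \<Omega>" "z \<in> H1 \<Omega>"
  shows "dirichlet_form \<Omega> (\<lambda>x. u x - v x) z = dirichlet_form \<Omega> u z - dirichlet_form \<Omega> v z"
proof -
  have "dirichlet_form \<Omega> (\<lambda>x. u x - v x) z =
      L2_inner \<Omega> (\<lambda>x. weak_gradient \<Omega> u x - weak_gradient \<Omega> v x) (weak_gradient \<Omega> z)"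
    unfolding dirichlet_form_def using assms
    by (intro L2_inner_cong_AE H1_diff L2_fun_diff H1_gradient_L2) auto
  then show ?thesis
    using assms by (simp add: dirichlet_form_def L2_inner_diff_left H1_gradient_L2)
qed

lemma dirichlet_form_diff_diff:
  fixes u v :: "real ^ 'd \<Rightarrow> real ^ 'n"
  assumes "u \<in> H1 \<Omega>" "v \<in> H1 \<Omega>"
  shows "dirichlet_form \<Omega> (\<lambda>x. u x - v x) (\<lambda>x. u x - v x) =
    L2_dist_sq \<Omega> (weak_gradient \<Omega> u) (weak_gradient \<Omega> v)"
  unfolding dirichlet_form_def using assms
  by (intro L2_inner_cong_AE H1_diff L2_fun_diff H1_gradient_L2)

lemma H1_tendsto_iff:
  fixes f :: "nat \<Rightarrow> real ^ 'd \<Rightarrow> real ^ 'n"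
  assumes "\<And>n. f n \<in> H1 \<Omega>" "u \<in> H1 \<Omega>"
  shows "H1_tendsto \<Omega> f u \<longleftrightarrow> (\<lambda>n. H1_dist_sq \<Omega> (f n) u) \<longlonglongrightarrow> 0"
proof -
  have sq: "(H1_norm \<Omega> (\<lambda>x. f n x - u x))\<^sup>2 = H1_dist_sq \<Omega> (f n) u" for n
    by (simp add: H1_norm_power2 dirichlet_form_diff_diff assms)
  have "H1_tendsto \<Omega> f u \<longleftrightarrow> (\<lambda>n. (H1_norm \<Omega> (\<lambda>x. f n x - u x))\<^sup>2) \<longlonglongrightarrow> 0"
    using assms by (simp add: H1_tendsto_def power_tendsto_0_iff)
  then show ?thesis unfolding sq .
qed

lemma H1_tendsto_parts:
  fixes f :: "nat \<Rightarrow> real ^ 'd \<Rightarrow> real ^ 'n"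
  assumes "H1_tendsto \<Omega> f u"
  shows "(\<lambda>n. L2_dist_sq \<Omega> (f n) u) \<longlonglongrightarrow> 0"
    and "(\<lambda>n. L2_dist_sq \<Omega> (weak_gradient \<Omega> (f n)) (weak_gradient \<Omega> u)) \<longlonglongrightarrow> 0"
proof -
  have lim: "(\<lambda>n. H1_dist_sq \<Omega> (f n) u) \<longlonglongrightarrow> 0"
    using H1_tendsto_iff[of f u] assms by (auto simp: H1_tendsto_def)
  show "(\<lambda>n. L2_dist_sq \<Omega> (f n) u) \<longlonglongrightarrow> 0"
    by (rule tendsto_sandwich[OF _ _ tendsto_const lim]) auto
  show "(\<lambda>n. L2_dist_sq \<Omega> (weak_gradient \<Omega> (f n)) (weak_gradient \<Omega> u)) \<longlonglongrightarrow> 0"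
    by (rule tendsto_sandwich[OF _ _ tendsto_const lim]) auto
qed

lemma H1_dist_sq_triangle:
  fixes u v w :: "real ^ 'd \<Rightarrow> real ^ 'n"
  assumes "u \<in> H1 \<Omega>" "v \<in> H1 \<Omega>" "w \<in> H1 \<Omega>"
  shows "H1_dist_sq \<Omega> u w \<le> 2 * H1_dist_sq \<Omega> u v + 2 * H1_dist_sq \<Omega> v w"
  using L2_inner_triangle_sq[OF assms[THEN H1_L2]] L2_inner_triangle_sq[OF assms[THEN H1_gradient_L2]]
  unfolding distrib_left by linarith

lemma H1_dist_sq_diff_diff:
  fixes f g u v :: "real ^ 'd \<Rightarrow> real ^ 'n"
  assumes H: "f \<in> H1 \<Omega>" "g \<in> H1 \<Omega>" "u \<in> H1 \<Omega>" "v \<in> H1 \<Omega>"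
  shows "H1_dist_sq \<Omega> (\<lambda>x. f x - g x) (\<lambda>x. u x - v x) \<le> 2 * H1_dist_sq \<Omega> f u + 2 * H1_dist_sq \<Omega> g v"
proof -
  let ?D = "weak_gradient \<Omega>"
  have "L2_dist_sq \<Omega> (\<lambda>x. f x - g x) (\<lambda>x. u x - v x) \<le> 2 * L2_dist_sq \<Omega> f u + 2 * L2_dist_sq \<Omega> g v"
    using L2_inner_diff_sq_le[OF L2_fun_diff[OF H(1,3)[THEN H1_L2]] L2_fun_diff[OF H(2,4)[THEN H1_L2]]]
    by (simp add: algebra_simps)
  moreover have "L2_dist_sq \<Omega> (?D (\<lambda>x. f x - g x)) (?D (\<lambda>x. u x - v x)) \<le>
      2 * L2_dist_sq \<Omega> (?D f) (?D u) + 2 * L2_dist_sq \<Omega> (?D g) (?D v)"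
  proof -
    have ae: "AE x in lebesgue_on \<Omega>. ?D (\<lambda>x. f x - g x) x - ?D (\<lambda>x. u x - v x) x = (?D f x - ?D u x) - (?D g x - ?D v x)"
      using H1_diff(2)[OF H(1,2)] H1_diff(2)[OF H(3,4)] by eventually_elim simp
    have L: "L2_fun \<Omega> (\<lambda>x. ?D (\<lambda>x. f x - g x) x - ?D (\<lambda>x. u x - v x) x)"
      by (intro L2_fun_diff H1_gradient_L2 H1_diff H)
    have R: "L2_fun \<Omega> (\<lambda>x. ?D f x - ?D u x)" "L2_fun \<Omega> (\<lambda>x. ?D g x - ?D v x)"
      by (intro L2_fun_diff H1_gradient_L2 H)+
    show ?thesis
      using L2_inner_cong_AE[OF ae ae L L2_fun_diff[OF R] L L2_fun_diff[OF R]] L2_inner_diff_sq_le[OF R] by simp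
  qed
  ultimately show ?thesis unfolding distrib_left by linarith
qed

lemma test_function_H1:
  fixes \<phi> :: "real ^ 'd \<Rightarrow> real ^ 'n"
  assumes "test_function \<Omega> \<phi>" shows "\<phi> \<in> H1 \<Omega>"
  by (rule H1_I[OF test_function_L2(1)[OF \<Omega>(1) assms] has_L2_weak_gradient_classical[OF \<Omega>(1) assms]])

lemma test_function_nn_integrals:
  fixes \<phi> :: "real ^ 'd \<Rightarrow> real ^ 'n"
  assumes \<phi>: "test_function \<Omega> \<phi>"
  shows "L2_sq_nn \<phi> = ennreal (L2_inner \<Omega> \<phi> \<phi>)"
    and "L2_sq_nn (classical_gradient \<phi>) = ennreal (dirichlet_form \<Omega> \<phi> \<phi>)"
proof -
  have \<Omega>s: "\<Omega> \<in> sets lebesgue" using \<Omega>(1) by simp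
  have 0: "\<phi> x = 0" "classical_gradient \<phi> x = 0" if "x \<notin> \<Omega>" for x
  proof -
    obtain K where "K \<subseteq> \<Omega>" "\<And>x. x \<notin> K \<Longrightarrow> \<phi> x = 0"
      "\<And>x e. x \<notin> K \<Longrightarrow> frechet_derivative \<phi> (at x) e = 0" using test_function_support[OF \<phi>] by metis
    then show "\<phi> x = 0" "classical_gradient \<phi> x = 0" using that by (auto intro!: classical_gradient_eq_0)
  qed
  have cl: "has_L2_weak_gradient \<Omega> \<phi> (classical_gradient \<phi>)"
    by (rule has_L2_weak_gradient_classical[OF \<Omega>(1) \<phi>])
  have G: "L2_fun \<Omega> (classical_gradient \<phi>)" using cl by (simp add: has_L2_weak_gradient_def)
  show "L2_sq_nn \<phi> = ennreal (L2_inner \<Omega> \<phi> \<phi>)"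
    unfolding L2_inner_self_nn[OF test_function_L2(1)[OF \<Omega>(1) \<phi>], symmetric]
    by (rule nn_integral_lebesgue_on_support[OF \<Omega>s, symmetric]) (simp add: 0)
  have "dirichlet_form \<Omega> \<phi> \<phi> = L2_inner \<Omega> (classical_gradient \<phi>) (classical_gradient \<phi>)"
    unfolding dirichlet_form_def using test_function_H1[OF \<phi>]
    by (intro L2_inner_cong_AE weak_gradient_AE cl G H1_gradient_L2)
  then show "L2_sq_nn (classical_gradient \<phi>) = ennreal (dirichlet_form \<Omega> \<phi> \<phi>)"
    using L2_inner_self_nn[OF G] nn_integral_lebesgue_on_support[OF \<Omega>s, of "\<lambda>x. ennreal ((norm (classical_gradient \<phi> x))\<^sup>2)"] 0
    by simp
qed

lemma H10_I:
  fixes u :: "real ^ 'd \<Rightarrow> real ^ 'n"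
  assumes "u \<in> H1 \<Omega>" "\<And>n. test_function \<Omega> (\<phi> n)" "(\<lambda>n. H1_dist_sq \<Omega> (\<phi> n) u) \<longlonglongrightarrow> 0"
  shows "u \<in> H10 \<Omega>"
proof -
  have "H1_tendsto \<Omega> \<phi> u"
    using H1_tendsto_iff[of \<phi> u, OF test_function_H1[OF assms(2)] assms(1)] assms(3) by blast
  then show ?thesis using assms(2) by (auto simp: H10_def)
qed

lemma H10_approx:
  fixes u :: "nat \<Rightarrow> real ^ 'd \<Rightarrow> real ^ 'n"
  assumes u: "\<And>n. u n \<in> H10 \<Omega>"
  obtains \<phi> where "\<And>n. test_function \<Omega> (\<phi> n)" "\<And>n. H1_dist_sq \<Omega> (\<phi> n) (u n) < inverse (real (Suc n))"
proof -
  have "\<forall>n. \<exists>\<phi>. test_function \<Omega> \<phi> \<and> H1_dist_sq \<Omega> \<phi> (u n) < inverse (real (Suc n))"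
  proof
    fix n
    obtain \<phi> where \<phi>: "\<And>k. test_function \<Omega> (\<phi> k)" "H1_tendsto \<Omega> \<phi> (u n)"
      using u[of n] by (auto simp: H10_def)
    have "(\<lambda>k. H1_dist_sq \<Omega> (\<phi> k) (u n)) \<longlonglongrightarrow> 0"
      using \<phi>(2) unfolding H1_tendsto_iff[OF test_function_H1[OF \<phi>(1)] H10_H1[OF u]] .
    then have "\<forall>\<^sub>F k in sequentially. H1_dist_sq \<Omega> (\<phi> k) (u n) < inverse (real (Suc n))"
      by (rule order_tendstoD(2)) simp
    then obtain k where "H1_dist_sq \<Omega> (\<phi> k) (u n) < inverse (real (Suc n))"
      by (auto simp: eventually_sequentially)
    then show "\<exists>\<phi>. test_function \<Omega> \<phi> \<and> H1_dist_sq \<Omega> \<phi> (u n) < inverse (real (Suc n))"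
      using \<phi>(1)[of k] by blast
  qed
  from choice[OF this] show ?thesis using that by blast
qed

text \<open>Each member of the sequence may be replaced by a test function that is ever closer to it.\<close>

lemma H10_closed:
  fixes u :: "nat \<Rightarrow> real ^ 'd \<Rightarrow> real ^ 'n"
  assumes u: "\<And>n. u n \<in> H10 \<Omega>" and lim: "H1_tendsto \<Omega> u w"
  shows "w \<in> H10 \<Omega>"
proof -
  have w: "w \<in> H1 \<Omega>" using lim by (simp add: H1_tendsto_def)
  obtain \<phi> where \<phi>: "\<And>n. test_function \<Omega> (\<phi> n)" "\<And>n. H1_dist_sq \<Omega> (\<phi> n) (u n) < inverse (real (Suc n))"
    using H10_approx[of u, OF u] by blast
  note \<phi>H = test_function_H1[OF \<phi>(1)]
  have "(\<lambda>n. H1_dist_sq \<Omega> (\<phi> n) w) \<longlonglongrightarrow> 0"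
  proof (rule tendsto_sandwich[OF _ _ tendsto_const])
    have "(\<lambda>n. 2 * inverse (real (Suc n)) + 2 * H1_dist_sq \<Omega> (u n) w) \<longlonglongrightarrow> 2 * 0 + 2 * 0"
      using lim unfolding H1_tendsto_iff[OF H10_H1[OF u] w]
      by (intro tendsto_add tendsto_mult tendsto_const LIMSEQ_inverse_real_of_nat)
    then show "(\<lambda>n. 2 * inverse (real (Suc n)) + 2 * H1_dist_sq \<Omega> (u n) w) \<longlonglongrightarrow> 0" by simp
    have "H1_dist_sq \<Omega> (\<phi> n) w \<le> 2 * inverse (real (Suc n)) + 2 * H1_dist_sq \<Omega> (u n) w" for n
      by (rule order_trans[OF H1_dist_sq_triangle[OF \<phi>H H10_H1[OF u[of n]] w]])
         (intro add_right_mono mult_left_mono less_imp_le[OF \<phi>(2)], simp)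
    then show "\<forall>\<^sub>F n in sequentially. H1_dist_sq \<Omega> (\<phi> n) w \<le> 2 * inverse (real (Suc n)) + 2 * H1_dist_sq \<Omega> (u n) w"
      by (rule always_eventually[OF allI])
  qed simp
  then show ?thesis by (rule H10_I[OF w \<phi>(1)])
qed

lemma H10_diff:
  fixes u v :: "real ^ 'd \<Rightarrow> real ^ 'n"
  assumes u: "u \<in> H10 \<Omega>" and v: "v \<in> H10 \<Omega>"
  shows "(\<lambda>x. u x - v x) \<in> H10 \<Omega>"
proof -
  obtain \<phi> \<psi> where \<phi>: "\<And>n. test_function \<Omega> (\<phi> n)" "H1_tendsto \<Omega> \<phi> u"
    and \<psi>: "\<And>n. test_function \<Omega> (\<psi> n)" "H1_tendsto \<Omega> \<psi> v"
    using u v by (auto simp: H10_def)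
  note uH = H10_H1[OF u] and vH = H10_H1[OF v] and \<phi>H = test_function_H1[OF \<phi>(1)] and \<psi>H = test_function_H1[OF \<psi>(1)]
  have diff: "test_function \<Omega> (\<lambda>x. \<phi> n x - \<psi> n x)" for n by (intro test_function_diff \<phi> \<psi>)
  have "(\<lambda>n. H1_dist_sq \<Omega> (\<lambda>x. \<phi> n x - \<psi> n x) (\<lambda>x. u x - v x)) \<longlonglongrightarrow> 0"
  proof (rule tendsto_sandwich[OF _ _ tendsto_const])
    have "(\<lambda>n. 2 * H1_dist_sq \<Omega> (\<phi> n) u + 2 * H1_dist_sq \<Omega> (\<psi> n) v) \<longlonglongrightarrow> 2 * 0 + 2 * 0"
      using \<phi>(2) \<psi>(2) unfolding H1_tendsto_iff[OF \<phi>H uH] H1_tendsto_iff[OF \<psi>H vH]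
      by (intro tendsto_add tendsto_mult tendsto_const)
    then show "(\<lambda>n. 2 * H1_dist_sq \<Omega> (\<phi> n) u + 2 * H1_dist_sq \<Omega> (\<psi> n) v) \<longlonglongrightarrow> 0" by simp
    show "\<forall>\<^sub>F n in sequentially. H1_dist_sq \<Omega> (\<lambda>x. \<phi> n x - \<psi> n x) (\<lambda>x. u x - v x) \<le>
        2 * H1_dist_sq \<Omega> (\<phi> n) u + 2 * H1_dist_sq \<Omega> (\<psi> n) v"
      by (rule always_eventually[OF allI], rule H1_dist_sq_diff_diff[OF \<phi>H \<psi>H uH vH])
  qed simp
  then show ?thesis by (rule H10_I[OF H1_diff(1)[OF uH vH] diff])
qed

text \<open>The identity that defines a weak gradient is an equality of inner products with fixed functions
in \<open>L\<^sup>2\<close>, so it survives in the limit of the functions and of their gradients.\<close>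

lemma H1_complete:
  fixes u :: "nat \<Rightarrow> real ^ 'd \<Rightarrow> real ^ 'n"
  assumes u: "\<And>n. u n \<in> H1 \<Omega>"
    and c0: "\<And>e. e > 0 \<Longrightarrow> \<exists>N. \<forall>m\<ge>N. \<forall>n\<ge>N. L2_dist_sq \<Omega> (u m) (u n) < e"
    and c1: "\<And>e. e > 0 \<Longrightarrow> \<exists>N. \<forall>m\<ge>N. \<forall>n\<ge>N. dirichlet_form \<Omega> (\<lambda>x. u m x - u n x) (\<lambda>x. u m x - u n x) < e"
  shows "\<exists>w. H1_tendsto \<Omega> u w"
proof -
  obtain w where w: "L2_fun \<Omega> w" "(\<lambda>n. L2_dist_sq \<Omega> (u n) w) \<longlonglongrightarrow> 0"
    using L2_complete[OF H1_L2[OF u] c0] by blast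
  obtain G where G: "L2_fun \<Omega> G"
    "(\<lambda>n. L2_dist_sq \<Omega> (weak_gradient \<Omega> (u n)) G) \<longlonglongrightarrow> 0"
    using L2_complete[OF H1_gradient_L2[OF u] c1[unfolded dirichlet_form_diff_diff[OF u u]]] by blast
  have wG: "has_L2_weak_gradient \<Omega> w G"
    unfolding has_L2_weak_gradient_def
  proof (intro conjI allI impI G(1))
    fix \<phi> :: "real ^ 'd \<Rightarrow> real" and i j
    assume \<phi>: "test_function \<Omega> \<phi>"
    have e: "(axis i 1 :: real ^ 'd) \<in> Basis" by (auto simp: Basis_vec_def)
    let ?d = "\<lambda>x. frechet_derivative \<phi> (at x) (axis i 1)"
    have L1: "L2_fun \<Omega> (\<lambda>x. ?d x *\<^sub>R (axis j 1 :: real ^ 'n))"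
      by (intro L2_fun_scaleR_const test_function_L2(2)[OF \<Omega>(1) \<phi> e])
    have L2: "L2_fun \<Omega> (\<lambda>x. \<phi> x *\<^sub>R (axis j (axis i 1) :: real ^ 'd ^ 'n))"
      by (intro L2_fun_scaleR_const test_function_L2(1)[OF \<Omega>(1) \<phi>])
    have "(\<lambda>n. L2_inner \<Omega> (u n) (\<lambda>x. ?d x *\<^sub>R axis j 1)) \<longlonglongrightarrow> L2_inner \<Omega> w (\<lambda>x. ?d x *\<^sub>R axis j 1)"
      by (rule L2_inner_tendsto[OF H1_L2[OF u] w(1) L1 w(2)])
    moreover have "(\<lambda>n. - L2_inner \<Omega> (weak_gradient \<Omega> (u n)) (\<lambda>x. \<phi> x *\<^sub>R axis j (axis i 1)))
        \<longlonglongrightarrow> - L2_inner \<Omega> G (\<lambda>x. \<phi> x *\<^sub>R axis j (axis i 1))"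
      by (intro tendsto_minus L2_inner_tendsto[OF H1_gradient_L2[OF u] G(1) L2 G(2)])
    moreover have "L2_inner \<Omega> (u n) (\<lambda>x. ?d x *\<^sub>R axis j 1) =
        - L2_inner \<Omega> (weak_gradient \<Omega> (u n)) (\<lambda>x. \<phi> x *\<^sub>R axis j (axis i 1))" for n
      using H1_has_weak_gradient[OF u[of n]] \<phi>
      by (simp add: has_L2_weak_gradient_def L2_inner_def inner_axis mult.commute)
    ultimately have "L2_inner \<Omega> w (\<lambda>x. ?d x *\<^sub>R axis j 1) = - L2_inner \<Omega> G (\<lambda>x. \<phi> x *\<^sub>R axis j (axis i 1))"
      using LIMSEQ_unique by simp
    then show "(LINT x|lebesgue_on \<Omega>. w x $ j * ?d x) = - (LINT x|lebesgue_on \<Omega>. G x $ j $ i * \<phi> x)"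
      by (simp add: L2_inner_def inner_axis mult.commute)
  qed
  then have wH: "w \<in> H1 \<Omega>" by (rule H1_I[OF w(1)])
  have ae: "AE x in lebesgue_on \<Omega>. weak_gradient \<Omega> (u n) x - weak_gradient \<Omega> w x = weak_gradient \<Omega> (u n) x - G x" for n
    using weak_gradient_AE[OF wH wG] by eventually_elim simp
  have "L2_dist_sq \<Omega> (weak_gradient \<Omega> (u n)) (weak_gradient \<Omega> w) =
     L2_dist_sq \<Omega> (weak_gradient \<Omega> (u n)) G" for n
    by (intro L2_inner_cong_AE ae L2_fun_diff H1_gradient_L2 u wH G(1))
  then have "H1_tendsto \<Omega> u w"
    using H1_tendsto_iff[OF u wH] tendsto_add[OF w(2) G(2)] by simp
  then show ?thesis by blast
qed

text \<open>Approximating test functions converge almost everywhere along a subsequence, so Fatou's lemma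
carries their \<open>L\<^sup>4\<close> bound over to the limit.\<close>

lemma H10_L4:
  assumes d: "CARD('d) \<le> 3"
  obtains K where "K \<ge> 0" "\<And>u :: real ^ 'd \<Rightarrow> real ^ 'n. u \<in> H10 \<Omega> \<Longrightarrow>
     integrable (lebesgue_on \<Omega>) (\<lambda>x. (norm (u x)) ^ 4) \<and>
     (LINT x|lebesgue_on \<Omega>. (norm (u x)) ^ 4) \<le> K * (dirichlet_form \<Omega> u u)\<^sup>2"
proof -
  obtain K where K: "K \<ge> 0" "\<And>\<phi> :: real ^ 'd \<Rightarrow> real ^ 'n. test_function \<Omega> \<phi> \<Longrightarrow>
    (\<integral>\<^sup>+x. ennreal ((norm (\<phi> x)) ^ 4) \<partial>lborel) \<le>
      ennreal K * (L2_sq_nn (classical_gradient \<phi>))\<^sup>2"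
    using L4_embedding_test_function[OF \<Omega>(2) d] by blast
  show ?thesis
  proof (rule that[OF K(1)])
    fix u :: "real ^ 'd \<Rightarrow> real ^ 'n" assume u: "u \<in> H10 \<Omega>"
    let ?M = "lebesgue_on \<Omega>"
    obtain \<phi> where \<phi>: "\<And>n. test_function \<Omega> (\<phi> n)" "H1_tendsto \<Omega> \<phi> u"
      using u by (auto simp: H10_def)
    note uH = H10_H1[OF u] and \<phi>H = test_function_H1[OF \<phi>(1)]
    note lims = H1_tendsto_parts[OF \<phi>(2)]
    have dlim: "(\<lambda>n. dirichlet_form \<Omega> (\<phi> n) (\<phi> n)) \<longlonglongrightarrow> dirichlet_form \<Omega> u u"
      unfolding dirichlet_form_def
      by (rule L2_inner_self_tendsto[OF H1_gradient_L2[OF \<phi>H] H1_gradient_L2[OF uH] lims(2)])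
    have [measurable]: "u \<in> borel_measurable ?M" "\<phi> n \<in> borel_measurable ?M" for n
      by (intro L2_fun_measurable H1_L2 uH \<phi>H)+
    have "\<exists>r::nat\<Rightarrow>nat. strict_mono r \<and> (AE x in ?M. (\<lambda>n. (norm (\<phi> (r n) x - u x))\<^sup>2) \<longlonglongrightarrow> 0)"
    proof (rule tendsto_L1_AE_subseq)
      show "integrable ?M (\<lambda>x. (norm (\<phi> n x - u x))\<^sup>2)" for n
        using L2_fun_diff[OF H1_L2[OF \<phi>H] H1_L2[OF uH]] by (simp add: L2_fun_def)
      show "(\<lambda>n. LINT x|?M. norm ((norm (\<phi> n x - u x))\<^sup>2)) \<longlonglongrightarrow> 0"
        using lims(1) by (simp add: L2_inner_self)
    qed
    then obtain r :: "nat \<Rightarrow> nat" where r: "strict_mono r" "AE x in ?M. (\<lambda>n. (norm (\<phi> (r n) x - u x))\<^sup>2) \<longlonglongrightarrow> 0"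
      by blast
    have nn: "(\<integral>\<^sup>+x. ennreal ((norm (\<phi> n x)) ^ 4) \<partial>?M) \<le> ennreal (K * (dirichlet_form \<Omega> (\<phi> n) (\<phi> n))\<^sup>2)" for n
    proof -
      have "\<phi> n x = 0" if "x \<notin> \<Omega>" for x using \<phi>(1)[of n] that unfolding test_function_def by blast
      then have "(\<integral>\<^sup>+x. ennreal ((norm (\<phi> n x)) ^ 4) \<partial>?M) = (\<integral>\<^sup>+x. ennreal ((norm (\<phi> n x)) ^ 4) \<partial>lborel)"
        using \<Omega>(1) by (intro nn_integral_lebesgue_on_support) auto
      also have "\<dots> \<le> ennreal K * (ennreal (dirichlet_form \<Omega> (\<phi> n) (\<phi> n)))\<^sup>2"
        using K(2)[OF \<phi>(1)] unfolding test_function_nn_integrals(2)[OF \<phi>(1)] .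
      also have "\<dots> = ennreal (K * (dirichlet_form \<Omega> (\<phi> n) (\<phi> n))\<^sup>2)"
        using K(1) by (simp add: ennreal_power ennreal_mult dirichlet_form_def)
      finally show ?thesis .
    qed
    have "(\<integral>\<^sup>+x. ennreal ((norm (u x)) ^ 4) \<partial>?M) = (\<integral>\<^sup>+x. liminf (\<lambda>n. ennreal ((norm (\<phi> (r n) x)) ^ 4)) \<partial>?M)"
    proof (rule nn_integral_cong_AE)
      show "AE x in ?M. ennreal ((norm (u x)) ^ 4) = liminf (\<lambda>n. ennreal ((norm (\<phi> (r n) x)) ^ 4))"
        using r(2)
      proof eventually_elim
        case (elim x)
        then have "(\<lambda>n. norm (\<phi> (r n) x - u x)) \<longlonglongrightarrow> 0" by (simp add: power_tendsto_0_iff)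
        then have "(\<lambda>n. \<phi> (r n) x) \<longlonglongrightarrow> u x" by (simp add: tendsto_norm_zero_iff LIM_zero_iff)
        then have "(\<lambda>n. ennreal ((norm (\<phi> (r n) x)) ^ 4)) \<longlonglongrightarrow> ennreal ((norm (u x)) ^ 4)"
          by (intro tendsto_intros)
        then show ?case by (rule lim_imp_Liminf[symmetric, rotated]) simp
      qed
    qed
    also have "\<dots> \<le> liminf (\<lambda>n. \<integral>\<^sup>+x. ennreal ((norm (\<phi> (r n) x)) ^ 4) \<partial>?M)"
      by (intro nn_integral_liminf) measurable
    also have "\<dots> \<le> liminf (\<lambda>n. ennreal (K * (dirichlet_form \<Omega> (\<phi> (r n)) (\<phi> (r n)))\<^sup>2))"
      by (intro Liminf_mono always_eventually allI nn)
    also have "\<dots> = ennreal (K * (dirichlet_form \<Omega> u u)\<^sup>2)"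
      using LIMSEQ_subseq_LIMSEQ[OF dlim r(1)]
      by (intro lim_imp_Liminf tendsto_intros) (auto simp: o_def)
    finally have le: "(\<integral>\<^sup>+x. ennreal ((norm (u x)) ^ 4) \<partial>?M) \<le> ennreal (K * (dirichlet_form \<Omega> u u)\<^sup>2)" .
    then have int: "integrable ?M (\<lambda>x. (norm (u x)) ^ 4)"
      by (intro integrableI_nonneg) (auto intro: le_less_trans)
    then have "ennreal (LINT x|?M. (norm (u x)) ^ 4) \<le> ennreal (K * (dirichlet_form \<Omega> u u)\<^sup>2)"
      using le by (subst (asm) nn_integral_eq_integral) auto
    then show "integrable ?M (\<lambda>x. (norm (u x)) ^ 4) \<and> (LINT x|?M. (norm (u x)) ^ 4) \<le> K * (dirichlet_form \<Omega> u u)\<^sup>2"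
      using int K(1) by simp
  qed
qed

text \<open>Test functions are chosen at distances tending to \<open>0\<close> from the given functions. When a
subsequence of them is Cauchy in \<open>L\<^sup>2\<close>, the given functions are Cauchy along the same indices.\<close>

lemma H10_rellich:
  fixes u :: "nat \<Rightarrow> real ^ 'd \<Rightarrow> real ^ 'n"
  assumes u: "\<And>n. u n \<in> H10 \<Omega>"
    and b0: "\<And>n. L2_inner \<Omega> (u n) (u n) \<le> B" and b1: "\<And>n. dirichlet_form \<Omega> (u n) (u n) \<le> B"
  obtains r :: "nat \<Rightarrow> nat" where "strict_mono r" "\<And>e. e > 0 \<Longrightarrow>
    \<exists>N. \<forall>m\<ge>N. \<forall>n\<ge>N. L2_dist_sq \<Omega> (u (r m)) (u (r n)) < e"
proof -
  note uH = H10_H1[OF u]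
  obtain \<phi> where \<phi>: "\<And>n. test_function \<Omega> (\<phi> n)" "\<And>n. H1_dist_sq \<Omega> (\<phi> n) (u n) < inverse (real (Suc n))"
    using H10_approx[of u, OF u] by blast
  have \<phi>1: "L2_dist_sq \<Omega> (\<phi> n) (u n) < inverse (real (Suc n))"
    and \<phi>2: "L2_dist_sq \<Omega> (weak_gradient \<Omega> (\<phi> n)) (weak_gradient \<Omega> (u n)) < inverse (real (Suc n))" for n
    using \<phi>(2)[of n] L2_inner_self_nonneg[of \<Omega> "\<lambda>x. \<phi> n x - u n x"]
      L2_inner_self_nonneg[of \<Omega> "\<lambda>x. weak_gradient \<Omega> (\<phi> n) x - weak_gradient \<Omega> (u n) x"] by linarith+
  note \<phi>H = test_function_H1[OF \<phi>(1)]
  have inv1: "inverse (real (Suc n)) \<le> 1" for n by (simp add: inverse_le_1_iff)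
  have "L2_inner \<Omega> (u 0) (u 0) \<ge> 0" by simp
  then have B: "B \<ge> 0" using b0[of 0] by linarith
  have B0: "L2_inner \<Omega> (\<phi> n) (\<phi> n) \<le> 2 + 2 * B" for n
    using L2_inner_add_sq_le[OF L2_fun_diff[OF H1_L2[OF \<phi>H] H1_L2[OF uH]] H1_L2[OF uH], of n n n]
      \<phi>1[of n] inv1[of n] b0[of n] by simp
  have B1: "dirichlet_form \<Omega> (\<phi> n) (\<phi> n) \<le> 2 + 2 * B" for n
    using L2_inner_add_sq_le[OF L2_fun_diff[OF H1_gradient_L2[OF \<phi>H] H1_gradient_L2[OF uH]] H1_gradient_L2[OF uH], of n n n]
      \<phi>2[of n] inv1[of n] b1[of n] unfolding dirichlet_form_def by simp
  have nn0: "L2_sq_nn (\<phi> n) \<le> ennreal (2 + 2 * B)" for n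
    unfolding test_function_nn_integrals(1)[OF \<phi>(1)] by (intro ennreal_leI B0)
  have nn1: "L2_sq_nn (classical_gradient (\<phi> n)) \<le> ennreal (2 + 2 * B)" for n
    unfolding test_function_nn_integrals(2)[OF \<phi>(1)] by (intro ennreal_leI B1)
  have B2: "0 \<le> 2 + 2 * B" using B by simp
  show ?thesis
  proof (rule rellich_test_functions[OF \<Omega> \<phi>(1) B2 nn0 nn1])
    fix r :: "nat \<Rightarrow> nat" assume r: "strict_mono r" "\<And>e. e > 0 \<Longrightarrow>
      \<exists>N. \<forall>m\<ge>N. \<forall>n\<ge>N. L2_sq_nn (\<lambda>x. \<phi> (r m) x - \<phi> (r n) x) \<le> ennreal e"
    show thesis
    proof (rule that[OF r(1)])
      fix e :: real assume e: "e > 0"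
      obtain N where N: "\<And>m n. m \<ge> N \<Longrightarrow> n \<ge> N \<Longrightarrow>
          L2_sq_nn (\<lambda>x. \<phi> (r m) x - \<phi> (r n) x) \<le> ennreal (e / 16)"
        using r(2)[of "e / 16"] e by auto
      obtain k where k: "inverse (real (Suc k)) < e / 16" using reals_Archimedean[of "e / 16"] e by auto
      have "L2_dist_sq \<Omega> (u (r m)) (u (r n)) < e"
        if mn: "m \<ge> max N k" "n \<ge> max N k" for m n
      proof -
        let ?u = "\<lambda>n. u (r n)" and ?p = "\<lambda>n. \<phi> (r n)"
        have small: "L2_dist_sq \<Omega> (?p i) (?u i) < e / 16" if "i \<ge> k" for i
        proof -
          have "r i \<ge> k" using seq_suble[OF r(1), of i] that by linarith
          then have "inverse (real (Suc (r i))) \<le> inverse (real (Suc k))" by (intro le_imp_inverse_le) auto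
          then show ?thesis using \<phi>1[of "r i"] k by linarith
        qed
        have "L2_dist_sq \<Omega> (?p m) (?p n) \<le> e / 16"
        proof -
          have "ennreal (L2_dist_sq \<Omega> (?p m) (?p n)) \<le> ennreal (e / 16)"
            using N[of m n] mn unfolding test_function_nn_integrals(1)[OF test_function_diff[OF \<phi>(1) \<phi>(1)]] by simp
          then show ?thesis using e by simp
        qed
        moreover have "L2_dist_sq \<Omega> (?u m) (?u n) \<le>
            2 * L2_dist_sq \<Omega> (?u m) (?p m) + 2 * L2_dist_sq \<Omega> (?p m) (?u n)"
          by (rule L2_inner_triangle_sq) (intro H1_L2 uH \<phi>H)+
        moreover have "L2_dist_sq \<Omega> (?p m) (?u n) \<le>
            2 * L2_dist_sq \<Omega> (?p m) (?p n) + 2 * L2_dist_sq \<Omega> (?p n) (?u n)"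
          by (rule L2_inner_triangle_sq) (intro H1_L2 uH \<phi>H)+
        moreover have "k \<le> m" "k \<le> n" using mn by simp_all
        ultimately show ?thesis
          using small[of m] small[of n] e L2_dist_sq_commute[of \<Omega> "?u m" "?p m"] by linarith
      qed
      then show "\<exists>N. \<forall>m\<ge>N. \<forall>n\<ge>N. L2_dist_sq \<Omega> (u (r m)) (u (r n)) < e"
        by blast
    qed
  qed
qed

end

section \<open>The cubic nonlinearity\<close>

definition L4_fun :: "'a::euclidean_space set \<Rightarrow> ('a \<Rightarrow> 'b::euclidean_space) \<Rightarrow> bool" where
  "L4_fun \<Omega> f \<longleftrightarrow> f \<in> borel_measurable (lebesgue_on \<Omega>) \<and> integrable (lebesgue_on \<Omega>) (\<lambda>x. (norm (f x)) ^ 4)"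

abbreviation L4_integral :: "'a::euclidean_space set \<Rightarrow> ('a \<Rightarrow> 'b::euclidean_space) \<Rightarrow> real" where
  "L4_integral \<Omega> u \<equiv> (LINT x|lebesgue_on \<Omega>. (norm (u x)) ^ 4)"

definition cubic_form :: "'a::euclidean_space set \<Rightarrow> ('a \<Rightarrow> 'b::euclidean_space) \<Rightarrow> ('a \<Rightarrow> 'b) \<Rightarrow> real" where
  "cubic_form \<Omega> u z = (LINT x|lebesgue_on \<Omega>. (norm (u x))\<^sup>2 * (u x \<bullet> z x))"

lemma cubic_integrable:
  assumes u: "L4_fun \<Omega> u" and z: "L4_fun \<Omega> z"
  shows "integrable (lebesgue_on \<Omega>) (\<lambda>x. (norm (u x))\<^sup>2 * (u x \<bullet> z x))"
proof (rule Bochner_Integration.integrable_bound)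
  show "integrable (lebesgue_on \<Omega>) (\<lambda>x. (norm (u x)) ^ 4 + (norm (z x)) ^ 4)"
    using u z by (auto simp: L4_fun_def)
  show "(\<lambda>x. (norm (u x))\<^sup>2 * (u x \<bullet> z x)) \<in> borel_measurable (lebesgue_on \<Omega>)"
    using u z by (auto simp: L4_fun_def)
  have "norm ((norm a)\<^sup>2 * (a \<bullet> b)) \<le> norm ((norm a) ^ 4 + (norm b) ^ 4)" for a b :: 'b
  proof -
    define m where "m = max (norm a) (norm b)"
    have m: "norm a \<le> m" "norm b \<le> m" "0 \<le> m" by (auto simp: m_def le_max_iff_disj)
    have "norm ((norm a)\<^sup>2 * (a \<bullet> b)) \<le> (norm a)\<^sup>2 * (norm a * norm b)"
      by (simp add: abs_mult mult_left_mono Cauchy_Schwarz_ineq2)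
    also have "\<dots> \<le> m\<^sup>2 * (m * m)" using m by (intro mult_mono power_mono) auto
    also have "\<dots> = m ^ 4" by (simp add: power4_eq_xxxx power2_eq_square)
    also have "\<dots> \<le> (norm a) ^ 4 + (norm b) ^ 4" by (auto simp: m_def max_def)
    finally show ?thesis by simp
  qed
  then show "AE x in lebesgue_on \<Omega>. norm ((norm (u x))\<^sup>2 * (u x \<bullet> z x)) \<le> norm ((norm (u x)) ^ 4 + (norm (z x)) ^ 4)"
    by simp
qed

lemma L2_inner_cubic:
  assumes "L4_fun \<Omega> u" "L4_fun \<Omega> z" "L2_fun \<Omega> v" "L2_fun \<Omega> z"
  shows "L2_inner \<Omega> (\<lambda>x. (\<alpha> * (norm (u x))\<^sup>2) *\<^sub>R u x - \<beta> *\<^sub>R v x) z = \<alpha> * cubic_form \<Omega> u z - \<beta> * L2_inner \<Omega> v z"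
proof -
  have "((\<alpha> * (norm (u x))\<^sup>2) *\<^sub>R u x - \<beta> *\<^sub>R v x) \<bullet> z x = \<alpha> * ((norm (u x))\<^sup>2 * (u x \<bullet> z x)) - \<beta> * (v x \<bullet> z x)" for x
    by (simp add: inner_diff_left)
  then show ?thesis
    using cubic_integrable[OF assms(1,2)] L2_integrable_inner[OF assms(3,4)]
    by (simp add: L2_inner_def cubic_form_def)
qed

lemma inner_le_half_sum: "a \<bullet> b \<le> ((norm a)\<^sup>2 + (norm b)\<^sup>2) / 2" for a b :: "'a::real_inner"
proof -
  have "0 \<le> (norm (a - b))\<^sup>2" by simp
  then show ?thesis by (simp add: power2_norm_eq_inner inner_simps inner_commute)
qed

text \<open>The map \<open>a \<mapsto> |a|\<^sup>2 a\<close> is monotone, being the gradient of the convex function \<open>|a|\<^sup>4 / 4\<close>. Both this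
and the tangent inequality below reduce to \<open>(|a|\<^sup>2 - |b|\<^sup>2)\<^sup>2 \<ge> 0\<close>.\<close>

lemma cubic_monotone_pointwise:
  fixes a b :: "'a::real_inner"
  shows "(norm b)\<^sup>2 * (b \<bullet> (a - b)) \<le> (norm a)\<^sup>2 * (a \<bullet> (a - b))"
proof -
  let ?p = "(norm a)\<^sup>2" and ?q = "(norm b)\<^sup>2"
  have "(?p + ?q) * (a \<bullet> b) \<le> (?p + ?q) * ((?p + ?q) / 2)"
    by (intro mult_left_mono inner_le_half_sum) simp
  moreover have "0 \<le> (?p - ?q)\<^sup>2" by simp
  ultimately show ?thesis
    by (simp add: inner_diff_right power2_norm_eq_inner[symmetric] inner_commute algebra_simps power2_eq_square)
qed

lemma cubic_convex_pointwise:
  fixes a b :: "'a::real_inner"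
  shows "((norm a) ^ 4 - (norm b) ^ 4) / 4 \<le> (norm a)\<^sup>2 * (a \<bullet> (a - b))"
proof -
  let ?p = "(norm a)\<^sup>2" and ?q = "(norm b)\<^sup>2"
  have p4: "(norm c) ^ 4 = (norm c)\<^sup>2 * (norm c)\<^sup>2" for c :: 'a by (simp add: power4_eq_xxxx power2_eq_square)
  have "?p * (a \<bullet> b) \<le> ?p * ((?p + ?q) / 2)"
    by (intro mult_left_mono inner_le_half_sum) simp
  also have "\<dots> = ?p * ?p / 2 + ?p * ?q / 2" by (simp add: field_simps)
  finally have 1: "?p * (a \<bullet> b) \<le> ?p * ?p / 2 + ?p * ?q / 2" .
  have "0 \<le> (?p - ?q)\<^sup>2" by simp
  also have "\<dots> = ?p * ?p - 2 * (?p * ?q) + ?q * ?q" by (simp add: power2_eq_square algebra_simps)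
  finally have 2: "0 \<le> ?p * ?p - 2 * (?p * ?q) + ?q * ?q" .
  have "?p * (a \<bullet> (a - b)) = ?p * ?p - ?p * (a \<bullet> b)"
    by (simp add: inner_diff_right power2_norm_eq_inner right_diff_distrib)
  moreover have "(?p * ?p - ?q * ?q) / 4 = ?p * ?p / 4 - ?q * ?q / 4" by (rule diff_divide_distrib)
  ultimately show ?thesis unfolding p4 using 1 2 by linarith
qed

text \<open>A form of continuity that integrates without Hoelder's inequality: a small multiple of a fixed
function plus a large multiple of \<open>|a - b|\<^sup>4\<close>. With \<open>M\<close> the larger of \<open>|b|\<close> and \<open>|z|\<close>, the first term
covers the case \<open>|a - b| \<le> t M\<close>, the second the opposite one.\<close>

lemma cubic_diff_le:
  fixes a b z :: "'a::real_inner"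
  assumes t: "0 < t" "t \<le> 1"
  shows "\<bar>(norm a)\<^sup>2 * (a \<bullet> z) - (norm b)\<^sup>2 * (b \<bullet> z)\<bar> \<le>
    9 * t * ((norm b) ^ 4 + (norm z) ^ 4) + 9 / t ^ 4 * (norm (a - b)) ^ 4"
proof -
  define M where "M = max (norm b) (norm z)"
  define s where "s = norm (a - b)"
  have M: "norm b \<le> M" "norm z \<le> M" "0 \<le> M" by (auto simp: M_def le_max_iff_disj)
  have s: "0 \<le> s" by (simp add: s_def)
  have a: "norm a \<le> M + s" using norm_triangle_ineq[of b "a - b"] M by (simp add: s_def)
  have "(norm a)\<^sup>2 * (a \<bullet> z) - (norm b)\<^sup>2 * (b \<bullet> z) = (norm a)\<^sup>2 * ((a - b) \<bullet> z) + ((norm a)\<^sup>2 - (norm b)\<^sup>2) * (b \<bullet> z)"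
    by (simp add: inner_diff_left algebra_simps)
  also have "\<bar>\<dots>\<bar> \<le> (norm a)\<^sup>2 * (s * norm z) + ((norm a + norm b) * s) * (norm b * norm z)"
  proof -
    have 1: "\<bar>(norm a)\<^sup>2 * ((a - b) \<bullet> z)\<bar> \<le> (norm a)\<^sup>2 * (s * norm z)"
      by (simp add: abs_mult s_def mult_left_mono Cauchy_Schwarz_ineq2)
    have "\<bar>norm a - norm b\<bar> \<le> s" unfolding s_def by (rule norm_triangle_ineq3)
    then have "\<bar>(norm a)\<^sup>2 - (norm b)\<^sup>2\<bar> \<le> (norm a + norm b) * s"
      by (simp add: power2_eq_square square_diff_square_factored abs_mult mult_left_mono)
    then have 2: "\<bar>((norm a)\<^sup>2 - (norm b)\<^sup>2) * (b \<bullet> z)\<bar> \<le> ((norm a + norm b) * s) * (norm b * norm z)"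
      unfolding abs_mult by (intro mult_mono Cauchy_Schwarz_ineq2) (auto simp: s)
    show ?thesis using 1 2 by linarith
  qed
  also have "\<dots> \<le> (M + s)\<^sup>2 * (s * M) + ((M + s + M) * s) * (M * M)"
    using M s a by (intro add_mono mult_mono power_mono) auto
  also have "\<dots> \<le> 9 * t * M ^ 4 + 9 / t ^ 4 * s ^ 4"
  proof (cases "s \<le> t * M")
    case True
    have sM: "s \<le> M" using True mult_right_mono[OF t(2) M(3)] by simp
    have "(M + s)\<^sup>2 * (s * M) + ((M + s + M) * s) * (M * M) \<le> (M + M)\<^sup>2 * ((t * M) * M) + ((M + M + M) * (t * M)) * (M * M)"
      using M s sM True t by (intro add_mono mult_mono power_mono) auto
    also have "\<dots> = 7 * (t * M ^ 4)" by (simp add: power2_eq_square power4_eq_xxxx algebra_simps)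
    also have "\<dots> \<le> 9 * (t * M ^ 4)" using t M by (intro mult_right_mono) auto
    finally show ?thesis using s t by (simp add: add_increasing2)
  next
    case False
    define q where "q = s / t"
    have q: "M \<le> q" "s \<le> q" "0 \<le> q"
      using False t s mult_left_mono[OF t(2) s] by (auto simp: q_def field_simps)
    have "(M + s)\<^sup>2 * (s * M) + ((M + s + M) * s) * (M * M) \<le> (q + q)\<^sup>2 * (q * q) + ((q + q + q) * q) * (q * q)"
      using M s q by (intro add_mono mult_mono power_mono) auto
    also have "\<dots> = 7 * q ^ 4" by (simp add: power2_eq_square power4_eq_xxxx algebra_simps)
    also have "\<dots> \<le> 9 * q ^ 4" by simp
    also have "\<dots> = 9 / t ^ 4 * s ^ 4" by (simp add: q_def power_divide)
    finally show ?thesis using t M by (simp add: add_increasing)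
  qed
  also have "\<dots> \<le> 9 * t * ((norm b) ^ 4 + (norm z) ^ 4) + 9 / t ^ 4 * s ^ 4"
  proof -
    have "M ^ 4 \<le> (norm b) ^ 4 + (norm z) ^ 4" by (auto simp: M_def max_def)
    then show ?thesis using t by (intro add_right_mono mult_left_mono) auto
  qed
  finally show ?thesis by (simp add: s_def)
qed

lemma cubic_form_tendsto:
  assumes v: "\<And>n. L4_fun \<Omega> (v n)" "L4_fun \<Omega> w" "L4_fun \<Omega> z"
    and d: "\<And>n. L4_fun \<Omega> (\<lambda>x. v n x - w x)"
    and lim: "(\<lambda>n. LINT x|lebesgue_on \<Omega>. (norm (v n x - w x)) ^ 4) \<longlonglongrightarrow> 0"
  shows "(\<lambda>n. cubic_form \<Omega> (v n) z) \<longlonglongrightarrow> cubic_form \<Omega> w z"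
proof (rule LIMSEQ_I)
  fix e :: real assume e: "e > 0"
  define A where "A = (LINT x|lebesgue_on \<Omega>. (norm (w x)) ^ 4 + (norm (z x)) ^ 4)"
  have A: "A \<ge> 0" unfolding A_def by (intro Bochner_Integration.integral_nonneg) simp
  define t where "t = min 1 (e / (18 * (A + 1)))"
  have t: "0 < t" "t \<le> 1" using e A by (auto simp: t_def)
  have "9 * t * A \<le> 9 * (e / (18 * (A + 1))) * A" using A by (intro mult_right_mono mult_left_mono) (auto simp: t_def)
  also have "\<dots> < e / 2 + 0" using e A by (simp add: field_simps)
  finally have tA: "9 * t * A < e / 2" by simp
  have "(\<lambda>n. 9 / t ^ 4 * L4_integral \<Omega> (\<lambda>x. v n x - w x)) \<longlonglongrightarrow> 9 / t ^ 4 * 0"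
    by (intro tendsto_intros lim)
  then have "\<forall>\<^sub>F n in sequentially. 9 / t ^ 4 * L4_integral \<Omega> (\<lambda>x. v n x - w x) < e / 2"
    using e by (intro order_tendstoD(2)) auto
  then obtain N where N: "\<And>n. n \<ge> N \<Longrightarrow> 9 / t ^ 4 * L4_integral \<Omega> (\<lambda>x. v n x - w x) < e / 2"
    by (auto simp: eventually_sequentially)
  have "norm (cubic_form \<Omega> (v n) z - cubic_form \<Omega> w z) < e" if n: "n \<ge> N" for n
  proof -
    let ?f = "\<lambda>x. (norm (v n x))\<^sup>2 * (v n x \<bullet> z x) - (norm (w x))\<^sup>2 * (w x \<bullet> z x)"
    have i1: "integrable (lebesgue_on \<Omega>) ?f" by (intro Bochner_Integration.integrable_diff cubic_integrable v)
    have i2: "integrable (lebesgue_on \<Omega>) (\<lambda>x. (norm (w x)) ^ 4 + (norm (z x)) ^ 4)"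
      "integrable (lebesgue_on \<Omega>) (\<lambda>x. (norm (v n x - w x)) ^ 4)"
      using v(2,3) d[of n] by (auto simp: L4_fun_def)
    have "cubic_form \<Omega> (v n) z - cubic_form \<Omega> w z = (LINT x|lebesgue_on \<Omega>. ?f x)"
      unfolding cubic_form_def by (intro Bochner_Integration.integral_diff[symmetric] cubic_integrable v)
    also have "norm \<dots> \<le> (LINT x|lebesgue_on \<Omega>. norm (?f x))" by (rule integral_norm_bound)
    also have "\<dots> \<le> (LINT x|lebesgue_on \<Omega>. 9 * t * ((norm (w x)) ^ 4 + (norm (z x)) ^ 4) + 9 / t ^ 4 * (norm (v n x - w x)) ^ 4)"
    proof (rule integral_mono)
      show "norm (?f x) \<le> 9 * t * ((norm (w x)) ^ 4 + (norm (z x)) ^ 4) + 9 / t ^ 4 * (norm (v n x - w x)) ^ 4" for x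
        unfolding real_norm_def by (rule cubic_diff_le[OF t])
      show "integrable (lebesgue_on \<Omega>) (\<lambda>x. norm (?f x))" by (rule integrable_norm[OF i1])
    qed (intro Bochner_Integration.integrable_add integrable_mult_right i2)
    also have "\<dots> = 9 * t * A + 9 / t ^ 4 * L4_integral \<Omega> (\<lambda>x. v n x - w x)"
      unfolding A_def using i2 by (subst Bochner_Integration.integral_add) (auto simp del: distrib_left_numeral)
    also have "\<dots> < e" using tA N[OF n] by linarith
    finally show ?thesis .
  qed
  then show "\<exists>no. \<forall>n\<ge>no. norm (cubic_form \<Omega> (v n) z - cubic_form \<Omega> w z) < e" by blast
qed

lemma cubic_form_monotone:
  assumes "L4_fun \<Omega> u" "L4_fun \<Omega> v" "L4_fun \<Omega> (\<lambda>x. u x - v x)"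
  shows "cubic_form \<Omega> v (\<lambda>x. u x - v x) \<le> cubic_form \<Omega> u (\<lambda>x. u x - v x)"
  unfolding cubic_form_def using assms
  by (intro integral_mono cubic_integrable cubic_monotone_pointwise)

lemma cubic_form_convex:
  assumes "L4_fun \<Omega> u" "L4_fun \<Omega> v" "L4_fun \<Omega> (\<lambda>x. u x - v x)"
  shows "(L4_integral \<Omega> u - L4_integral \<Omega> v) / 4
    \<le> cubic_form \<Omega> u (\<lambda>x. u x - v x)"
proof -
  have i: "integrable (lebesgue_on \<Omega>) (\<lambda>x. (norm (u x)) ^ 4)" "integrable (lebesgue_on \<Omega>) (\<lambda>x. (norm (v x)) ^ 4)"
    using assms by (auto simp: L4_fun_def)
  have "(L4_integral \<Omega> u - L4_integral \<Omega> v) / 4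
      = (LINT x|lebesgue_on \<Omega>. ((norm (u x)) ^ 4 - (norm (v x)) ^ 4) / 4)"
    using i by simp
  also have "\<dots> \<le> cubic_form \<Omega> u (\<lambda>x. u x - v x)"
    unfolding cubic_form_def using assms i
    by (intro integral_mono cubic_integrable cubic_convex_pointwise) auto
  finally show ?thesis .
qed

lemma H10_L4_fun:
  fixes u :: "real ^ 'd \<Rightarrow> real ^ 'n"
  assumes \<Omega>: "open \<Omega>" "bounded \<Omega>" and d: "CARD('d) \<le> 3" and u: "u \<in> H10 \<Omega>"
  shows "L4_fun \<Omega> u"
proof -
  have "integrable (lebesgue_on \<Omega>) (\<lambda>x. (norm (u x)) ^ 4)"
    by (rule H10_L4[OF \<Omega> d]) (use u in blast)
  then show ?thesis using L2_fun_measurable[OF H1_L2[OF H10_H1[OF u]]] by (simp add: L4_fun_def)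
qed

section \<open>Convergence of almost stationary sequences\<close>

lemma L2_inner_le_half_sum:
  assumes "L2_fun \<Omega> f" "L2_fun \<Omega> g"
  shows "L2_inner \<Omega> f g \<le> L2_inner \<Omega> f f / 2 + L2_inner \<Omega> g g / 2"
  using L2_inner_diff_diff[OF assms] L2_inner_self_nonneg[of \<Omega> "\<lambda>x. f x - g x"] by simp

text \<open>Along a subsequence that is Cauchy in \<open>L\<^sup>2\<close>, the difference of two equations is tested with the
difference \<open>z\<close> of the two functions. The cubic terms contribute a nonnegative quantity by
monotonicity, so the Dirichlet form of \<open>z\<close> is controlled by the \<open>L\<^sup>2\<close> norm of \<open>z\<close> and the
residuals. Hence the subsequence is Cauchy in \<open>H\<^sup>1\<close>.\<close>

lemma almost_stationary_compact:
  fixes \<Omega> :: "(real ^ 'd) set" and w R :: "nat \<Rightarrow> real ^ 'd \<Rightarrow> real ^ 'n"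
  assumes \<Omega>: "open \<Omega>" "bounded \<Omega>" and d: "CARD('d) \<le> 3" and \<alpha>: "\<alpha> > 0" and \<beta>: "\<beta> > 0"
    and w: "\<And>n. w n \<in> H10 \<Omega>" and b0: "\<And>n. L2_inner \<Omega> (w n) (w n) \<le> B"
    and b1: "\<And>n. dirichlet_form \<Omega> (w n) (w n) \<le> B"
    and R: "\<And>n. L2_fun \<Omega> (R n)" "(\<lambda>n. L2_inner \<Omega> (R n) (R n)) \<longlonglongrightarrow> 0"
    and eq: "\<And>n z. z \<in> H10 \<Omega> \<Longrightarrow> dirichlet_form \<Omega> (w n) z +
        L2_inner \<Omega> (\<lambda>x. (\<alpha> * (norm (w n x))\<^sup>2) *\<^sub>R w n x - \<beta> *\<^sub>R w n x) z = L2_inner \<Omega> (R n) z"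
  shows "\<exists>r v. strict_mono (r :: nat \<Rightarrow> nat) \<and> stationary_point \<Omega> \<alpha> \<beta> v \<and> H1_tendsto \<Omega> (\<lambda>n. w (r n)) v"
proof -
  obtain K where K: "K \<ge> 0" "\<And>u :: real ^ 'd \<Rightarrow> real ^ 'n. u \<in> H10 \<Omega> \<Longrightarrow>
     integrable (lebesgue_on \<Omega>) (\<lambda>x. (norm (u x)) ^ 4) \<and>
     L4_integral \<Omega> u \<le> K * (dirichlet_form \<Omega> u u)\<^sup>2"
  proof (rule H10_L4[OF \<Omega> d])
    fix K assume "0 \<le> K" "\<And>u :: real ^ 'd \<Rightarrow> real ^ 'n. u \<in> H10 \<Omega> \<Longrightarrow>
     integrable (lebesgue_on \<Omega>) (\<lambda>x. (norm (u x)) ^ 4) \<and>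
     L4_integral \<Omega> u \<le> K * (dirichlet_form \<Omega> u u)\<^sup>2"
    then show thesis by (rule that)
  qed
  have L2: "L2_fun \<Omega> u" if "u \<in> H10 \<Omega>" for u :: "real ^ 'd \<Rightarrow> real ^ 'n"
    using H1_L2[OF H10_H1[OF that]] .
  note L4 = H10_L4_fun[OF \<Omega> d]
  have eq': "dirichlet_form \<Omega> (w n) z + (\<alpha> * cubic_form \<Omega> (w n) z - \<beta> * L2_inner \<Omega> (w n) z) = L2_inner \<Omega> (R n) z"
    if "z \<in> H10 \<Omega>" for n z
    using eq[OF that, of n] unfolding L2_inner_cubic[OF L4[OF w] L4[OF that] L2[OF w] L2[OF that]] .
  show ?thesis
  proof (rule H10_rellich[OF \<Omega> w b0 b1])
    fix r :: "nat \<Rightarrow> nat"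
    assume r: "strict_mono r" and c0: "\<And>e. e > 0 \<Longrightarrow>
      \<exists>N. \<forall>m\<ge>N. \<forall>n\<ge>N. L2_dist_sq \<Omega> (w (r m)) (w (r n)) < e"
    define v where "v n = w (r n)" for n
    define S where "S n = R (r n)" for n
    have v: "v n \<in> H10 \<Omega>" for n by (simp add: v_def w)
    have S: "L2_fun \<Omega> (S n)" for n by (simp add: S_def R)
    have S0: "(\<lambda>n. L2_inner \<Omega> (S n) (S n)) \<longlonglongrightarrow> 0"
      using LIMSEQ_subseq_LIMSEQ[OF R(2) r] by (simp add: S_def o_def)
    have veq: "dirichlet_form \<Omega> (v n) z + (\<alpha> * cubic_form \<Omega> (v n) z - \<beta> * L2_inner \<Omega> (v n) z) = L2_inner \<Omega> (S n) z"
      if "z \<in> H10 \<Omega>" for n z using eq'[OF that] by (simp add: v_def S_def)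
    have key: "dirichlet_form \<Omega> (\<lambda>x. v m x - v n x) (\<lambda>x. v m x - v n x) \<le>
        (\<beta> + 1) * L2_dist_sq \<Omega> (v m) (v n) + L2_inner \<Omega> (S m) (S m) + L2_inner \<Omega> (S n) (S n)" for m n
    proof -
      let ?z = "\<lambda>x. v m x - v n x" and ?T = "\<lambda>x. S m x - S n x"
      have z: "?z \<in> H10 \<Omega>" by (rule H10_diff[OF \<Omega> v v])
      have T: "L2_fun \<Omega> ?T" by (rule L2_fun_diff[OF S S])
      have 1: "dirichlet_form \<Omega> ?z ?z = dirichlet_form \<Omega> (v m) ?z - dirichlet_form \<Omega> (v n) ?z"
        by (rule dirichlet_form_diff_left[OF \<Omega> H10_H1[OF v] H10_H1[OF v] H10_H1[OF z]])
      have 2: "L2_inner \<Omega> ?z ?z = L2_inner \<Omega> (v m) ?z - L2_inner \<Omega> (v n) ?z"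
        by (rule L2_inner_diff_left[OF L2[OF v] L2[OF v] L2[OF z]])
      have 3: "L2_inner \<Omega> ?T ?z = L2_inner \<Omega> (S m) ?z - L2_inner \<Omega> (S n) ?z"
        by (rule L2_inner_diff_left[OF S S L2[OF z]])
      have 4: "\<alpha> * cubic_form \<Omega> (v n) ?z \<le> \<alpha> * cubic_form \<Omega> (v m) ?z"
        using \<alpha> by (intro mult_left_mono cubic_form_monotone L4 v z) simp
      have 5: "L2_inner \<Omega> ?T ?z \<le> L2_inner \<Omega> ?T ?T / 2 + L2_inner \<Omega> ?z ?z / 2"
        by (rule L2_inner_le_half_sum[OF T L2[OF z]])
      have 6: "L2_inner \<Omega> ?T ?T \<le> 2 * L2_inner \<Omega> (S m) (S m) + 2 * L2_inner \<Omega> (S n) (S n)"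
        by (rule L2_inner_diff_sq_le[OF S S])
      have 7: "0 \<le> L2_inner \<Omega> ?z ?z" by simp
      have 8: "\<beta> * L2_inner \<Omega> ?z ?z = \<beta> * L2_inner \<Omega> (v m) ?z - \<beta> * L2_inner \<Omega> (v n) ?z"
        unfolding 2 by (simp add: right_diff_distrib)
      have "dirichlet_form \<Omega> ?z ?z \<le> \<beta> * L2_inner \<Omega> ?z ?z + L2_inner \<Omega> ?T ?z"
        using veq[OF z, of m] veq[OF z, of n] 1 3 4 8 by linarith
      also have "\<dots> \<le> \<beta> * L2_inner \<Omega> ?z ?z + L2_inner \<Omega> ?z ?z + L2_inner \<Omega> (S m) (S m) + L2_inner \<Omega> (S n) (S n)"
        using 5 6 7 by linarith
      finally show ?thesis by (simp add: distrib_right)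
    qed
    have c1: "\<exists>N. \<forall>m\<ge>N. \<forall>n\<ge>N. dirichlet_form \<Omega> (\<lambda>x. v m x - v n x) (\<lambda>x. v m x - v n x) < e" if e: "e > 0" for e
    proof -
      obtain N1 where N1: "\<And>m n. m \<ge> N1 \<Longrightarrow> n \<ge> N1 \<Longrightarrow> L2_dist_sq \<Omega> (v m) (v n) < e / 3 / (\<beta> + 1)"
        using c0[of "e / 3 / (\<beta> + 1)"] e \<beta> by (auto simp: v_def)
      have "\<forall>\<^sub>F n in sequentially. L2_inner \<Omega> (S n) (S n) < e / 3"
        using S0 e by (intro order_tendstoD(2)) auto
      then obtain N2 where N2: "\<And>n. n \<ge> N2 \<Longrightarrow> L2_inner \<Omega> (S n) (S n) < e / 3" by (auto simp: eventually_sequentially)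
      have "dirichlet_form \<Omega> (\<lambda>x. v m x - v n x) (\<lambda>x. v m x - v n x) < e" if "m \<ge> max N1 N2" "n \<ge> max N1 N2" for m n
      proof -
        have "(\<beta> + 1) * L2_dist_sq \<Omega> (v m) (v n) < e / 3"
        proof -
          have "0 < \<beta> + 1" using \<beta> by simp
          moreover have "L2_dist_sq \<Omega> (v m) (v n) < e / 3 / (\<beta> + 1)"
            by (rule N1) (use that in auto)
          ultimately have "(\<beta> + 1) * L2_dist_sq \<Omega> (v m) (v n) < (\<beta> + 1) * (e / 3 / (\<beta> + 1))"
            by (intro mult_strict_left_mono)
          also have "\<dots> = e / 3"
            using \<open>0 < \<beta> + 1\<close> by (subst times_divide_eq_right, subst nonzero_mult_div_cancel_left) auto
          finally show ?thesis .
        qed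
        then show ?thesis using key[of m n] N2[of m] N2[of n] that by simp
      qed
      then show ?thesis by blast
    qed
    obtain u where lim: "H1_tendsto \<Omega> v u"
      using H1_complete[OF \<Omega> H10_H1[OF v] c0[folded v_def] c1] by blast
    have u: "u \<in> H10 \<Omega>" by (rule H10_closed[OF \<Omega> v lim])
    note lims = H1_tendsto_parts[OF \<Omega> lim]
    have L4lim: "(\<lambda>n. LINT x|lebesgue_on \<Omega>. (norm (v n x - u x)) ^ 4) \<longlonglongrightarrow> 0"
    proof (rule tendsto_sandwich[OF _ _ tendsto_const])
      have "(\<lambda>n. K * (dirichlet_form \<Omega> (\<lambda>x. v n x - u x) (\<lambda>x. v n x - u x))\<^sup>2) \<longlonglongrightarrow> K * 0\<^sup>2"
        unfolding dirichlet_form_diff_diff[OF \<Omega> H10_H1[OF v] H10_H1[OF u]]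
        by (intro tendsto_intros lims(2))
      then show "(\<lambda>n. K * (dirichlet_form \<Omega> (\<lambda>x. v n x - u x) (\<lambda>x. v n x - u x))\<^sup>2) \<longlonglongrightarrow> 0" by simp
      show "\<forall>\<^sub>F n in sequentially. L4_integral \<Omega> (\<lambda>x. v n x - u x) \<le> K * (dirichlet_form \<Omega> (\<lambda>x. v n x - u x) (\<lambda>x. v n x - u x))\<^sup>2"
        using K(2)[OF H10_diff[OF \<Omega> v u]] by simp
    qed simp
    have "dirichlet_form \<Omega> u z + L2_inner \<Omega> (\<lambda>x. (\<alpha> * (norm (u x))\<^sup>2) *\<^sub>R u x - \<beta> *\<^sub>R u x) z = 0" if z: "z \<in> H10 \<Omega>" for z
    proof -
      have "(\<lambda>n. dirichlet_form \<Omega> (v n) z + (\<alpha> * cubic_form \<Omega> (v n) z - \<beta> * L2_inner \<Omega> (v n) z))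
          \<longlonglongrightarrow> dirichlet_form \<Omega> u z + (\<alpha> * cubic_form \<Omega> u z - \<beta> * L2_inner \<Omega> u z)"
        unfolding dirichlet_form_def
        by (intro tendsto_intros
            L2_inner_tendsto[OF H1_gradient_L2[OF H10_H1[OF v]] H1_gradient_L2[OF H10_H1[OF u]] H1_gradient_L2[OF H10_H1[OF z]] lims(2)]
            L2_inner_tendsto[OF L2[OF v] L2[OF u] L2[OF z] lims(1)]
            cubic_form_tendsto[OF L4[OF v] L4[OF u] L4[OF z] L4[OF H10_diff[OF \<Omega> v u]] L4lim])
      moreover have "(\<lambda>n. dirichlet_form \<Omega> (v n) z + (\<alpha> * cubic_form \<Omega> (v n) z - \<beta> * L2_inner \<Omega> (v n) z)) \<longlonglongrightarrow> 0"
      proof -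
        have zero: "L2_fun \<Omega> (\<lambda>x. 0 :: real ^ 'n)" by (simp add: L2_fun_def)
        have "(\<lambda>n. L2_inner \<Omega> (\<lambda>x. S n x - 0) (\<lambda>x. S n x - 0)) \<longlonglongrightarrow> 0" using S0 by simp
        from L2_inner_tendsto[OF S zero L2[OF z] this] show ?thesis
          unfolding veq[OF z] by (simp add: L2_inner_def)
      qed
      ultimately have "dirichlet_form \<Omega> u z + (\<alpha> * cubic_form \<Omega> u z - \<beta> * L2_inner \<Omega> u z) = 0"
        using LIMSEQ_unique by blast
      then show ?thesis unfolding L2_inner_cubic[OF L4[OF u] L4[OF z] L2[OF u] L2[OF z]] .
    qed
    then have "stationary_point \<Omega> \<alpha> \<beta> u" using u by (simp add: stationary_point_def)
    then show ?thesis using r lim unfolding v_def by blast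
  qed
qed

section \<open>Energy decay along the scheme\<close>

text \<open>The kinetic energy of the velocity \<open>(u - up) / \<tau>\<close> plus the energy of \<open>u\<close> up to its constant term
\<open>\<gamma> |\<Omega>|\<close>.\<close>

definition total_energy ::
    "(real ^ 'd) set \<Rightarrow> real \<Rightarrow> real \<Rightarrow> real \<Rightarrow> (real ^ 'd \<Rightarrow> real ^ 'n) \<Rightarrow> (real ^ 'd \<Rightarrow> real ^ 'n) \<Rightarrow> real" where
  "total_energy \<Omega> \<alpha> \<beta> \<tau> up u = L2_dist_sq \<Omega> u up / (2 * \<tau>\<^sup>2) +
     dirichlet_form \<Omega> u u / 2 + \<alpha> / 4 * L4_integral \<Omega> u - \<beta> / 2 * L2_inner \<Omega> u u"

context
  fixes \<Omega> :: "(real ^ 'd) set" and \<alpha> \<beta> \<tau> :: real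
  assumes \<Omega>: "open \<Omega>" "bounded \<Omega>" and d: "CARD('d) \<le> 3" and pos: "\<alpha> > 0" "\<beta> > 0" "\<tau> > 0"
begin

lemma cs_step_equation:
  fixes up u un :: "real ^ 'd \<Rightarrow> real ^ 'n"
  assumes step: "cs_step \<Omega> \<alpha> \<beta> \<tau> h up u un" and H: "up \<in> H10 \<Omega>" "u \<in> H10 \<Omega>" and z: "z \<in> H10 \<Omega>"
  shows "(1 / \<tau>\<^sup>2 + h / \<tau>) * L2_inner \<Omega> (\<lambda>x. un x - u x) z - 1 / \<tau>\<^sup>2 * L2_inner \<Omega> (\<lambda>x. u x - up x) z =
    - dirichlet_form \<Omega> un z - (\<alpha> * cubic_form \<Omega> un z - \<beta> * L2_inner \<Omega> u z)"
proof -
  note L2 = H1_L2[OF H10_H1]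
  have un: "un \<in> H10 \<Omega>" using step by (simp add: cs_step_def)
  have "(\<lambda>x. (un x - 2 *\<^sub>R u x + up x) /\<^sub>R \<tau>\<^sup>2 + h *\<^sub>R ((un x - u x) /\<^sub>R \<tau>))
      = (\<lambda>x. (1 / \<tau>\<^sup>2 + h / \<tau>) *\<^sub>R (un x - u x) - (1 / \<tau>\<^sup>2) *\<^sub>R (u x - up x))"
    by (rule ext) (simp add: algebra_simps divide_inverse scaleR_2)
  moreover have "L2_inner \<Omega> (\<lambda>x. (1 / \<tau>\<^sup>2 + h / \<tau>) *\<^sub>R (un x - u x) - (1 / \<tau>\<^sup>2) *\<^sub>R (u x - up x)) z =
      (1 / \<tau>\<^sup>2 + h / \<tau>) * L2_inner \<Omega> (\<lambda>x. un x - u x) z - 1 / \<tau>\<^sup>2 * L2_inner \<Omega> (\<lambda>x. u x - up x) z"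
  proof -
    have "L2_fun \<Omega> (\<lambda>x. un x - u x)" "L2_fun \<Omega> (\<lambda>x. u x - up x)" "L2_fun \<Omega> z"
      by (intro L2_fun_diff L2 un H z)+
    then show ?thesis by (simp only: L2_inner_diff_left L2_fun_scaleR L2_inner_scaleR_left)
  qed
  moreover have "L2_inner \<Omega> (\<lambda>x. (un x - 2 *\<^sub>R u x + up x) /\<^sub>R \<tau>\<^sup>2 + h *\<^sub>R ((un x - u x) /\<^sub>R \<tau>)) z =
      - dirichlet_form \<Omega> un z - L2_inner \<Omega> (\<lambda>x. (\<alpha> * (norm (un x))\<^sup>2) *\<^sub>R un x - \<beta> *\<^sub>R u x) z"
    using step z by (simp add: cs_step_def)
  ultimately show ?thesis
    using L2_inner_cubic[OF H10_L4_fun[OF \<Omega> d un] H10_L4_fun[OF \<Omega> d z] L2[OF H(2)] L2[OF z], of \<alpha> \<beta>] by simp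
qed

text \<open>The equation is tested with \<open>z = un - u\<close>. Kinetic, gradient and quartic parts of the energy are
convex and evaluated at the new iterate, so their tangent inequalities point the right way. The
quadratic part is evaluated at the old iterate, and the identity
\<open>2 u \<bullet> z = |un|\<^sup>2 - |u|\<^sup>2 - |z|\<^sup>2\<close> turns its concavity into the gain \<open>\<beta>/2 |z|\<^sup>2\<close>.\<close>

lemma cs_step_energy_decay:
  fixes up u un :: "real ^ 'd \<Rightarrow> real ^ 'n"
  assumes step: "cs_step \<Omega> \<alpha> \<beta> \<tau> h up u un" and H: "up \<in> H10 \<Omega>" "u \<in> H10 \<Omega>" and h: "h \<ge> 0"
  shows "total_energy \<Omega> \<alpha> \<beta> \<tau> u un + \<beta> / 2 * L2_dist_sq \<Omega> un u
    \<le> total_energy \<Omega> \<alpha> \<beta> \<tau> up u"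
proof -
  note L2 = H1_L2[OF H10_H1]
  let ?z = "\<lambda>x. un x - u x" and ?y = "\<lambda>x. u x - up x"
  have un: "un \<in> H10 \<Omega>" using step by (simp add: cs_step_def)
  have z: "?z \<in> H10 \<Omega>" by (rule H10_diff[OF \<Omega> un H(2)])
  have y: "L2_fun \<Omega> ?y" by (intro L2_fun_diff L2 H)
  define Z where "Z = L2_inner \<Omega> ?z ?z"
  define Y where "Y = L2_inner \<Omega> ?y ?y"
  have Z: "Z \<ge> 0" by (simp add: Z_def)
  have 1: "L2_inner \<Omega> ?y ?z \<le> Y / 2 + Z / 2"
    unfolding Y_def Z_def by (rule L2_inner_le_half_sum[OF y L2[OF z]])
  have kin: "Z / (2 * \<tau>\<^sup>2) - Y / (2 * \<tau>\<^sup>2) \<le> (1 / \<tau>\<^sup>2 + h / \<tau>) * Z - 1 / \<tau>\<^sup>2 * L2_inner \<Omega> ?y ?z"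
  proof -
    have "1 / \<tau>\<^sup>2 * L2_inner \<Omega> ?y ?z \<le> 1 / \<tau>\<^sup>2 * (Y / 2 + Z / 2)" using 1 by (intro mult_left_mono) auto
    moreover have "0 \<le> h / \<tau> * Z" using h pos Z by simp
    moreover have "1 / \<tau>\<^sup>2 * (Y / 2 + Z / 2) = Y / (2 * \<tau>\<^sup>2) + Z / (2 * \<tau>\<^sup>2)" "1 / \<tau>\<^sup>2 * Z = Z / (2 * \<tau>\<^sup>2) + Z / (2 * \<tau>\<^sup>2)"
      using pos by (simp_all add: field_simps)
    ultimately show ?thesis unfolding distrib_right by linarith
  qed
  have grad: "dirichlet_form \<Omega> un un / 2 - dirichlet_form \<Omega> u u / 2 \<le> dirichlet_form \<Omega> un ?z"
  proof -
    have "dirichlet_form \<Omega> un ?z = dirichlet_form \<Omega> ?z un"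
      by (simp only: dirichlet_form_def L2_inner_sym)
    also have "\<dots> = dirichlet_form \<Omega> un un - dirichlet_form \<Omega> u un"
      by (rule dirichlet_form_diff_left[OF \<Omega> H10_H1[OF un] H10_H1[OF H(2)] H10_H1[OF un]])
    finally show ?thesis
      using L2_inner_le_half_sum[OF H1_gradient_L2[OF H10_H1[OF H(2)]] H1_gradient_L2[OF H10_H1[OF un]]]
      by (simp add: dirichlet_form_def)
  qed
  have cub: "\<alpha> / 4 * L4_integral \<Omega> un - \<alpha> / 4 * L4_integral \<Omega> u
      \<le> \<alpha> * cubic_form \<Omega> un ?z"
    using mult_left_mono[OF cubic_form_convex[OF H10_L4_fun[OF \<Omega> d un] H10_L4_fun[OF \<Omega> d H(2)] H10_L4_fun[OF \<Omega> d z]], of \<alpha>] pos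
    by (simp add: algebra_simps)
  have conc: "\<beta> * L2_inner \<Omega> u ?z = \<beta> / 2 * L2_inner \<Omega> un un - \<beta> / 2 * L2_inner \<Omega> u u - \<beta> / 2 * Z"
  proof -
    have "L2_inner \<Omega> u ?z = L2_inner \<Omega> un u - L2_inner \<Omega> u u"
      using L2_inner_diff_left[OF L2[OF un] L2[OF H(2)] L2[OF H(2)]] L2_inner_sym[of \<Omega> u ?z] by simp
    then have half: "L2_inner \<Omega> u ?z = L2_inner \<Omega> un un / 2 - L2_inner \<Omega> u u / 2 - Z / 2"
      using L2_inner_diff_diff[OF L2[OF un] L2[OF H(2)]] unfolding Z_def by linarith
    show ?thesis unfolding half by (simp add: field_simps)
  qed
  from cs_step_equation[OF step H z] have
    "(1 / \<tau>\<^sup>2 + h / \<tau>) * Z - 1 / \<tau>\<^sup>2 * L2_inner \<Omega> ?y ?z = - dirichlet_form \<Omega> un ?z - (\<alpha> * cubic_form \<Omega> un ?z - \<beta> * L2_inner \<Omega> u ?z)"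
    by (simp only: Z_def)
  with kin grad cub conc show ?thesis unfolding total_energy_def Z_def[symmetric] Y_def[symmetric] by linarith
qed

text \<open>Completing the square, \<open>\<alpha>/4 s\<^sup>4 \<ge> \<beta> s\<^sup>2 - \<beta>\<^sup>2/\<alpha>\<close>: half of the quadratic term compensates the negative
term of the energy, and the other half bounds the \<open>L\<^sup>2\<close> norm.\<close>

lemma total_energy_lower_bound:
  fixes up u :: "real ^ 'd \<Rightarrow> real ^ 'n"
  assumes u: "u \<in> H10 \<Omega>"
  shows "dirichlet_form \<Omega> u u / 2 + \<beta> / 2 * L2_inner \<Omega> u u - \<beta>\<^sup>2 / \<alpha> * measure lebesgue \<Omega>
    \<le> total_energy \<Omega> \<alpha> \<beta> \<tau> up u"
proof -
  have \<Omega>m: "\<Omega> \<in> lmeasurable" using lmeasurable_open[OF \<Omega>(2,1)] .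
  have i4: "integrable (lebesgue_on \<Omega>) (\<lambda>x. (norm (u x)) ^ 4)" using H10_L4_fun[OF \<Omega> d u] by (simp add: L4_fun_def)
  have i2: "integrable (lebesgue_on \<Omega>) (\<lambda>x. (norm (u x))\<^sup>2)" using H1_L2[OF H10_H1[OF u]] by (simp add: L2_fun_def)
  have i0: "integrable (lebesgue_on \<Omega>) (\<lambda>x. \<beta>\<^sup>2 / \<alpha>)"
    by (intro finite_measure.integrable_const finite_measure_lebesgue_on \<Omega>m)
  have pt: "\<beta> * s\<^sup>2 - \<beta>\<^sup>2 / \<alpha> \<le> \<alpha> / 4 * s ^ 4" for s :: real
  proof -
    have "0 \<le> (\<alpha> * s\<^sup>2 - 2 * \<beta>)\<^sup>2" by simp
    then have "4 * \<alpha> * \<beta> * s\<^sup>2 - 4 * \<beta>\<^sup>2 \<le> \<alpha>\<^sup>2 * s ^ 4"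
      by (simp add: power2_eq_square power4_eq_xxxx algebra_simps)
    moreover have "\<beta> * s\<^sup>2 - \<beta>\<^sup>2 / \<alpha> = (4 * \<alpha> * \<beta> * s\<^sup>2 - 4 * \<beta>\<^sup>2) / (4 * \<alpha>)"
      "\<alpha> / 4 * s ^ 4 = (\<alpha>\<^sup>2 * s ^ 4) / (4 * \<alpha>)"
      using pos by (simp_all add: field_simps power2_eq_square)
    ultimately show ?thesis using pos by (simp only: divide_right_mono mult_nonneg_nonneg less_imp_le zero_le_numeral)
  qed
  have "\<beta> * L2_inner \<Omega> u u - \<beta>\<^sup>2 / \<alpha> * measure lebesgue \<Omega> = (LINT x|lebesgue_on \<Omega>. \<beta> * (norm (u x))\<^sup>2 - \<beta>\<^sup>2 / \<alpha>)"
    using i0 i2 \<Omega>m by (simp add: L2_inner_self measure_restrict_space fmeasurableD)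
  also have "\<dots> \<le> (LINT x|lebesgue_on \<Omega>. \<alpha> / 4 * (norm (u x)) ^ 4)"
    using i0 i2 i4 by (intro integral_mono pt Bochner_Integration.integrable_diff integrable_mult_right)
  also have "\<dots> = \<alpha> / 4 * L4_integral \<Omega> u" by simp
  finally have "\<beta> * L2_inner \<Omega> u u - \<beta>\<^sup>2 / \<alpha> * measure lebesgue \<Omega> \<le> \<alpha> / 4 * L4_integral \<Omega> u" .
  moreover have "0 \<le> L2_dist_sq \<Omega> u up / (2 * \<tau>\<^sup>2)" by simp
  ultimately show ?thesis unfolding total_energy_def by linarith
qed

end

theorem theorem2p4:
  fixes \<Omega> :: "(real ^ 'd) set"
    and u0 :: "real ^ 'd \<Rightarrow> real ^ 'n"
    and u :: "nat \<Rightarrow> real ^ 'd \<Rightarrow> real ^ 'n"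
    and \<alpha> \<beta> \<gamma> \<tau> \<omega> \<omega>\<^sub>0 :: real
    and \<eta> :: "nat \<Rightarrow> real"
  assumes "CARD('d) \<in> {1, 2, 3}"
    and "bounded_C2_domain \<Omega>"
    and "\<alpha> > 0" and "\<beta> > 0" and "\<gamma> > 0"
    and "\<tau> > 0"
    and "u0 \<in> H10 \<Omega>"
    and "\<omega> > 0" and "\<omega>\<^sub>0 > 0"
    and "\<forall>k\<ge>1. \<omega> / real k \<le> \<eta> k \<and> \<eta> k \<le> \<omega>\<^sub>0"
    and "cs_scheme \<Omega> \<alpha> \<beta> \<tau> \<eta> u0 (\<lambda>x. 0) u"
  shows "\<exists>r w. strict_mono r \<and> stationary_point \<Omega> \<alpha> \<beta> w \<and>
    H1_tendsto \<Omega> (\<lambda>n. u (r n)) w"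
proof -
  have \<Omega>: "open \<Omega>" "bounded \<Omega>" using assms(2) by (auto simp: bounded_C2_domain_def)
  have d: "CARD('d) \<le> 3" using assms(1) by auto
  note pos = assms(3,4,6)
  note L2 = H1_L2[OF H10_H1]
  \<comment> \<open>The vanishing initial velocity makes the ghost iterate equal to \<open>u 0\<close>.\<close>
  define p where "p k = (if k = 0 then u 0 else u (k - 1))" for k
  have u0: "u 0 = u0" using assms(11) by (simp add: cs_scheme_def)
  have step: "cs_step \<Omega> \<alpha> \<beta> \<tau> (\<eta> (k + 1)) (p k) (u k) (u (k + 1))" for k
  proof -
    have "cs_step \<Omega> \<alpha> \<beta> \<tau> (\<eta> (k + 1)) (if k = 0 then (\<lambda>x. u0 x - \<tau> *\<^sub>R 0) else u (k - 1)) (u k) (u (k + 1))"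
      using assms(11) unfolding cs_scheme_def by blast
    then show ?thesis by (cases "k = 0") (simp_all add: p_def u0)
  qed
  have u: "u k \<in> H10 \<Omega>" for k
  proof (cases k)
    case 0 then show ?thesis using u0 assms(7) by simp
  next
    case (Suc m) then show ?thesis using step[of m] by (simp add: cs_step_def)
  qed
  have p: "p k \<in> H10 \<Omega>" for k by (simp add: p_def u)
  have \<eta>: "0 \<le> \<eta> (k + 1)" "\<eta> (k + 1) \<le> \<omega>\<^sub>0" for k
  proof -
    have "\<omega> / real (k + 1) \<le> \<eta> (k + 1) \<and> \<eta> (k + 1) \<le> \<omega>\<^sub>0" using assms(10)[rule_format, of "k + 1"] by simp
    moreover have "0 \<le> \<omega> / real (k + 1)" using assms(8) by simp
    ultimately show "0 \<le> \<eta> (k + 1)" "\<eta> (k + 1) \<le> \<omega>\<^sub>0" by linarith+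
  qed
  define E where "E k = total_energy \<Omega> \<alpha> \<beta> \<tau> (p k) (u k)" for k
  define D where "D k = L2_dist_sq \<Omega> (u (k + 1)) (u k)" for k
  define C where "C = \<beta>\<^sup>2 / \<alpha> * measure lebesgue \<Omega>"
  have decay: "E (Suc k) + \<beta> / 2 * D k \<le> E k" for k
    using cs_step_energy_decay[OF \<Omega> d pos step p u \<eta>(1), of k] by (simp add: E_def D_def p_def)
  have lower: "dirichlet_form \<Omega> (u k) (u k) / 2 + \<beta> / 2 * L2_inner \<Omega> (u k) (u k) - C \<le> E k" for k
    unfolding E_def C_def by (rule total_energy_lower_bound[OF \<Omega> d pos u])
  have D: "D k \<ge> 0" for k by (simp add: D_def)
  have dir: "dirichlet_form \<Omega> (u k) (u k) \<ge> 0" for k by (simp add: dirichlet_form_def)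
  have dec: "decseq E"
  proof (rule decseq_SucI)
    fix k
    have "0 \<le> \<beta> / 2 * D k" using D[of k] pos by simp
    then show "E (Suc k) \<le> E k" using decay[of k] by linarith
  qed
  have Ebd: "- C \<le> E k" for k
  proof -
    have "0 \<le> \<beta> / 2 * L2_inner \<Omega> (u k) (u k)" using pos by simp
    then show ?thesis using lower[of k] dir[of k] by linarith
  qed
  then have "\<forall>k. - C \<le> E k" ..
  from decseq_convergent[OF dec this] obtain L where L: "E \<longlonglongrightarrow> L" by blast
  have D0: "D \<longlonglongrightarrow> 0"
  proof (rule tendsto_sandwich[OF _ _ tendsto_const])
    have "(\<lambda>k. 2 / \<beta> * (E k - E (Suc k))) \<longlonglongrightarrow> 2 / \<beta> * (L - L)"
      by (intro tendsto_intros L LIMSEQ_Suc)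
    then show "(\<lambda>k. 2 / \<beta> * (E k - E (Suc k))) \<longlonglongrightarrow> 0" by simp
    have "D k \<le> 2 / \<beta> * (E k - E (Suc k))" for k using decay[of k] pos by (simp add: field_simps)
    then show "\<forall>\<^sub>F k in sequentially. D k \<le> 2 / \<beta> * (E k - E (Suc k))" by simp
  qed (simp add: D)
  define Y where "Y k = L2_dist_sq \<Omega> (u k) (p k)" for k
  have Y0: "Y \<longlonglongrightarrow> 0"
  proof (rule LIMSEQ_imp_Suc)
    show "(\<lambda>k. Y (Suc k)) \<longlonglongrightarrow> 0" using D0 unfolding Y_def D_def p_def by simp
  qed
  define c where "c k = 1 / \<tau>\<^sup>2 + \<eta> (k + 1) / \<tau> + \<beta>" for k
  have c: "0 \<le> c k" "c k \<le> 1 / \<tau>\<^sup>2 + \<omega>\<^sub>0 / \<tau> + \<beta>" for k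
    using \<eta>[of k] pos by (auto simp: c_def divide_right_mono)
  \<comment> \<open>The residual of the Euler--Lagrange equation at \<open>u (k + 1)\<close>: the inertial and damping terms of the
    scheme, and \<open>- \<beta> (u (k + 1) - u k)\<close> for the explicit treatment of the quadratic term.\<close>
  define R where "R k x = (1 / \<tau>\<^sup>2) *\<^sub>R (u k x - p k x) - c k *\<^sub>R (u (k + 1) x - u k x)" for k x
  have RL: "L2_fun \<Omega> (R k)" for k
    unfolding R_def by (intro L2_fun_diff L2_fun_scaleR L2 u p)
  define M where "M = E 0 + C"
  have EM: "dirichlet_form \<Omega> (u k) (u k) / 2 + \<beta> / 2 * L2_inner \<Omega> (u k) (u k) \<le> M" for k
    using lower[of k] decseqD[OF dec, of 0 k] by (simp add: M_def)
  have "\<exists>r v. strict_mono (r :: nat \<Rightarrow> nat) \<and> stationary_point \<Omega> \<alpha> \<beta> v \<and> H1_tendsto \<Omega> (\<lambda>n. u (r n + 1)) v"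
  proof (rule almost_stationary_compact[OF \<Omega> d pos(1,2), of "\<lambda>n. u (n + 1)" "max (2 * M) (2 * M / \<beta>)" R])
    show "u (n + 1) \<in> H10 \<Omega>" for n by (rule u)
    show "L2_inner \<Omega> (u (n + 1)) (u (n + 1)) \<le> max (2 * M) (2 * M / \<beta>)" for n
    proof -
      have "\<beta> / 2 * L2_inner \<Omega> (u (n + 1)) (u (n + 1)) \<le> M" using EM[of "n + 1"] dir[of "n + 1"] by linarith
      then have "L2_inner \<Omega> (u (n + 1)) (u (n + 1)) \<le> 2 * M / \<beta>" using pos by (simp add: field_simps)
      then show ?thesis by simp
    qed
    show "dirichlet_form \<Omega> (u (n + 1)) (u (n + 1)) \<le> max (2 * M) (2 * M / \<beta>)" for n
    proof -
      have "0 \<le> \<beta> / 2 * L2_inner \<Omega> (u (n + 1)) (u (n + 1))" using pos by simp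
      then show ?thesis using EM[of "n + 1"] by linarith
    qed
    show "L2_fun \<Omega> (R n)" for n by (rule RL)
    show "(\<lambda>n. L2_inner \<Omega> (R n) (R n)) \<longlonglongrightarrow> 0"
    proof (rule tendsto_sandwich[OF _ _ tendsto_const])
      let ?c = "1 / \<tau>\<^sup>2 + \<omega>\<^sub>0 / \<tau> + \<beta>"
      have "(\<lambda>n. 2 * ((1 / \<tau>\<^sup>2)\<^sup>2 * Y n) + 2 * (?c\<^sup>2 * D n)) \<longlonglongrightarrow> 2 * ((1 / \<tau>\<^sup>2)\<^sup>2 * 0) + 2 * (?c\<^sup>2 * 0)"
        by (intro tendsto_intros Y0 D0)
      then show "(\<lambda>n. 2 * ((1 / \<tau>\<^sup>2)\<^sup>2 * Y n) + 2 * (?c\<^sup>2 * D n)) \<longlonglongrightarrow> 0" by simp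
      have "L2_inner \<Omega> (R n) (R n) \<le> 2 * ((1 / \<tau>\<^sup>2)\<^sup>2 * Y n) + 2 * (?c\<^sup>2 * D n)" for n
      proof -
        have sc: "L2_inner \<Omega> (\<lambda>x. a *\<^sub>R f x) (\<lambda>x. a *\<^sub>R f x) = a\<^sup>2 * L2_inner \<Omega> f f" for a and f :: "real ^ 'd \<Rightarrow> real ^ 'n"
          by (simp add: L2_inner_self power_mult_distrib)
        have "L2_inner \<Omega> (R n) (R n) \<le> 2 * ((1 / \<tau>\<^sup>2)\<^sup>2 * Y n) + 2 * ((c n)\<^sup>2 * D n)"
          unfolding R_def Y_def D_def sc[symmetric]
          by (rule L2_inner_diff_sq_le) (intro L2_fun_diff L2_fun_scaleR L2 u p)+
        also have "\<dots> \<le> 2 * ((1 / \<tau>\<^sup>2)\<^sup>2 * Y n) + 2 * (?c\<^sup>2 * D n)"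
          using c[of n] D[of n] by (intro add_left_mono mult_left_mono mult_right_mono power_mono) auto
        finally show ?thesis .
      qed
      then show "\<forall>\<^sub>F n in sequentially. L2_inner \<Omega> (R n) (R n) \<le> 2 * ((1 / \<tau>\<^sup>2)\<^sup>2 * Y n) + 2 * (?c\<^sup>2 * D n)" by simp
    qed simp
    fix n and z :: "real ^ 'd \<Rightarrow> real ^ 'n" assume z: "z \<in> H10 \<Omega>"
    let ?y = "\<lambda>x. u n x - p n x" and ?d = "\<lambda>x. u (n + 1) x - u n x"
    note L4 = H10_L4_fun[OF \<Omega> d]
    have Rz: "L2_inner \<Omega> (R n) z = 1 / \<tau>\<^sup>2 * L2_inner \<Omega> ?y z - c n * L2_inner \<Omega> ?d z"
      unfolding R_def
    proof -
      have "L2_fun \<Omega> ?y" "L2_fun \<Omega> ?d" "L2_fun \<Omega> z" by (intro L2_fun_diff L2 u p z)+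
      then show "L2_inner \<Omega> (\<lambda>x. (1 / \<tau>\<^sup>2) *\<^sub>R ?y x - c n *\<^sub>R ?d x) z = 1 / \<tau>\<^sup>2 * L2_inner \<Omega> ?y z - c n * L2_inner \<Omega> ?d z"
        by (simp only: L2_inner_diff_left L2_fun_scaleR L2_inner_scaleR_left)
    qed
    have dz: "\<beta> * L2_inner \<Omega> ?d z = \<beta> * L2_inner \<Omega> (u (n + 1)) z - \<beta> * L2_inner \<Omega> (u n) z"
      by (simp add: L2_inner_diff_left[OF L2[OF u] L2[OF u] L2[OF z]] right_diff_distrib)
    have "c n * L2_inner \<Omega> ?d z = (1 / \<tau>\<^sup>2 + \<eta> (n + 1) / \<tau>) * L2_inner \<Omega> ?d z + \<beta> * L2_inner \<Omega> ?d z"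
      unfolding c_def by (rule distrib_right)
    then show "dirichlet_form \<Omega> (u (n + 1)) z +
        L2_inner \<Omega> (\<lambda>x. (\<alpha> * (norm (u (n + 1) x))\<^sup>2) *\<^sub>R u (n + 1) x - \<beta> *\<^sub>R u (n + 1) x) z = L2_inner \<Omega> (R n) z"
      unfolding L2_inner_cubic[OF L4[OF u] L4[OF z] L2[OF u] L2[OF z]]
      using cs_step_equation[OF \<Omega> d pos step p u z, of n] Rz dz by linarith
  qed
  then obtain r v where "strict_mono (r :: nat \<Rightarrow> nat)" "stationary_point \<Omega> \<alpha> \<beta> v" "H1_tendsto \<Omega> (\<lambda>n. u (r n + 1)) v"
    by blast
  then show ?thesis
    by (intro exI[of _ "\<lambda>n. r n + 1"] exI[of _ v]) (auto simp: strict_mono_def)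
qed

end
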